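(* Let $U:\mathbb{R}^n\to\mathbb{R}$ be of class $C^2$, let $\Omega\subset\mathbb{R}^n$ be a connected component of $\{x\in\mathbb{R}^n:U(x)>0\}$, and assume that $\partial\Omega$ is compact and is the union of $N\geq 1$ distinct nonempty connected components $\Gamma_1,\ldots,\Gamma_N$, all of positive diameter. Assume: (a) $\Omega$ is bounded, $0\in\Omega$, and $U(-x)=U(x)$ for all $x\in\Omega$; (b) the set $P$ of critical points of $U$ contained in $\partial\Omega$ is finite (possibly empty) and every $p\in P$ is a hyperbolic critical point of $U$. Then there exist $\Gamma_+\in\{\Gamma_1,\ldots,\Gamma_N\}$, a number $T_+\in(0,+\infty)$ and a map $v^*:\mathbb{R}\to\overline{\Omega}$, periodic with period $T=4T_+$, such that $$\ddot v^*=\nabla U(v^* ),\qquad \tfrac12|\dot v^*|^2-U(v^* )=0,\qquad v^*(-t)=-v^*(t)\qquad\text{for all }t\in\mathbb{R},$$ and such that $v^*((0,T_+))\subset\Omega$ and $\lim_{t\to T_+^-}d(v^*(t),\Gamma_+)=0$.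
   Context: $d$ denotes Euclidean distance. A critical point $p$ of $U$ is hyperbolic if the Hessian of $U$ at $p$ is nonsingular. *)

theory Defs
  imports "HOL-Analysis.Analysis"
begin

definition gradient :: "(real ^ 'n \<Rightarrow> real) \<Rightarrow> real ^ 'n \<Rightarrow> real ^ 'n" where
  "gradient U x = (THE D. GDERIV U x :> D)"

definition hessian :: "(real ^ 'n \<Rightarrow> real) \<Rightarrow> real ^ 'n \<Rightarrow> real ^ 'n ^ 'n" where
  "hessian U x = jacobian (gradient U) (at x)"

definition class_C2 :: "(real ^ 'n \<Rightarrow> real) \<Rightarrow> bool" where
  "class_C2 U \<longleftrightarrow>
     (\<forall>x. U differentiable (at x)) \<and>
     (\<forall>x. gradient U differentiable (at x)) \<and>
     continuous_on UNIV (hessian U)"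

definition critical_point :: "(real ^ 'n \<Rightarrow> real) \<Rightarrow> real ^ 'n \<Rightarrow> bool" where
  "critical_point U p \<longleftrightarrow> gradient U p = 0"

definition hyperbolic_critical_point :: "(real ^ 'n \<Rightarrow> real) \<Rightarrow> real ^ 'n \<Rightarrow> bool" where
  "hyperbolic_critical_point U p \<longleftrightarrow> critical_point U p \<and> invertible (hessian U p)"

lemma gradient_eqI:
  assumes "GDERIV U x :> D"
  shows "gradient U x = D"
  unfolding gradient_def
proof (rule the_equality[where P = "\<lambda>D. GDERIV U x :> D", OF assms])
  fix E assume "GDERIV U x :> E"
  with assms have "(\<lambda>h. h \<bullet> E) = (\<lambda>h. h \<bullet> D)"
    unfolding gderiv_def by (rule has_derivative_unique[rotated])
  then show "E = D"
    by (metis vector_eq_ldot)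
qed

lemma GDERIV_gradient:
  assumes "U differentiable (at x)"
  shows "GDERIV U x :> gradient U x"
proof -
  obtain f' where f': "(U has_derivative f') (at x)"
    using assms by (auto simp: differentiable_def)
  interpret linear f'
    using f' by (rule has_derivative_linear)
  have "f' = (\<lambda>h. h \<bullet> adjoint f' 1)"
    using adjoint_works[OF linear_axioms, of _ 1] by (auto simp: fun_eq_iff)
  with f' have "GDERIV U x :> adjoint f' 1"
    by (simp add: gderiv_def)
  then show ?thesis
    using gradient_eqI by metis
qed

end

theory Submission
  imports Defs
begin

text \<open>
  Since \<open>U\<close> is even, it suffices to find an orbit of zero energy that leaves \<open>0\<close> and reaches the
  frontier in finite time: there its velocity vanishes, so it can be run backwards and then continued
  as an odd function. Such an orbit is a limit of minimizers of a discrete action. Fixing the number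
  \<open>N\<close> of steps, one minimizes (sum of the squared increments) times (sum of \<open>U + \<delta>\<close>), a discrete
  Maupertuis functional on a compact set, so that the step \<open>h\<close> comes out of the minimization and the
  mean energy is \<open>\<delta>\<close>; the discrete Euler-Lagrange equation keeps the energy of every single step
  close to \<open>\<delta>\<close>.

  The travel times \<open>N h\<close> stay bounded as \<open>\<delta>\<close> and \<open>h\<close> tend to \<open>0\<close>. The action is bounded, so a long
  minimizer contains a long stretch of small action, which must lie near a critical point on the
  frontier. The Hessian has a negative direction there, for otherwise hyperbolicity would make the
  critical point an isolated zero of \<open>U\<close>, that is, a component of the frontier of diameter zero.
  Perturbing the stretch in that direction decreases the action, a contradiction. Only pointwise limits
  of the curves and their velocities are needed, since the second-order expansions of the discrete
  solutions pass to the limit and yield the differential equation.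
\<close>

section \<open>The discrete Maupertuis functional\<close>

text \<open>The obstacle is that an orbit of zero energy may need infinite time to reach a critical
  point of the frontier, so that a limit of minimizers could be an asymptotic curve without a
  turning point; the second-order work serves to exclude this. The two small parameters have
  different tasks. As long as \<open>\<delta>\<close> is positive, time has a price, which bounds
  the travel time by a multiple of \<open>1 / \<delta>\<close>. For fixed \<open>\<delta>\<close>
  the step can then be made so small that the accumulated energy error stays below
  \<open>\<delta> / 2\<close>; this is why \<open>\<delta>\<close> is chosen before the number of
  steps. Only afterwards is a bound on the travel time derived that does not depend on
  \<open>\<delta>\<close>. Discretization reduces the existence of minimizers to the continuity of
  two finite sums on a product of compact sets. The constants \<open>G\<close>, \<open>M\<close> and
  \<open>Um\<close> bound the gradient, its Lipschitz constant and the potential; apart from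
  differentiability of \<open>U\<close> they carry all the regularity that the variational part
  uses.\<close>

locale potential_well =
  fixes U :: "'a::euclidean_space \<Rightarrow> real" and g :: "'a \<Rightarrow> 'a" and \<Omega> :: "'a set"
    and G M Um :: real
  assumes open_Omega: "open \<Omega>"
    and bounded_Omega: "bounded \<Omega>"
    and zero_in: "0 \<in> \<Omega>"
    and U_deriv: "\<And>x. (U has_derivative (\<lambda>h. g x \<bullet> h)) (at x)"
    and U_pos: "\<And>x. x \<in> \<Omega> \<Longrightarrow> U x > 0"
    and U_frontier: "\<And>x. x \<in> frontier \<Omega> \<Longrightarrow> U x = 0"
    and U_le: "\<And>x. x \<in> closure \<Omega> \<Longrightarrow> U x \<le> Um"
    and g_bound: "\<And>x. x \<in> closure \<Omega> \<Longrightarrow> norm (g x) \<le> G"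
    and g_lip: "\<And>x y. \<lbrakk>x \<in> closure \<Omega>; y \<in> closure \<Omega>\<rbrakk> \<Longrightarrow> norm (g y - g x) \<le> M * norm (y - x)"
    and U_lip: "\<And>x y. \<lbrakk>x \<in> closure \<Omega>; y \<in> closure \<Omega>\<rbrakk> \<Longrightarrow> \<bar>U y - U x\<bar> \<le> G * norm (y - x)"
    and U_taylor: "\<And>x y. \<lbrakk>x \<in> closure \<Omega>; y \<in> closure \<Omega>\<rbrakk>
          \<Longrightarrow> \<bar>U y - U x - g x \<bullet> (y - x)\<bar> \<le> M * (norm (y - x))\<^sup>2"
    and G_pos: "G > 0" and M_pos: "M > 0" and Um_pos: "Um > 0"
begin

lemma U_nonneg: "x \<in> closure \<Omega> \<Longrightarrow> U x \<ge> 0"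
  using U_pos U_frontier open_Omega
  by (metis DiffI closure_Un_frontier UnE less_imp_le order_refl)

lemma closure_cases: "x \<in> closure \<Omega> \<Longrightarrow> x \<in> \<Omega> \<or> x \<in> frontier \<Omega>"
  using closure_Un_frontier by auto

lemma frontier_in_closure: "x \<in> frontier \<Omega> \<Longrightarrow> x \<in> closure \<Omega>"
  by (simp add: frontier_def)

lemma Omega_in_closure: "x \<in> \<Omega> \<Longrightarrow> x \<in> closure \<Omega>"
  using closure_subset by blast

lemma frontier_notin: "x \<in> frontier \<Omega> \<Longrightarrow> x \<notin> \<Omega>"
  using open_Omega by (simp add: frontier_def interior_open)

lemma compact_closure_Omega: "compact (closure \<Omega>)"
  using bounded_Omega by simp

lemma continuous_on_U: "continuous_on S U"
  by (rule continuous_at_imp_continuous_on) (intro ballI has_derivative_continuous[OF U_deriv])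

text \<open>This provides a comparison curve: on the way to a nearest frontier point the segment
  cannot meet the frontier earlier, because such a point would be closer to
  \<open>0\<close>.\<close>

lemma nearest_frontier_point:
  obtains q where "q \<in> frontier \<Omega>" "q \<noteq> 0" "\<And>s. \<lbrakk>0 \<le> s; s \<le> 1\<rbrakk> \<Longrightarrow> s *\<^sub>R q \<in> closure \<Omega>"
proof -
  have "\<Omega> \<noteq> UNIV"
    using bounded_Omega not_bounded_UNIV by metis
  then have "frontier \<Omega> \<noteq> {}"
    using zero_in frontier_not_empty by blast
  then obtain q where q: "q \<in> frontier \<Omega>" "\<And>y. y \<in> frontier \<Omega> \<Longrightarrow> dist 0 q \<le> dist 0 y"
    using distance_attains_inf[of "frontier \<Omega>" 0] by auto
  show ?thesis
  proof (rule that)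
    show "q \<in> frontier \<Omega>" by fact
    show "q \<noteq> 0" using q(1) frontier_notin zero_in by blast
    fix s :: real assume s: "0 \<le> s" "s \<le> 1"
    show "s *\<^sub>R q \<in> closure \<Omega>"
    proof (cases "s = 1")
      case True
      then show ?thesis using q(1) frontier_in_closure by simp
    next
      case False
      have "s *\<^sub>R q \<in> \<Omega>"
      proof (rule ccontr)
        assume n: "s *\<^sub>R q \<notin> \<Omega>"
        have "closed_segment 0 (s *\<^sub>R q) \<inter> frontier \<Omega> \<noteq> {}"
          by (rule connected_Int_frontier) (use n zero_in in auto)
        then obtain u where u: "u \<in> closed_segment 0 (s *\<^sub>R q)" "u \<in> frontier \<Omega>" by auto
        have "norm u \<le> norm (s *\<^sub>R q)"
          using u(1) segment_bound1 by (metis diff_zero)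
        also have "\<dots> < norm q"
          using s False \<open>q \<noteq> 0\<close> by simp
        finally show False
          using q(2)[OF u(2)] by simp
      qed
      then show ?thesis by (rule Omega_in_closure)
    qed
  qed
qed

text \<open>All terms of the infinite sequence are confined to the closure, although only those up
  to \<open>N\<close> enter the sums. The admissible set is thus a closed subset of a product of
  compact sets, and Tychonoff's theorem applies.\<close>

definition admissible :: "nat \<Rightarrow> (nat \<Rightarrow> 'a) \<Rightarrow> bool" where
  "admissible N x \<longleftrightarrow> x 0 = 0 \<and> (\<forall>k. x k \<in> closure \<Omega>) \<and> x N \<in> frontier \<Omega>"

definition kin :: "nat \<Rightarrow> (nat \<Rightarrow> 'a) \<Rightarrow> real" where
  "kin N x = (\<Sum>k<N. (norm (x (Suc k) - x k))\<^sup>2)"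

definition pot :: "nat \<Rightarrow> real \<Rightarrow> (nat \<Rightarrow> 'a) \<Rightarrow> real" where
  "pot N \<delta> x = (\<Sum>k<N. U (x k) + \<delta>)"

text \<open>The Riemann sum with step \<open>h\<close> for the integral of
  \<open>|v'|^2 / 2 + U(v) + \<delta>\<close>.\<close>

definition action :: "nat \<Rightarrow> real \<Rightarrow> real \<Rightarrow> (nat \<Rightarrow> 'a) \<Rightarrow> real" where
  "action N \<delta> h x = kin N x / (2 * h) + h * pot N \<delta> x"

lemma kin_nonneg: "kin N x \<ge> 0"
  unfolding kin_def by (intro sum_nonneg) auto

lemma pot_ge: "admissible N x \<Longrightarrow> pot N \<delta> x \<ge> N * \<delta>"
proof -
  assume "admissible N x"
  then have "(\<Sum>k<N. \<delta>) \<le> pot N \<delta> x"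
    unfolding pot_def admissible_def by (intro sum_mono) (auto intro: U_nonneg)
  then show ?thesis by simp
qed

lemma kin_pos:
  assumes "admissible N x" shows "kin N x > 0"
proof (rule ccontr)
  assume "\<not> kin N x > 0"
  then have "kin N x = 0" using kin_nonneg[of N x] by linarith
  then have eq: "x (Suc k) = x k" if "k < N" for k
    using that unfolding kin_def by (simp add: sum_nonneg_eq_0_iff)
  have "x k = x 0" if "k \<le> N" for k
    using that by (induction k) (auto simp: eq)
  from this[of N] have "x N = 0" using assms by (simp add: admissible_def)
  then have "0 \<in> frontier \<Omega>" using assms by (simp add: admissible_def)
  then show False using frontier_notin zero_in by blast
qed

lemma compact_admissible: "compact {x. admissible N x}"
proof -
  have 1: "compact (PiE (UNIV :: nat set) (\<lambda>_. closure \<Omega>))"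
    by (metis compactin_PiE euclidean_product_topology compactin_euclidean_iff compact_closure_Omega)
  have 2: "closed {x :: nat \<Rightarrow> 'a. x 0 = 0}"
    by (intro closed_Collect_eq continuous_on_product_coordinates continuous_on_const)
  have 3: "closed {x :: nat \<Rightarrow> 'a. x N \<in> frontier \<Omega>}"
    using closed_vimage[OF frontier_closed continuous_on_product_coordinates] unfolding vimage_def .
  have "{x. admissible N x} = PiE UNIV (\<lambda>_. closure \<Omega>) \<inter> ({x. x 0 = 0} \<inter> {x. x N \<in> frontier \<Omega>})"
    unfolding admissible_def PiE_UNIV_domain Pi_def by blast
  then show ?thesis
    using compact_Int_closed[OF 1 closed_Int[OF 2 3]] by metis
qed

lemma continuous_on_U_coord: "continuous_on S (\<lambda>x :: nat \<Rightarrow> 'a. U (x k))"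
  by (rule continuous_on_compose2[OF continuous_on_U[of UNIV] continuous_on_subset[OF continuous_on_product_coordinates]]) auto

lemma continuous_on_kin_pot: "continuous_on S (\<lambda>x. kin N x * pot N \<delta> x)"
  unfolding kin_def pot_def
  by (intro continuous_intros continuous_on_U_coord continuous_on_subset[OF continuous_on_product_coordinates]) auto

text \<open>The bound does not depend on \<open>N\<close>, because \<open>N\<close> equal steps
  along a segment make \<open>kin\<close> of order \<open>1 / N\<close> and \<open>pot\<close> of
  order \<open>N\<close>.\<close>

lemma action_bound:
  obtains C where "C > 0"
    "\<And>N \<delta>. \<lbrakk>N \<ge> 1; 0 < \<delta>; \<delta> \<le> 1\<rbrakk> \<Longrightarrow> \<exists>x. admissible N x \<and> kin N x * pot N \<delta> x \<le> C"
proof -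
  obtain q where q: "q \<in> frontier \<Omega>" "q \<noteq> 0" "\<And>s. \<lbrakk>0 \<le> s; s \<le> 1\<rbrakk> \<Longrightarrow> s *\<^sub>R q \<in> closure \<Omega>"
    using nearest_frontier_point by blast
  show ?thesis
  proof (rule that)
    show "(norm q)\<^sup>2 * (Um + 1) > 0" using q Um_pos by simp
    fix N :: nat and \<delta> :: real assume N: "N \<ge> 1" and d: "0 < \<delta>" "\<delta> \<le> 1"
    \<comment> \<open>The cap at 1 parks the terms after \<open>N\<close> at \<open>q\<close>, since
      admissibility constrains them too.\<close>
    define x where "x k = min 1 (real k / real N) *\<^sub>R q" for k
    have adm: "admissible N x"
      unfolding admissible_def x_def using N q by auto
    have "(norm (x (Suc k) - x k))\<^sup>2 = (norm q)\<^sup>2 / (real N)\<^sup>2" if "k < N" for k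
    proof -
      have "min 1 (real (Suc k) / real N) = real (Suc k) / real N" "min 1 (real k / real N) = real k / real N"
        using that by (auto simp: min_def divide_simps)
      then have "x (Suc k) - x k = (1 / real N) *\<^sub>R q"
        unfolding x_def scaleR_left_diff_distrib[symmetric]
        by (simp add: diff_divide_distrib[symmetric])
      then show ?thesis by (simp add: power_divide)
    qed
    then have kin: "kin N x = (norm q)\<^sup>2 / real N"
      unfolding kin_def using N by (simp add: power2_eq_square)
    have "pot N \<delta> x \<le> (\<Sum>k<N. Um + 1)"
      unfolding pot_def using adm d unfolding admissible_def
      by (intro sum_mono add_mono U_le) auto
    then have "kin N x * pot N \<delta> x \<le> ((norm q)\<^sup>2 / real N) * (\<Sum>k<N. Um + 1)"
      unfolding kin by (intro mult_left_mono) auto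
    also have "\<dots> = (norm q)\<^sup>2 * (Um + 1)" using N by simp
    finally show "\<exists>x. admissible N x \<and> kin N x * pot N \<delta> x \<le> (norm q)\<^sup>2 * (Um + 1)"
      using adm by blast
  qed
qed

text \<open>Once a discrete curve has met the frontier it may rest there, since this increases neither sum.\<close>

lemma minimizer_with_tail:
  assumes "N \<ge> 1" "\<delta> > 0" "\<exists>x. admissible N x"
  obtains x K where "admissible N x" "\<And>y. admissible N y \<Longrightarrow> kin N x * pot N \<delta> x \<le> kin N y * pot N \<delta> y"
    "0 < K" "K \<le> N" "\<And>k. k < K \<Longrightarrow> x k \<in> \<Omega>" "\<And>k. k \<ge> K \<Longrightarrow> x k = x K" "x K \<in> frontier \<Omega>"
proof -
  obtain z where z: "admissible N z" "\<And>y. admissible N y \<Longrightarrow> kin N z * pot N \<delta> z \<le> kin N y * pot N \<delta> y"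
    using continuous_attains_inf[OF compact_admissible[of N] _ continuous_on_kin_pot[of _ N \<delta>]] assms(3)
    by auto
  \<comment> \<open>The first index on the frontier: all earlier points lie in the open set
    \<open>\<Omega>\<close>, where they can be varied freely.\<close>
  define K where "K = (LEAST k. z k \<in> frontier \<Omega>)"
  have zN: "z N \<in> frontier \<Omega>" using z(1) by (simp add: admissible_def)
  have zK: "z K \<in> frontier \<Omega>" unfolding K_def by (rule LeastI) (rule zN)
  have KN: "K \<le> N" unfolding K_def by (rule Least_le) (rule zN)
  have zk: "z k \<in> \<Omega>" if "k < K" for k
    using not_less_Least[of k "\<lambda>k. z k \<in> frontier \<Omega>"] that z(1) closure_cases
    unfolding K_def admissible_def by blast
  have K0: "0 < K"
    using zK z(1) zero_in frontier_notin unfolding admissible_def by (cases K) auto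
  define x where "x k = z (min k K)" for k
  have adm: "admissible N x"
    using z(1) KN zK unfolding admissible_def x_def by (auto simp: min_def)
  have "kin N x \<le> kin N z"
    unfolding kin_def x_def
  proof (intro sum_mono)
    fix k
    show "(norm (z (min (Suc k) K) - z (min k K)))\<^sup>2 \<le> (norm (z (Suc k) - z k))\<^sup>2"
      by (cases "k < K") (simp_all add: min_def)
  qed
  moreover have "pot N \<delta> x \<le> pot N \<delta> z"
    unfolding pot_def x_def
  proof (intro sum_mono)
    fix k
    show "U (z (min k K)) + \<delta> \<le> U (z k) + \<delta>"
      using U_frontier[OF zK] U_nonneg[of "z k"] z(1) by (auto simp: min_def admissible_def)
  qed
  moreover have "0 \<le> real N * \<delta>" using assms(2) by simp
  then have "0 \<le> pot N \<delta> x" using pot_ge[OF adm, of \<delta>] by linarith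
  ultimately have "kin N x * pot N \<delta> x \<le> kin N z * pot N \<delta> z"
    by (intro mult_mono kin_nonneg) simp_all
  then have min: "kin N x * pot N \<delta> x \<le> kin N y * pot N \<delta> y" if "admissible N y" for y
    using z(2)[OF that] by linarith
  show ?thesis
  proof (rule that[OF adm min K0 KN])
    show "x k \<in> \<Omega>" if "k < K" for k using zk[OF that] that by (simp add: x_def)
    show "x k = x K" if "k \<ge> K" for k using that by (simp add: x_def min_def)
    show "x K \<in> frontier \<Omega>" using zK by (simp add: x_def)
  qed
qed

text \<open>The step \<open>h\<close> is the optimal one for the given points, so that the arithmetic-geometric mean
  inequality turns a minimizer of the product into a minimizer of the action with fixed step.\<close>

lemma action_minimizer:
  assumes "admissible N x" "N \<ge> 1" "\<delta> > 0"
    and min: "\<And>y. admissible N y \<Longrightarrow> kin N x * pot N \<delta> x \<le> kin N y * pot N \<delta> y"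
  obtains h where "h > 0" "kin N x = 2 * h\<^sup>2 * pot N \<delta> x"
    "\<And>y. admissible N y \<Longrightarrow> action N \<delta> h x \<le> action N \<delta> h y"
proof -
  define A where "A = kin N x"
  define B where "B = pot N \<delta> x"
  have A: "A > 0" unfolding A_def by (rule kin_pos[OF assms(1)])
  have "0 < real N * \<delta>" using assms by simp
  then have B: "B > 0" unfolding B_def using pot_ge[OF assms(1), of \<delta>] by linarith
  define h where "h = sqrt (A / (2 * B))"
  have h: "h > 0" unfolding h_def using A B by simp
  have AB: "A = 2 * h\<^sup>2 * B" unfolding h_def using A B by simp
  have act: "action N \<delta> h x = 2 * h * B"
    using AB h unfolding action_def A_def[symmetric] B_def[symmetric] by (simp add: power2_eq_square)
  show ?thesis
  proof (rule that[OF h])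
    show "kin N x = 2 * h\<^sup>2 * pot N \<delta> x" using AB by (simp add: A_def B_def)
    fix y assume y: "admissible N y"
    define A' where "A' = kin N y"
    define B' where "B' = pot N \<delta> y"
    have B': "B' \<ge> 0" unfolding B'_def using pot_ge[OF y, of \<delta>] \<open>0 < real N * \<delta>\<close> by linarith
    have A': "A' \<ge> 0" unfolding A'_def by (rule kin_nonneg)
    have "(2 * h * B)\<^sup>2 = 2 * (A * B)"
      unfolding AB by (simp add: power2_eq_square)
    also have "\<dots> \<le> 2 * (A' * B')"
      using min[OF y] by (simp add: A_def B_def A'_def B'_def)
    also have "\<dots> = 4 * (A' / (2 * h)) * (h * B')" using h by simp
    also have "\<dots> \<le> (A' / (2 * h) + h * B')\<^sup>2"
    proof -
      have "0 \<le> (A' / (2 * h) - h * B')\<^sup>2" by simp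
      then show ?thesis unfolding power2_diff power2_sum by (simp only: mult.assoc)
    qed
    finally have "2 * h * B \<le> A' / (2 * h) + h * B'"
    proof (rule power2_le_imp_le)
      show "0 \<le> A' / (2 * h) + h * B'" using A' B' h by simp
    qed
    then show "action N \<delta> h x \<le> action N \<delta> h y"
      unfolding act unfolding action_def A'_def B'_def .
  qed
qed

end

section \<open>Euler-Lagrange equation and energy\<close>

text \<open>By \<open>kin_pot\<close> the kinetic and the potential part of the action are equal, so
  the quantity bounded in \<open>C_bound\<close> is the action itself. \<open>K\<close> is the index
  of arrival at the frontier; that it equals \<open>N\<close> has to be proved.\<close>

locale discrete_minimizer = potential_well +
  fixes N K :: nat and \<delta> h C :: real and x :: "nat \<Rightarrow> 'a"
  assumes delta_pos: "\<delta> > 0" and h_pos: "h > 0"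
    and adm: "admissible N x"
    and K_pos: "0 < K" and K_le: "K \<le> N"
    and x_Omega: "\<And>k. k < K \<Longrightarrow> x k \<in> \<Omega>"
    and x_tail: "\<And>k. K \<le> k \<Longrightarrow> x k = x K"
    and x_frontier: "x K \<in> frontier \<Omega>"
    and kin_pot: "kin N x = 2 * h\<^sup>2 * pot N \<delta> x"
    and minimal: "\<And>y. admissible N y \<Longrightarrow> action N \<delta> h x \<le> action N \<delta> h y"
    and C_bound: "2 * h * pot N \<delta> x \<le> C"
begin

lemma x_closure: "x k \<in> closure \<Omega>"
  using adm by (simp add: admissible_def)

definition vel :: "nat \<Rightarrow> 'a" where
  "vel k = (x (Suc k) - x k) /\<^sub>R h"

definition energy :: "nat \<Rightarrow> real" where
  "energy k = (norm (vel k))\<^sup>2 / 2 - U (x k)"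

text \<open>The sum of the one-step energy errors over the whole curve, with the bound
  \<open>C\<close> put in for the sum of \<open>h * (norm (vel k))\<^sup>2\<close>.\<close>

definition drift :: real where
  "drift = h * (G\<^sup>2 / 2 * (N * h) + M * C)"

lemma x_Suc: "x (Suc k) = x k + h *\<^sub>R vel k"
  unfolding vel_def using h_pos by simp

lemma action_upd:
  assumes "Suc j < N"
  shows "action N \<delta> h (x(Suc j := y)) =
     action N \<delta> h x + ((norm (y - x j))\<^sup>2 + (norm (x (Suc (Suc j)) - y))\<^sup>2
        - (norm (x (Suc j) - x j))\<^sup>2 - (norm (x (Suc (Suc j)) - x (Suc j)))\<^sup>2) / (2 * h)
      + h * (U y - U (x (Suc j)))"
proof -
  let ?z = "x(Suc j := y)"
  have "kin N ?z - kin N x = (\<Sum>k<N. (norm (?z (Suc k) - ?z k))\<^sup>2 - (norm (x (Suc k) - x k))\<^sup>2)"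
    unfolding kin_def by (simp only: sum_subtractf)
  also have "\<dots> = (\<Sum>k\<in>{j, Suc j}. (norm (?z (Suc k) - ?z k))\<^sup>2 - (norm (x (Suc k) - x k))\<^sup>2)"
    using assms by (intro sum.mono_neutral_right) auto
  also have "\<dots> = (norm (y - x j))\<^sup>2 + (norm (x (Suc (Suc j)) - y))\<^sup>2
        - (norm (x (Suc j) - x j))\<^sup>2 - (norm (x (Suc (Suc j)) - x (Suc j)))\<^sup>2"
    by simp
  finally have 1: "kin N ?z = kin N x + ((norm (y - x j))\<^sup>2 + (norm (x (Suc (Suc j)) - y))\<^sup>2
        - (norm (x (Suc j) - x j))\<^sup>2 - (norm (x (Suc (Suc j)) - x (Suc j)))\<^sup>2)" by linarith
  have "pot N \<delta> ?z - pot N \<delta> x = (\<Sum>k<N. (U (?z k) + \<delta>) - (U (x k) + \<delta>))"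
    unfolding pot_def by (simp only: sum_subtractf)
  also have "\<dots> = (\<Sum>k\<in>{Suc j}. (U (?z k) + \<delta>) - (U (x k) + \<delta>))"
    using assms by (intro sum.mono_neutral_right) auto
  also have "\<dots> = U y - U (x (Suc j))" by simp
  finally have 2: "pot N \<delta> ?z = pot N \<delta> x + (U y - U (x (Suc j)))" by linarith
  show ?thesis
    unfolding action_def 1 2 by (simp add: add_divide_distrib distrib_left)
qed

text \<open>The point lies in the open set \<open>\<Omega>\<close>, so every nearby replacement is
  admissible and the derivative of the action in this one point vanishes. \<open>F\<close> collects
  the terms of the action that contain it.\<close>

lemma euler_lagrange:
  assumes "Suc j < K"
  shows "x (Suc (Suc j)) - 2 *\<^sub>R x (Suc j) + x j = h\<^sup>2 *\<^sub>R g (x (Suc j))"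
proof -
  let ?a = "x j" and ?b = "x (Suc (Suc j))" and ?x = "x (Suc j)"
  define F where "F y = ((y - ?a) \<bullet> (y - ?a) + (?b - y) \<bullet> (?b - y)) / (2 * h) + h * U y" for y
  define F' where "F' v = (2 * ((?x - ?a) \<bullet> v) - 2 * ((?b - ?x) \<bullet> v)) / (2 * h) + h * (g ?x \<bullet> v)" for v
  have der: "(F has_derivative F') (at ?x)"
    unfolding F_def F'_def using h_pos
    by (auto intro!: derivative_eq_intros U_deriv simp: inner_commute fun_eq_iff divide_simps)
  have "F ?x \<le> F y" if "y \<in> \<Omega>" for y
  proof -
    have "admissible N (x(Suc j := y))"
      using adm that Omega_in_closure assms K_le by (auto simp: admissible_def)
    from minimal[OF this] show ?thesis
      using action_upd[of j y] assms K_le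
      unfolding F_def power2_norm_eq_inner[symmetric]
      by (simp add: add_divide_distrib diff_divide_distrib right_diff_distrib)
  qed
  then have "F' = (\<lambda>v. 0)"
    using differential_zero_maxmin[OF x_Omega[OF assms] open_Omega der] by blast
  then have "F' v = 0" for v by simp
  then have "((2 * h) * F' v) / 2 = 0" for v by simp
  moreover have "((2 * h) * F' v) / 2 = ((?x - ?a) - (?b - ?x) + h\<^sup>2 *\<^sub>R g ?x) \<bullet> v" for v
    unfolding F'_def using h_pos
    by (simp add: inner_add_left inner_diff_left power2_eq_square field_simps)
  ultimately have "(?x - ?a) - (?b - ?x) + h\<^sup>2 *\<^sub>R g ?x = 0"
    by (metis inner_eq_zero_iff)
  then show ?thesis by (simp add: algebra_simps scaleR_2)
qed

lemma vel_Suc: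
  assumes "Suc j < K"
  shows "vel (Suc j) = vel j + h *\<^sub>R g (x (Suc j))"
proof -
  have "h *\<^sub>R (vel (Suc j) - vel j) = h *\<^sub>R (h *\<^sub>R g (x (Suc j)))"
    using euler_lagrange[OF assms] h_pos
    by (simp add: vel_def scaleR_diff_right scaleR_2 algebra_simps power2_eq_square)
  then have "vel (Suc j) - vel j = h *\<^sub>R g (x (Suc j))"
    using h_pos by (simp only: scaleR_cancel_left) simp
  then show ?thesis by (simp add: algebra_simps)
qed

text \<open>As \<open>U\<close> is nonnegative, each step costs at least
  \<open>h * \<delta>\<close>. This bound on the travel time degenerates as \<open>\<delta>\<close>
  tends to 0.\<close>

lemma time_bound: "2 * (N * h) * \<delta> \<le> C"
proof -
  have "2 * h * (N * \<delta>) \<le> 2 * h * pot N \<delta> x"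
    using h_pos by (intro mult_left_mono pot_ge adm) auto
  then show ?thesis using C_bound by (simp add: algebra_simps)
qed

lemma kin_vel: "kin N x = h\<^sup>2 * (\<Sum>k<N. (norm (vel k))\<^sup>2)"
  unfolding kin_def sum_distrib_left by (simp add: x_Suc power_mult_distrib)

lemma sum_vel: "(\<Sum>k<N. h * (norm (vel k))\<^sup>2) \<le> C"
proof -
  have "h * (\<Sum>k<N. h * (norm (vel k))\<^sup>2) = h * (2 * h * pot N \<delta> x)"
    using kin_vel kin_pot h_pos by (simp add: sum_distrib_left[symmetric] power2_eq_square)
  then show ?thesis using h_pos C_bound by simp
qed

lemma sum_U: "(\<Sum>k<N. h * U (x k)) \<le> C"
proof -
  have "(\<Sum>k<N. U (x k)) \<le> pot N \<delta> x"
    unfolding pot_def using delta_pos by (intro sum_mono) auto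
  moreover have "0 \<le> (\<Sum>k<N. U (x k))"
    by (intro sum_nonneg U_nonneg x_closure)
  ultimately have "h * (\<Sum>k<N. U (x k)) \<le> 2 * h * pot N \<delta> x"
    using h_pos by (simp add: mult.assoc)
  then show ?thesis using C_bound by (simp add: sum_distrib_left)
qed

lemma C_nonneg: "C \<ge> 0"
  using time_bound delta_pos h_pos by (smt (verit) mult_nonneg_nonneg of_nat_0_le_iff)

text \<open>The recurrence for the velocity and the Taylor expansion of \<open>U\<close> both use
  the gradient at the new point, so the first-order changes of kinetic and potential energy cancel
  and only terms of order \<open>h\<^sup>2\<close> remain.\<close>

lemma drift_step:
  assumes "Suc j < K"
  shows "\<bar>energy (Suc j) - energy j\<bar> \<le> h * (G\<^sup>2 / 2 * h + M * (h * (norm (vel j))\<^sup>2))"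
proof -
  let ?x = "x (Suc j)" and ?p = "vel j" and ?g = "g (x (Suc j))"
  have xj: "x j - ?x = - (h *\<^sub>R ?p)" by (simp add: x_Suc)
  have "\<bar>U (x j) - U ?x - ?g \<bullet> (x j - ?x)\<bar> \<le> M * (norm (x j - ?x))\<^sup>2"
    by (intro U_taylor x_closure)
  then have 1: "\<bar>U (x j) - U ?x + h * (?g \<bullet> ?p)\<bar> \<le> M * (h\<^sup>2 * (norm ?p)\<^sup>2)"
    unfolding xj using h_pos by (simp add: power_mult_distrib)
  have 2: "(norm (vel (Suc j)))\<^sup>2 = (norm ?p)\<^sup>2 + 2 * h * (?g \<bullet> ?p) + h\<^sup>2 * (norm ?g)\<^sup>2"
    unfolding vel_Suc[OF assms] power2_norm_eq_inner
    by (simp add: inner_add_left inner_add_right inner_commute power2_eq_square algebra_simps)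
  have "(norm ?g)\<^sup>2 \<le> G\<^sup>2"
    by (intro power_mono g_bound x_closure) auto
  then have 3: "h\<^sup>2 * (norm ?g)\<^sup>2 \<le> h\<^sup>2 * G\<^sup>2" "0 \<le> h\<^sup>2 * (norm ?g)\<^sup>2"
    by (auto intro: mult_left_mono)
  have "\<bar>energy (Suc j) - energy j\<bar> \<le> h\<^sup>2 * G\<^sup>2 / 2 + M * (h\<^sup>2 * (norm ?p)\<^sup>2)"
    unfolding energy_def 2 using 1 3 by argo
  also have "\<dots> = h * (G\<^sup>2 / 2 * h + M * (h * (norm ?p)\<^sup>2))"
    by (simp add: power2_eq_square algebra_simps)
  finally show ?thesis .
qed

lemma energy_drift:
  assumes "i \<le> j" "j < K"
  shows "\<bar>energy j - energy i\<bar> \<le> drift"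
proof -
  let ?b = "\<lambda>k. h * (G\<^sup>2 / 2 * h + M * (h * (norm (vel k))\<^sup>2))"
  have b0: "0 \<le> ?b k" for k
    using h_pos M_pos by (simp add: add_nonneg_nonneg)
  have "energy j - energy i = (\<Sum>k\<in>{i..<j}. energy (Suc k) - energy k)"
    using assms by (simp add: sum_Suc_diff')
  then have "\<bar>energy j - energy i\<bar> \<le> (\<Sum>k\<in>{i..<j}. \<bar>energy (Suc k) - energy k\<bar>)"
    by simp
  also have "\<dots> \<le> (\<Sum>k\<in>{i..<j}. ?b k)"
    using assms by (intro sum_mono drift_step) auto
  also have "\<dots> \<le> (\<Sum>k<N. ?b k)"
    using assms K_le b0 by (intro sum_mono2) auto
  also have "\<dots> = h * (G\<^sup>2 / 2 * (N * h) + M * (\<Sum>k<N. h * (norm (vel k))\<^sup>2))"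
    by (simp add: sum_distrib_left[symmetric] sum.distrib)
  also have "\<dots> \<le> drift"
    unfolding drift_def using h_pos M_pos sum_vel
    by (intro mult_left_mono add_left_mono) auto
  finally show ?thesis .
qed

lemma energy_drift':
  assumes "i < K" "j < K"
  shows "\<bar>energy j - energy i\<bar> \<le> drift"
  using energy_drift[of i j] energy_drift[of j i] assms
  by (cases "i \<le> j") auto

text \<open>Optimality of the step \<open>h\<close> in terms of energies. Idle steps contribute no
  energy but are counted on the right, so the mean over the \<open>K\<close> moves is at least
  \<open>\<delta>\<close>, and equals \<open>\<delta>\<close> only if \<open>K = N\<close>. Hence
  the lower energy bound holds in general and the upper one only for \<open>K = N\<close>.\<close>

lemma sum_energy: "(\<Sum>k<K. energy k) = N * \<delta>"
proof -
  have v0: "vel k = 0" if "k \<ge> K" for k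
    unfolding vel_def using x_tail[of k] x_tail[of "Suc k"] that by simp
  have U0: "U (x k) = 0" if "k \<ge> K" for k
    using x_tail[OF that] U_frontier[OF x_frontier] by simp
  have "(\<Sum>k<K. (norm (vel k))\<^sup>2) = (\<Sum>k<N. (norm (vel k))\<^sup>2)"
    using K_le v0 by (intro sum.mono_neutral_left) auto
  also have "\<dots> = 2 * pot N \<delta> x"
    using kin_pot kin_vel h_pos by simp
  also have "pot N \<delta> x = (\<Sum>k<N. U (x k)) + N * \<delta>"
    unfolding pot_def by (simp add: sum.distrib)
  also have "(\<Sum>k<N. U (x k)) = (\<Sum>k<K. U (x k))"
    using K_le U0 by (intro sum.mono_neutral_right) auto
  finally show ?thesis
    unfolding energy_def by (simp add: sum_subtractf sum_divide_distrib[symmetric] add_divide_distrib)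
qed

lemma energy_lower:
  assumes "j < K" shows "energy j \<ge> \<delta> - drift"
proof (rule ccontr)
  assume n: "\<not> energy j \<ge> \<delta> - drift"
  have "(\<Sum>k<K. energy k) < (\<Sum>k<K. \<delta>)"
  proof (rule sum_strict_mono)
    fix k assume "k \<in> {..<K}"
    then show "energy k < \<delta>" using energy_drift'[of j k] assms n by auto
  qed (use K_pos in auto)
  also have "\<dots> \<le> N * \<delta>" using K_le delta_pos by simp
  finally show False using sum_energy by simp
qed

lemma energy_upper:
  assumes "K = N" "j < N" shows "energy j \<le> \<delta> + drift"
proof (rule ccontr)
  assume n: "\<not> energy j \<le> \<delta> + drift"
  have "(\<Sum>k<K. \<delta>) < (\<Sum>k<K. energy k)"
  proof (rule sum_strict_mono)
    fix k assume "k \<in> {..<K}"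
    then show "\<delta> < energy k" using energy_drift'[of j k] assms n by auto
  qed (use K_pos in auto)
  then show False using sum_energy assms by simp
qed

text \<open>A curve that rests before time \<open>N\<close> arrives with positive speed, so it gains by spending
  one of the idle steps on its last move.\<close>

lemma no_tail:
  assumes "drift \<le> \<delta> / 2" "(2 * G * h)\<^sup>2 < \<delta>"
  shows "K = N"
proof (rule ccontr)
  assume "K \<noteq> N"
  then have KN: "K < N" using K_le by simp
  obtain j where j: "K = Suc j" using K_pos by (cases K) auto
  let ?a = "x j" and ?q = "x K"
  define m where "m = midpoint ?a ?q"
  have a: "?a \<in> \<Omega>" using x_Omega j by simp
  have "?a \<noteq> ?q" using a x_frontier frontier_notin by metis
  have "energy j \<ge> \<delta> / 2" using energy_lower[of j] j assms by simp
  then have "(norm (vel j))\<^sup>2 \<ge> \<delta>"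
    using U_nonneg[OF x_closure, of j] unfolding energy_def by linarith
  then have "(2 * G * h)\<^sup>2 < (norm (vel j))\<^sup>2" using assms(2) by linarith
  then have v: "2 * G * h < norm (vel j)" by (rule power_less_imp_less_base) simp
  have "0 < 2 * G * h" using G_pos h_pos by simp
  then have vj: "0 < norm (vel j)" using v by linarith
  have dq: "norm (?q - ?a) = h * norm (vel j)" using h_pos by (simp add: j x_Suc)
  show False
  proof (cases "m \<in> closure \<Omega>")
    \<comment> \<open>Splitting the last move into halves saves
      \<open>(norm (?q - ?a))\<^sup>2 / (4 * h)\<close> and costs at most
      \<open>h * G * norm (?q - ?a) / 2\<close>. The saving is larger because the speed exceeds
      \<open>2 * G * h\<close>.\<close>
    case True
    then have "admissible N (x(Suc j := m))"
      using adm j KN by (auto simp: admissible_def)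
    from minimal[OF this] have 0: "0 \<le> ((norm (m - ?a))\<^sup>2 + (norm (?q - m))\<^sup>2 - (norm (?q - ?a))\<^sup>2) / (2 * h)
        + h * (U m - U ?q)"
      using action_upd[of j m] j KN x_tail[of "Suc K"] by simp
    have d1: "norm (m - ?a) = norm (?q - ?a) / 2"
      unfolding m_def using dist_midpoint(1)[of ?a ?q]
      by (simp add: dist_norm norm_minus_commute)
    have d2: "norm (?q - m) = norm (?q - ?a) / 2"
      unfolding m_def using dist_midpoint(2)[where a = ?a and b = ?q]
      by (simp only: dist_norm norm_minus_commute[of ?a ?q])
    have 1: "0 \<le> - (norm (?q - ?a))\<^sup>2 / (4 * h) + h * (U m - U ?q)"
      using 0 unfolding d1 d2 by (simp add: power_divide)
    have "U m - U ?q \<le> G * norm (m - ?q)"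
      using U_lip[OF x_closure True, of K] by simp
    then have "U m - U ?q \<le> G * (norm (?q - ?a) / 2)"
      unfolding norm_minus_commute[of m] d2 .
    then have "h * (U m - U ?q) \<le> h * (G * (norm (?q - ?a) / 2))"
      using h_pos by (intro mult_left_mono) auto
    also have "\<dots> = h * (2 * G * h) * (h * norm (vel j)) / (4 * h)"
      unfolding dq using h_pos by simp
    also have "\<dots> < h * norm (vel j) * (h * norm (vel j)) / (4 * h)"
      using h_pos v G_pos by (intro divide_strict_right_mono mult_strict_right_mono mult_strict_left_mono mult_pos_pos) (use vj in simp_all)
    also have "\<dots> = (norm (?q - ?a))\<^sup>2 / (4 * h)"
      unfolding dq by (simp add: power2_eq_square)
    finally show False using 1 by simp
  next
    \<comment> \<open>Now the move crosses the frontier before its midpoint. Ending the curve at the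
      crossing shortens the last move and leaves the potential part unchanged.\<close>
    case False
    then have "m \<notin> \<Omega>" using Omega_in_closure by blast
    then have "closed_segment ?a m \<inter> frontier \<Omega> \<noteq> {}"
      by (intro connected_Int_frontier) (use a in auto)
    then obtain q where q: "q \<in> closed_segment ?a m" "q \<in> frontier \<Omega>" by auto
    define z where "z k = (if k < K then x k else q)" for k
    have z: "admissible N z"
      using adm q frontier_in_closure K_pos KN by (auto simp: admissible_def z_def)
    have "norm (q - ?a) \<le> norm (m - ?a)"
      using q(1) by (metis segment_bound1 norm_minus_commute)
    also have "\<dots> = norm (?q - ?a) / 2"
      unfolding m_def using dist_midpoint(1)[of ?a ?q]
      by (simp add: dist_norm norm_minus_commute)
    also have "\<dots> < norm (?q - ?a)" using \<open>?a \<noteq> ?q\<close> by simp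
    finally have lt: "norm (q - ?a) < norm (?q - ?a)" .
    have "kin N z < kin N x"
      unfolding kin_def
    proof (rule sum_strict_mono_ex1)
      show "\<forall>k\<in>{..<N}. (norm (z (Suc k) - z k))\<^sup>2 \<le> (norm (x (Suc k) - x k))\<^sup>2"
      proof
        fix k
        consider "Suc k < K" | "k = j" | "K \<le> k" using j by linarith
        then show "(norm (z (Suc k) - z k))\<^sup>2 \<le> (norm (x (Suc k) - x k))\<^sup>2"
          by cases (use lt j in \<open>auto simp: z_def\<close>)
      qed
      show "\<exists>k\<in>{..<N}. (norm (z (Suc k) - z k))\<^sup>2 < (norm (x (Suc k) - x k))\<^sup>2"
        using lt j KN by (intro bexI[of _ j]) (auto simp: z_def intro: power_strict_mono)
    qed simp
    moreover have "pot N \<delta> z = pot N \<delta> x"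
      unfolding pot_def
    proof (intro sum.cong refl)
      fix k
      show "U (z k) + \<delta> = U (x k) + \<delta>"
        using x_tail[of k] U_frontier[OF x_frontier] U_frontier[OF q(2)] by (simp add: z_def)
    qed
    ultimately have "action N \<delta> h z < action N \<delta> h x"
      unfolding action_def using h_pos by (simp add: divide_strict_right_mono)
    then show False using minimal[OF z] by simp
  qed
qed

end

section \<open>Second variation\<close>

text \<open>The situation without idle steps. The locale of minimizers is instantiated with
  \<open>K = N\<close>, and \<open>drift_small\<close> puts the energy of every step between 0 and
  \<open>2 * \<delta>\<close>.\<close>

locale discrete_brake = discrete_minimizer U g \<Omega> G M Um N N \<delta> h C x
  for U :: "'a::euclidean_space \<Rightarrow> real" and g \<Omega> G M Um N \<delta> h C x +
  assumes drift_small: "h * (G\<^sup>2 / 2 * (N * h) + M * C) \<le> \<delta> / 2"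
    and delta_le: "\<delta> \<le> 1" and h_le: "h \<le> 1"
begin

lemma energy_bounds:
  assumes "j < N"
  shows "0 \<le> energy j" "energy j \<le> 2 * \<delta>"
  using energy_lower[OF assms] energy_upper[OF refl assms] drift_small delta_pos
  unfolding drift_def by linarith+

lemma speed: "j < N \<Longrightarrow> (norm (vel j))\<^sup>2 \<le> 2 * (U (x j) + 2 * \<delta>)"
  using energy_bounds[of j] unfolding energy_def by simp

lemma speed_le:
  assumes "j < N"
  shows "norm (vel j) \<le> sqrt (2 * (Um + 2))"
proof (rule real_le_rsqrt)
  show "(norm (vel j))\<^sup>2 \<le> 2 * (Um + 2)"
    using speed[OF assms] U_le[OF x_closure, of j] delta_le by simp
qed

text \<open>The action of the minimizer is compared with the sum of the actions of the two
  competitors obtained by shifting by \<open>s * \<phi> k\<close> along \<open>e\<close> and along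
  \<open>- e\<close>. The first-order terms cancel, so second differences of \<open>U\<close>
  suffice. For small \<open>s\<close> both competitors stay in \<open>\<Omega>\<close>, since only
  finitely many points of an open set are moved.\<close>

lemma second_variation:
  fixes \<phi> :: "nat \<Rightarrow> real"
  assumes \<phi>0: "\<phi> 0 = 0" "\<And>k. N \<le> k \<Longrightarrow> \<phi> k = 0" and \<phi>b: "\<And>k. \<bar>\<phi> k\<bar> \<le> b" and r: "r > 0"
    and e: "norm e = 1"
    and concave: "\<And>k s. \<lbrakk>\<phi> k \<noteq> 0; \<bar>s\<bar> < r\<rbrakk>
          \<Longrightarrow> U (x k + s *\<^sub>R e) + U (x k - s *\<^sub>R e) - 2 * U (x k) \<le> - \<mu> * s\<^sup>2"
  shows "h\<^sup>2 * \<mu> * (\<Sum>k<N. (\<phi> k)\<^sup>2) \<le> (\<Sum>k<N. (\<phi> (Suc k) - \<phi> k)\<^sup>2)"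
proof -
  define z where "z s k = x k + (s * \<phi> k) *\<^sub>R e" for s k
  have ev: "\<forall>\<^sub>F s in at_right 0. z s k \<in> \<Omega> \<and> z (- s) k \<in> \<Omega>" if "k < N" for k
  proof -
    have "((\<lambda>s. z s k) \<longlongrightarrow> x k + (0 * \<phi> k) *\<^sub>R e) (at_right 0)"
      "((\<lambda>s. z (- s) k) \<longlongrightarrow> x k + (- 0 * \<phi> k) *\<^sub>R e) (at_right 0)"
      unfolding z_def by (intro tendsto_intros)+
    then show ?thesis
      using topological_tendstoD[OF _ open_Omega] x_Omega[OF that]
      by (auto intro!: eventually_conj)
  qed
  have b: "b \<ge> 0" using \<phi>b[of 0] by linarith
  have "((\<lambda>s. s * b) \<longlongrightarrow> 0 * b) (at_right 0)" by (intro tendsto_intros)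
  then have "\<forall>\<^sub>F s in at_right 0. s * b < r"
    using r by (auto intro: order_tendstoD)
  moreover have "\<forall>\<^sub>F s in at_right (0::real). s > 0"
    by (simp add: eventually_at_right_less)
  moreover have "\<forall>\<^sub>F s in at_right 0. \<forall>k\<in>{..<N}. z s k \<in> \<Omega> \<and> z (- s) k \<in> \<Omega>"
    by (rule eventually_ball_finite) (use ev in auto)
  ultimately have "\<forall>\<^sub>F s in at_right 0. s * b < r \<and> s > 0 \<and> (\<forall>k\<in>{..<N}. z s k \<in> \<Omega> \<and> z (- s) k \<in> \<Omega>)"
    by eventually_elim auto
  then obtain s where s: "s * b < r" "s > 0" and z: "\<And>k. k < N \<Longrightarrow> z s k \<in> \<Omega> \<and> z (- s) k \<in> \<Omega>"
    using eventually_happens'[OF trivial_limit_at_right_real] by blast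
  have tail: "z t k = x k" if "N \<le> k" for t k
    using \<phi>0(2)[OF that] by (simp add: z_def)
  have "admissible N (z t)" if "t = s \<or> t = - s" for t
    unfolding admissible_def
  proof (intro conjI allI)
    show "z t 0 = 0" using adm \<phi>0 by (simp add: z_def admissible_def)
    show "z t N \<in> frontier \<Omega>" using x_frontier tail by simp
    show "z t k \<in> closure \<Omega>" for k
      using z[of k] tail[of k t] x_closure[of k] that Omega_in_closure by (cases "k < N") auto
  qed
  then have "action N \<delta> h x \<le> action N \<delta> h (z s)" "action N \<delta> h x \<le> action N \<delta> h (z (- s))"
    by (auto intro: minimal)
  then have "0 \<le> action N \<delta> h (z s) + action N \<delta> h (z (- s)) - 2 * action N \<delta> h x" by linarith
  also have "\<dots> = (kin N (z s) + kin N (z (- s)) - 2 * kin N x) / (2 * h)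
      + h * (pot N \<delta> (z s) + pot N \<delta> (z (- s)) - 2 * pot N \<delta> x)"
    unfolding action_def by (simp add: add_divide_distrib diff_divide_distrib algebra_simps)
  also have "kin N (z s) + kin N (z (- s)) - 2 * kin N x
      = (\<Sum>k<N. (norm (z s (Suc k) - z s k))\<^sup>2 + (norm (z (- s) (Suc k) - z (- s) k))\<^sup>2
          - 2 * (norm (x (Suc k) - x k))\<^sup>2)"
    unfolding kin_def by (simp add: sum.distrib sum_subtractf sum_distrib_left)
  also have "\<dots> = (\<Sum>k<N. 2 * s\<^sup>2 * (\<phi> (Suc k) - \<phi> k)\<^sup>2)"
  proof (intro sum.cong refl)
    fix k
    define a where "a = x (Suc k) - x k"
    define c where "c = s * (\<phi> (Suc k) - \<phi> k)"
    have "z s (Suc k) - z s k = a + c *\<^sub>R e" "z (- s) (Suc k) - z (- s) k = a - c *\<^sub>R e"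
      unfolding z_def a_def c_def by (simp_all add: algebra_simps)
    \<comment> \<open>Parallelogram law for a unit vector \<open>e\<close>.\<close>
    moreover have "(norm (a + c *\<^sub>R e))\<^sup>2 + (norm (a - c *\<^sub>R e))\<^sup>2 - 2 * (norm a)\<^sup>2 = 2 * c\<^sup>2"
      unfolding power2_norm_eq_inner using e
      by (simp add: inner_add_left inner_add_right inner_diff_left inner_diff_right inner_commute
          power2_eq_square norm_eq_1)
    ultimately show "(norm (z s (Suc k) - z s k))\<^sup>2 + (norm (z (- s) (Suc k) - z (- s) k))\<^sup>2
        - 2 * (norm (x (Suc k) - x k))\<^sup>2 = 2 * s\<^sup>2 * (\<phi> (Suc k) - \<phi> k)\<^sup>2"
      by (simp add: a_def c_def power_mult_distrib)
  qed
  also have "\<dots> = 2 * s\<^sup>2 * (\<Sum>k<N. (\<phi> (Suc k) - \<phi> k)\<^sup>2)"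
    by (simp add: sum_distrib_left)
  also have "pot N \<delta> (z s) + pot N \<delta> (z (- s)) - 2 * pot N \<delta> x
      = (\<Sum>k<N. U (z s k) + U (z (- s) k) - 2 * U (x k))"
    unfolding pot_def by (simp add: sum.distrib sum_subtractf sum_distrib_left)
  finally have "0 \<le> 2 * s\<^sup>2 * (\<Sum>k<N. (\<phi> (Suc k) - \<phi> k)\<^sup>2) / (2 * h)
      + h * (\<Sum>k<N. U (z s k) + U (z (- s) k) - 2 * U (x k))" .
  also have "\<dots> \<le> 2 * s\<^sup>2 * (\<Sum>k<N. (\<phi> (Suc k) - \<phi> k)\<^sup>2) / (2 * h) + h * (\<Sum>k<N. - \<mu> * (s * \<phi> k)\<^sup>2)"
  proof (intro add_left_mono mult_left_mono sum_mono)
    fix k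
    show "U (z s k) + U (z (- s) k) - 2 * U (x k) \<le> - \<mu> * (s * \<phi> k)\<^sup>2"
    proof (cases "\<phi> k = 0")
      case True
      then show ?thesis by (simp add: z_def)
    next
      case False
      have "\<bar>s * \<phi> k\<bar> \<le> s * b" using s \<phi>b[of k] by (simp add: abs_mult)
      then have "\<bar>s * \<phi> k\<bar> < r" using s by linarith
      from concave[OF False this] show ?thesis by (simp add: z_def)
    qed
  qed (use h_pos in simp)
  also have "\<dots> = s\<^sup>2 / h * ((\<Sum>k<N. (\<phi> (Suc k) - \<phi> k)\<^sup>2) - h\<^sup>2 * \<mu> * (\<Sum>k<N. (\<phi> k)\<^sup>2))"
  proof -
    have "(\<Sum>k<N. - \<mu> * (s * \<phi> k)\<^sup>2) = - \<mu> * s\<^sup>2 * (\<Sum>k<N. (\<phi> k)\<^sup>2)"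
      by (simp add: power_mult_distrib sum_distrib_left mult.assoc)
    moreover have "2 * s\<^sup>2 * A / (2 * h) + h * (- \<mu> * s\<^sup>2 * B) = s\<^sup>2 / h * (A - h\<^sup>2 * \<mu> * B)" for A B
      using h_pos by (simp add: right_diff_distrib power2_eq_square)
    ultimately show ?thesis by (simp only:)
  qed
  finally have "0 \<le> s\<^sup>2 / h * ((\<Sum>k<N. (\<phi> (Suc k) - \<phi> k)\<^sup>2) - h\<^sup>2 * \<mu> * (\<Sum>k<N. (\<phi> k)\<^sup>2))" .
  moreover have "s\<^sup>2 / h > 0" using s h_pos by simp
  ultimately have "0 \<le> (\<Sum>k<N. (\<phi> (Suc k) - \<phi> k)\<^sup>2) - h\<^sup>2 * \<mu> * (\<Sum>k<N. (\<phi> k)\<^sup>2)"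
    by (simp only: zero_le_mult_iff) linarith
  then show ?thesis by linarith
qed

text \<open>The perturbation is a tent of height \<open>2 n\<close> over the window, in the direction of concavity.\<close>

lemma no_long_stay:
  assumes "a + 4 * n \<le> N" "n > 0" "r > 0" "\<mu> > 0" "norm e = 1"
    and concave: "\<And>i s. \<lbrakk>i < 4 * n; \<bar>s\<bar> < r\<rbrakk>
      \<Longrightarrow> U (x (a + i) + s *\<^sub>R e) + U (x (a + i) - s *\<^sub>R e) - 2 * U (x (a + i)) \<le> - \<mu> * s\<^sup>2"
  shows "(h * n)\<^sup>2 * \<mu> \<le> 2"
proof -
  define \<phi> :: "nat \<Rightarrow> real" where
    "\<phi> k = (if a < k \<and> k < a + 4 * n then real (min (k - a) (a + 4 * n - k)) else 0)" for k
  have "h\<^sup>2 * \<mu> * (\<Sum>k<N. (\<phi> k)\<^sup>2) \<le> (\<Sum>k<N. (\<phi> (Suc k) - \<phi> k)\<^sup>2)"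
  proof (rule second_variation[where r = r and e = e])
    show "\<bar>\<phi> k\<bar> \<le> 4 * n" for k by (auto simp: \<phi>_def)
    show "\<phi> 0 = 0" by (simp add: \<phi>_def)
    show "\<phi> k = 0" if "N \<le> k" for k using that assms(1) by (simp add: \<phi>_def)
    fix k s assume k: "\<phi> k \<noteq> 0" and s: "\<bar>s :: real\<bar> < r"
    from k have "a < k" "k < a + 4 * n" by (auto simp: \<phi>_def split: if_splits)
    then show "U (x k + s *\<^sub>R e) + U (x k - s *\<^sub>R e) - 2 * U (x k) \<le> - \<mu> * s\<^sup>2"
      using concave[of "k - a" s] s by simp
  qed (use assms in auto)
  also have "(\<Sum>k<N. (\<phi> (Suc k) - \<phi> k)\<^sup>2) = (\<Sum>k\<in>{a..<a + 4 * n}. (\<phi> (Suc k) - \<phi> k)\<^sup>2)"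
    using assms(1) by (intro sum.mono_neutral_right) (auto simp: \<phi>_def)
  also have "\<dots> \<le> (\<Sum>k\<in>{a..<a + 4 * n}. 1)"
  proof (rule sum_mono)
    fix k assume "k \<in> {a..<a + 4 * n}"
    then have "\<bar>\<phi> (Suc k) - \<phi> k\<bar> \<le> 1"
      by (auto simp: \<phi>_def min_def)
    then show "(\<phi> (Suc k) - \<phi> k)\<^sup>2 \<le> 1" by (simp add: abs_square_le_1)
  qed
  also have "\<dots> = 4 * real n" by simp
  finally have 1: "h\<^sup>2 * \<mu> * (\<Sum>k<N. (\<phi> k)\<^sup>2) \<le> 4 * real n" .
  \<comment> \<open>On the middle half of the window the tent has height at least \<open>n\<close>,
    so the sum of squares is at least \<open>2 n^3\<close>, while slopes of modulus at most 1 give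
    at most \<open>4 n\<close> on the other side.\<close>
  have "2 * real n * (real n)\<^sup>2 = (\<Sum>k\<in>{a + n..<a + 3 * n}. (real n)\<^sup>2)" by simp
  also have "\<dots> \<le> (\<Sum>k\<in>{a + n..<a + 3 * n}. (\<phi> k)\<^sup>2)"
  proof (intro sum_mono power_mono)
    fix k assume "k \<in> {a + n..<a + 3 * n}"
    then show "real n \<le> \<phi> k" using assms(2) by (auto simp: \<phi>_def)
  qed simp
  also have "\<dots> \<le> (\<Sum>k<N. (\<phi> k)\<^sup>2)"
    using assms(1) by (intro sum_mono2) auto
  finally have "h\<^sup>2 * \<mu> * (2 * real n * (real n)\<^sup>2) \<le> h\<^sup>2 * \<mu> * (\<Sum>k<N. (\<phi> k)\<^sup>2)"
    using assms(4) by (intro mult_left_mono) auto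
  then have "h\<^sup>2 * \<mu> * (2 * real n * (real n)\<^sup>2) \<le> 4 * real n" using 1 by linarith
  then have "(2 * real n) * ((h * n)\<^sup>2 * \<mu>) \<le> (2 * real n) * 2"
    by (simp add: power_mult_distrib algebra_simps)
  then show ?thesis using assms(2) by (simp add: mult.commute)
qed

end

section \<open>Existence of discrete minimizers with small step and small mean energy\<close>

context potential_well
begin

text \<open>The step is an outcome of the minimization, not a choice. It is made small through
  \<open>N\<close>, because \<open>N * h\<close> is at most \<open>C / (2 * \<delta>)\<close>
  whatever the minimizer is. The constant \<open>C\<close> is the same for all
  \<open>\<epsilon>\<close>.\<close>

lemma ex_discrete_brake:
  obtains C where "\<And>\<epsilon>. \<epsilon> > 0 \<Longrightarrow> \<exists>N \<delta> h x. discrete_brake U g \<Omega> G M Um N \<delta> h C x \<and> h \<le> \<epsilon> \<and> \<delta> \<le> \<epsilon>"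
proof -
  obtain C0 where C0: "C0 > 0" "\<And>N \<delta>. \<lbrakk>N \<ge> 1; 0 < \<delta>; \<delta> \<le> 1\<rbrakk> \<Longrightarrow> \<exists>x. admissible N x \<and> kin N x * pot N \<delta> x \<le> C0"
    using action_bound by blast
  \<comment> \<open>The square of the minimal action is twice the minimal product, hence the
    root.\<close>
  define C where "C = sqrt (2 * C0)"
  have C: "C > 0" using C0 by (simp add: C_def)
  show ?thesis
  proof (rule that[of C])
    fix \<epsilon> :: real assume eps: "\<epsilon> > 0"
    define \<delta> where "\<delta> = min \<epsilon> 1"
    have d: "\<delta> > 0" "\<delta> \<le> 1" "\<delta> \<le> \<epsilon>" using eps by (auto simp: \<delta>_def)
    \<comment> \<open>With the a priori bound for \<open>N * h\<close> inserted, the energy drift is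
      at most \<open>h * c\<close>, where \<open>c\<close> is known before \<open>N\<close> is
      chosen.\<close>
    define c where "c = G\<^sup>2 / 2 * (C / (2 * \<delta>)) + M * C"
    have c: "c > 0" unfolding c_def using M_pos C d by (intro add_nonneg_pos) auto
    \<comment> \<open>The first two entries give the required size of \<open>h\<close>, the third
      makes the drift at most \<open>\<delta> / 2\<close>, and the fourth is the smallness of
      \<open>2 * G * h\<close> that excludes idle steps.\<close>
    define \<eta> where "\<eta> = min (min \<epsilon> 1) (min (\<delta> / (2 * c)) (sqrt \<delta> / (4 * G)))"
    have \<eta>: "\<eta> > 0" using eps d c G_pos by (simp add: \<eta>_def)
    obtain N0 :: nat where N0: "real N0 > C / (2 * \<delta> * \<eta>)" using reals_Archimedean2 by blast
    define N where "N = Suc N0"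
    have N: "N \<ge> 1" "real N > C / (2 * \<delta> * \<eta>)" using N0 by (auto simp: N_def)
    obtain x0 where x0: "admissible N x0" "kin N x0 * pot N \<delta> x0 \<le> C0" using C0(2)[of N \<delta>] N d by auto
    obtain x K where x: "admissible N x" "\<And>y. admissible N y \<Longrightarrow> kin N x * pot N \<delta> x \<le> kin N y * pot N \<delta> y"
      and K: "0 < K" "K \<le> N" "\<And>k. k < K \<Longrightarrow> x k \<in> \<Omega>" "\<And>k. k \<ge> K \<Longrightarrow> x k = x K" "x K \<in> frontier \<Omega>"
      using minimizer_with_tail[OF N(1) d(1)] x0 by metis
    obtain h where h: "h > 0" "kin N x = 2 * h\<^sup>2 * pot N \<delta> x"
      "\<And>y. admissible N y \<Longrightarrow> action N \<delta> h x \<le> action N \<delta> h y"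
      using action_minimizer[OF x(1) N(1) d(1) x(2)] by blast
    have "(2 * h * pot N \<delta> x)\<^sup>2 = 2 * (kin N x * pot N \<delta> x)"
      using h(2) by (simp add: power2_eq_square)
    also have "\<dots> \<le> 2 * C0" using x(2)[OF x0(1)] x0(2) by simp
    finally have bound: "2 * h * pot N \<delta> x \<le> C" unfolding C_def by (rule real_le_rsqrt)
    interpret D: discrete_minimizer U g \<Omega> G M Um N K \<delta> h C x
      by unfold_locales (fact d h x K bound)+
    have T: "real N * h \<le> C / (2 * \<delta>)"
      using D.time_bound d by (simp add: field_simps)
    have "C / (2 * \<delta>) < real N * \<eta>" using N(2) d \<eta> by (simp add: field_simps)
    then have "real N * h < real N * \<eta>" using T by linarith
    then have h\<eta>: "h < \<eta>" using N(1) by simp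
    then have hs: "h \<le> \<epsilon>" "h \<le> 1" "h < \<delta> / (2 * c)" "h < sqrt \<delta> / (4 * G)" by (auto simp: \<eta>_def)
    have "h * (G\<^sup>2 / 2 * (N * h) + M * C) \<le> h * c"
      unfolding c_def using T h(1) by (intro mult_left_mono add_right_mono) auto
    also have "\<dots> \<le> \<delta> / 2" using hs(3) c by (simp add: field_simps)
    finally have drift: "h * (G\<^sup>2 / 2 * (N * h) + M * C) \<le> \<delta> / 2" .
    have "0 \<le> 2 * G * h" using G_pos h(1) by simp
    moreover have "4 * G * h < sqrt \<delta>" using hs(4) G_pos by (simp add: field_simps)
    ultimately have "0 \<le> 2 * G * h" "2 * G * h < sqrt \<delta>" by linarith+
    then have "(2 * G * h)\<^sup>2 < (sqrt \<delta>)\<^sup>2" by (intro power_strict_mono) auto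
    then have "K = N" using D.no_tail drift d unfolding D.drift_def by auto
    then have "discrete_minimizer U g \<Omega> G M Um N N \<delta> h C x"
      using D.discrete_minimizer_axioms by simp
    then have "discrete_brake U g \<Omega> G M Um N \<delta> h C x"
      unfolding discrete_brake_def discrete_brake_axioms_def using drift hs d by auto
    then show "\<exists>N \<delta> h x. discrete_brake U g \<Omega> G M Um N \<delta> h C x \<and> h \<le> \<epsilon> \<and> \<delta> \<le> \<epsilon>"
      using hs d by blast
  qed
qed

end

section \<open>Bounded travel times\<close>

lemma (in potential_well) continuous_on_g: "continuous_on (closure \<Omega>) g"
proof (rule continuous_onI)
  fix y e :: real and x assume x: "x \<in> closure \<Omega>" and e: "e > 0"
  show "\<exists>d>0. \<forall>x'\<in>closure \<Omega>. dist x' x < d \<longrightarrow> dist (g x') (g x) \<le> e"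
  proof (intro exI[of _ "e / M"] conjI ballI impI)
    show "e / M > 0" using e M_pos by simp
    fix x' assume x': "x' \<in> closure \<Omega>" and d: "dist x' x < e / M"
    have "dist (g x') (g x) \<le> M * dist x' x"
      using g_lip[OF x x'] by (simp add: dist_norm)
    also have "\<dots> \<le> M * (e / M)" using d M_pos by (intro mult_left_mono) auto
    finally show "dist (g x') (g x) \<le> e" using M_pos by simp
  qed
qed

text \<open>Outside the balls around the critical frontier points, \<open>U + norm g\<close> is
  positive on a compact set and hence bounded below by some \<open>m > 0\<close>. Taking
  \<open>m / 3\<close> as bound for each summand rules such points out.\<close>

lemma (in potential_well) near_critical:
  assumes "\<rho> > 0"
  obtains \<kappa> where "\<kappa> > 0" "\<And>y. \<lbrakk>y \<in> closure \<Omega>; U y \<le> \<kappa>; norm (g y) \<le> \<kappa>\<rbrakk>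
     \<Longrightarrow> \<exists>p\<in>frontier \<Omega>. g p = 0 \<and> dist p y < \<rho>"
proof -
  define P where "P = {p \<in> frontier \<Omega>. g p = 0}"
  define S where "S = closure \<Omega> \<inter> (\<Inter>p\<in>P. - ball p \<rho>)"
  have "compact S"
    unfolding S_def by (intro compact_Int_closed compact_closure_Omega closed_INT) auto
  have cont: "continuous_on S (\<lambda>y. U y + norm (g y))"
    by (intro continuous_intros continuous_on_U continuous_on_subset[OF continuous_on_g]) (auto simp: S_def)
  have pos: "U y + norm (g y) > 0" if "y \<in> S" for y
  proof (rule ccontr)
    assume n: "\<not> U y + norm (g y) > 0"
    have y: "y \<in> closure \<Omega>" using that by (simp add: S_def)
    have "U y = 0" "norm (g y) = 0" using n U_nonneg[OF y] norm_ge_zero[of "g y"] by linarith+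
    then have "y \<in> P" using closure_cases[OF y] U_pos[of y] by (auto simp: P_def)
    then show False using that assms by (auto simp: S_def)
  qed
  have "\<exists>m>0. \<forall>y\<in>S. m \<le> U y + norm (g y)"
  proof (cases "S = {}")
    case False
    then show ?thesis using continuous_attains_inf[OF \<open>compact S\<close> _ cont] pos by blast
  qed (auto intro: exI[of _ 1])
  then obtain m where m: "m > 0" "\<And>y. y \<in> S \<Longrightarrow> m \<le> U y + norm (g y)" by blast
  show ?thesis
  proof (rule that)
    show "m / 3 > 0" using m by simp
    fix y assume y: "y \<in> closure \<Omega>" "U y \<le> m / 3" "norm (g y) \<le> m / 3"
    then have "y \<notin> S" using m(1) m(2)[of y] by linarith
    then show "\<exists>p\<in>frontier \<Omega>. g p = 0 \<and> dist p y < \<rho>"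
      using y(1) by (auto simp: S_def P_def)
  qed
qed

section \<open>Stretches of small action\<close>

context discrete_brake
begin

lemma vel_diff:
  assumes "a + i < N"
  shows "vel (a + i) - vel a = (\<Sum>k<i. h *\<^sub>R g (x (Suc (a + k))))"
  using assms by (induction i) (simp_all add: vel_Suc algebra_simps)

text \<open>A window on which kinetic and potential energy are small stays near a single point, at which
  \<open>U\<close> is small, and at which \<open>g\<close> is small because the velocity hardly changes.\<close>

lemma window:
  assumes a: "a + l \<le> N" and l: "2 \<le> l" and hl: "h * l \<le> \<Lambda>" and hl': "L \<le> h * real (l - 1)" and L: "L > 0"
    and small: "(\<Sum>i<l. h * (norm (vel (a + i)))\<^sup>2 + h * U (x (a + i))) \<le> \<sigma>"
  defines "D \<equiv> sqrt (\<Lambda> * \<sigma>)"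
  shows "\<And>i. i < l \<Longrightarrow> norm (x (a + i) - x a) \<le> D"
    and "U (x a) \<le> \<sigma> / L + G * D"
    and "norm (g (x a)) \<le> 2 * sqrt (2 * (\<sigma> / L + 2 * G * D + 2 * \<delta>)) / L + M * D"
proof -
  have U0: "0 \<le> h * U (x k)" for k using U_nonneg[OF x_closure, of k] h_pos by simp
  have v0: "0 \<le> h * (norm (vel k))\<^sup>2" for k using h_pos by simp
  have L0: "0 \<le> \<Lambda>" by (rule order_trans[OF _ hl]) (use h_pos in simp)
  show dist: "norm (x (a + i) - x a) \<le> D" if i: "i < l" for i
  proof -
    have xd: "x (a + i) - x a = (\<Sum>k<i. h *\<^sub>R vel (a + k))"
      by (induction i) (simp_all add: x_Suc algebra_simps)
    have "norm (x (a + i) - x a) \<le> (\<Sum>k<i. h * norm (vel (a + k)))"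
      unfolding xd using h_pos by (intro norm_sum[THEN order_trans]) (simp add: abs_of_pos)
    then have "(norm (x (a + i) - x a))\<^sup>2 \<le> (\<Sum>k<i. h * norm (vel (a + k)))\<^sup>2"
      by (intro power_mono) auto
    also have "\<dots> \<le> (\<Sum>k<i. (h * norm (vel (a + k)))\<^sup>2) * (\<Sum>k<i. 1\<^sup>2)"
      using Cauchy_Schwarz_ineq_sum[of "\<lambda>k. h * norm (vel (a + k))" "\<lambda>_. 1" "{..<i}"] by simp
    also have "(\<Sum>k<i. (h * norm (vel (a + k)))\<^sup>2) = h * (\<Sum>k<i. h * (norm (vel (a + k)))\<^sup>2)"
      by (simp add: power_mult_distrib sum_distrib_left power2_eq_square mult_ac)
    also have "h * (\<Sum>k<i. h * (norm (vel (a + k)))\<^sup>2) * (\<Sum>k<i. 1\<^sup>2)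
        = (h * real i) * (\<Sum>k<i. h * (norm (vel (a + k)))\<^sup>2)"
      by simp
    also have "\<dots> \<le> \<Lambda> * \<sigma>"
    proof (rule mult_mono)
      show "h * real i \<le> \<Lambda>"
        by (rule order_trans[OF mult_left_mono hl]) (use i h_pos in simp_all)
      have "(\<Sum>k<i. h * (norm (vel (a + k)))\<^sup>2) \<le> (\<Sum>k<l. h * (norm (vel (a + k)))\<^sup>2)"
        using i v0 by (intro sum_mono2) auto
      also have "\<dots> \<le> (\<Sum>i<l. h * (norm (vel (a + i)))\<^sup>2 + h * U (x (a + i)))"
        using U0 by (intro sum_mono) auto
      finally show "(\<Sum>k<i. h * (norm (vel (a + k)))\<^sup>2) \<le> \<sigma>" using small by linarith
      show "0 \<le> (\<Sum>k<i. h * (norm (vel (a + k)))\<^sup>2)" using v0 by (intro sum_nonneg) auto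
    qed (rule L0)
    finally show ?thesis unfolding D_def by (rule real_le_rsqrt)
  qed
  have U_a: "\<bar>U (x (a + k)) - U (x a)\<bar> \<le> G * D" if "k < l" for k
    by (rule order_trans[OF U_lip[OF x_closure x_closure] mult_left_mono[OF dist[OF that]]]) (use G_pos in simp)
  have U_near: "\<bar>U (x (a + i)) - U (x (a + j))\<bar> \<le> 2 * G * D" if "i < l" "j < l" for i j
  proof -
    from U_a[OF that(1)] U_a[OF that(2)] show ?thesis by linarith
  qed
  \<comment> \<open>Otherwise the potential part alone would exceed \<open>\<sigma>\<close>, because
    the window lasts at least \<open>L\<close>.\<close>
  have "\<exists>i<l. U (x (a + i)) \<le> \<sigma> / L"
  proof (rule ccontr)
    assume "\<not> ?thesis"
    then have n: "\<sigma> / L < U (x (a + i))" if "i < l" for i using that by auto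
    have s0: "0 \<le> \<sigma>"
      by (rule order_trans[OF _ small]) (intro sum_nonneg add_nonneg_nonneg v0 U0)
    have "\<sigma> = L * (\<sigma> / L)" using L by simp
    also have "\<dots> \<le> h * real (l - 1) * (\<sigma> / L)"
      by (rule mult_right_mono[OF hl']) (use s0 L in simp)
    also have "\<dots> \<le> (\<Sum>i<l. h * (\<sigma> / L))"
    proof -
      have "h * real (l - 1) * (\<sigma> / L) \<le> h * real l * (\<sigma> / L)"
        by (intro mult_right_mono mult_left_mono) (use h_pos s0 L in simp_all)
      then show ?thesis by (simp add: mult_ac)
    qed
    also have "\<dots> < (\<Sum>i<l. h * U (x (a + i)))"
      using n h_pos l by (intro sum_strict_mono mult_strict_left_mono) (auto simp: lessThan_empty_iff)
    also have "\<dots> \<le> (\<Sum>i<l. h * (norm (vel (a + i)))\<^sup>2 + h * U (x (a + i)))"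
      using v0 by (intro sum_mono) auto
    finally show False using small by linarith
  qed
  then obtain i0 where i0: "i0 < l" "U (x (a + i0)) \<le> \<sigma> / L" by blast
  show "U (x a) \<le> \<sigma> / L + G * D" using i0(2) U_a[OF i0(1)] by linarith
  define w where "w = sqrt (2 * (\<sigma> / L + 2 * G * D + 2 * \<delta>))"
  have speed_w: "norm (vel (a + i)) \<le> w" if "i < l" for i
  proof -
    have "(norm (vel (a + i)))\<^sup>2 \<le> 2 * (\<sigma> / L + 2 * G * D + 2 * \<delta>)"
    proof -
      have "a + i < N" using a that by simp
      then show ?thesis using speed[of "a + i"] U_near[OF that i0(1)] i0(2) by argo
    qed
    then show ?thesis unfolding w_def by (rule real_le_rsqrt)
  qed
  have w0: "w \<ge> 0" by (rule order_trans[OF norm_ge_zero speed_w[of 0]]) (use l in simp)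
  \<comment> \<open>Both velocities to be compared must belong to the window, so the time between
    them is that of \<open>l - 1\<close> steps; this is why \<open>hl'\<close> is stated with
    \<open>l - 1\<close>.\<close>
  let ?n = "l - 1"
  have hn: "0 < h * real ?n" using h_pos l by simp
  \<comment> \<open>The change of velocity is the duration times \<open>g (x a)\<close> up to a
    Lipschitz error. As both velocities are at most \<open>w\<close> and the duration is at least
    \<open>L\<close>, \<open>g (x a)\<close> must be small.\<close>
  have "vel (a + ?n) - vel a = (\<Sum>k<?n. h *\<^sub>R g (x (Suc (a + k))))"
    using a l by (intro vel_diff) auto
  also have "\<dots> = (h * real ?n) *\<^sub>R g (x a) + (\<Sum>k<?n. h *\<^sub>R (g (x (a + Suc k)) - g (x a)))"
    by (simp add: sum_subtractf scaleR_diff_right mult.commute sum_constant_scaleR)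
  finally have "(h * real ?n) *\<^sub>R g (x a) = vel (a + ?n) - vel a - (\<Sum>k<?n. h *\<^sub>R (g (x (a + Suc k)) - g (x a)))"
    by simp
  then have "norm ((h * real ?n) *\<^sub>R g (x a)) \<le> norm (vel (a + ?n)) + norm (vel a)
      + norm (\<Sum>k<?n. h *\<^sub>R (g (x (a + Suc k)) - g (x a)))"
    using norm_triangle_ineq4[of "vel (a + ?n) - vel a" "\<Sum>k<?n. h *\<^sub>R (g (x (a + Suc k)) - g (x a))"]
      norm_triangle_ineq4[of "vel (a + ?n)" "vel a"] by (simp only:)
  also have "\<dots> \<le> w + w + (\<Sum>k<?n. h * (M * D))"
  proof (intro add_mono)
    show "norm (vel (a + ?n)) \<le> w" using speed_w[of ?n] l by simp
    show "norm (vel a) \<le> w" using speed_w[of 0] l by simp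
    show "norm (\<Sum>k<?n. h *\<^sub>R (g (x (a + Suc k)) - g (x a))) \<le> (\<Sum>k<?n. h * (M * D))"
    proof (rule sum_norm_le)
      fix k assume "k \<in> {..<?n}"
      then have k: "Suc k < l" by auto
      have "norm (g (x (a + Suc k)) - g (x a)) \<le> M * norm (x (a + Suc k) - x a)"
        by (intro g_lip x_closure)
      also have "\<dots> \<le> M * D" using dist[OF k] M_pos by (intro mult_left_mono) auto
      finally show "norm (h *\<^sub>R (g (x (a + Suc k)) - g (x a))) \<le> h * (M * D)"
        using h_pos by simp
    qed
  qed
  finally have "(h * real ?n) * norm (g (x a)) \<le> 2 * w + (h * real ?n) * (M * D)"
    using h_pos by (simp add: mult_ac)
  then have "norm (g (x a)) \<le> (2 * w + (h * real ?n) * (M * D)) / (h * real ?n)"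
    unfolding pos_le_divide_eq[OF hn] by (simp only: mult.commute)
  also have "\<dots> = 2 * w / (h * real ?n) + M * D"
    unfolding add_divide_distrib using hn by (subst nonzero_mult_div_cancel_left) auto
  also have "\<dots> \<le> 2 * w / L + M * D"
    using hl' L w0 hn by (intro add_right_mono divide_left_mono) auto
  finally show "norm (g (x a)) \<le> 2 * sqrt (2 * (\<sigma> / L + 2 * G * D + 2 * \<delta>)) / L + M * D"
    unfolding w_def .
qed

end

text \<open>The negative Hessian direction is recorded as a bound on second differences, the form
  that the discrete second variation consumes, and with the same \<open>r\<close> and
  \<open>\<mu>\<close> for all critical points.\<close>

locale unstable_well = potential_well +
  fixes r \<mu> :: real
  assumes r_pos: "r > 0" and mu_pos: "\<mu> > 0"
    and unstable: "\<And>p. \<lbrakk>p \<in> frontier \<Omega>; g p = 0\<rbrakk> \<Longrightarrow> \<exists>e. norm e = 1 \<and>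
      (\<forall>y\<in>ball p r. \<forall>s. \<bar>s\<bar> < r \<longrightarrow> U (y + s *\<^sub>R e) + U (y - s *\<^sub>R e) - 2 * U y \<le> - \<mu> * s\<^sup>2)"
begin

text \<open>Among the disjoint windows of a long curve of bounded action, one carries little action.\<close>

lemma time_bounded:
  obtains T \<eta> where "\<eta> > 0"
    "\<And>N \<delta> h x. \<lbrakk>discrete_brake U g \<Omega> G M Um N \<delta> h C x; \<delta> \<le> \<eta>\<rbrakk> \<Longrightarrow> N * h \<le> T"
proof -
  \<comment> \<open>Chosen so that \<open>L\<^sup>2 * \<mu> = 4\<close> exceeds the bound 2 of
    \<open>no_long_stay\<close>.\<close>
  define L where "L = 2 / sqrt \<mu>"
  have L: "L > 0" using mu_pos by (simp add: L_def)
  have L2: "L\<^sup>2 * \<mu> = 4" using mu_pos by (simp add: L_def power_divide)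
  \<comment> \<open>An upper bound for the duration of \<open>4 * n\<close> steps when
    \<open>n\<close> is \<open>L / h\<close> rounded up and \<open>h\<close> is at most 1.\<close>
  define \<Lambda> where "\<Lambda> = 4 * (L + 1)"
  have Lam: "\<Lambda> > 0" using L by (simp add: \<Lambda>_def)
  obtain \<kappa> where \<kappa>: "\<kappa> > 0" "\<And>y. \<lbrakk>y \<in> closure \<Omega>; U y \<le> \<kappa>; norm (g y) \<le> \<kappa>\<rbrakk>
     \<Longrightarrow> \<exists>p\<in>frontier \<Omega>. g p = 0 \<and> dist p y < r / 2"
    using near_critical[of "r / 2"] r_pos by auto
  \<comment> \<open>All bounds that \<open>window\<close> yields, for the displacement, for
    \<open>U\<close> and for \<open>g\<close>, tend to 0 with \<open>\<sigma>\<close>. In the last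
    one \<open>\<delta>\<close> is replaced by \<open>s\<close>, as \<open>\<sigma>\<close> also
    serves as the threshold for \<open>\<delta>\<close>.\<close>
  have "((\<lambda>s. sqrt (\<Lambda> * s)) \<longlongrightarrow> sqrt (\<Lambda> * 0)) (at_right 0)"
    by (intro tendsto_intros)
  then have e1: "\<forall>\<^sub>F s in at_right 0. sqrt (\<Lambda> * s) < r / 2"
    by (rule order_tendstoD) (use r_pos in simp)
  have "((\<lambda>s. s / L + G * sqrt (\<Lambda> * s)) \<longlongrightarrow> 0 / L + G * sqrt (\<Lambda> * 0)) (at_right 0)"
    by (intro tendsto_intros) (use L in simp)
  then have e2: "\<forall>\<^sub>F s in at_right 0. s / L + G * sqrt (\<Lambda> * s) < \<kappa>"
    by (rule order_tendstoD) (use \<kappa> in simp)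
  have "((\<lambda>s. 2 * sqrt (2 * (s / L + 2 * G * sqrt (\<Lambda> * s) + 2 * s)) / L + M * sqrt (\<Lambda> * s))
      \<longlongrightarrow> 2 * sqrt (2 * (0 / L + 2 * G * sqrt (\<Lambda> * 0) + 2 * 0)) / L + M * sqrt (\<Lambda> * 0)) (at_right 0)"
    by (intro tendsto_intros) (use L in simp_all)
  then have e3: "\<forall>\<^sub>F s in at_right 0. 2 * sqrt (2 * (s / L + 2 * G * sqrt (\<Lambda> * s) + 2 * s)) / L + M * sqrt (\<Lambda> * s) < \<kappa>"
    by (rule order_tendstoD) (use \<kappa> in simp)
  have "\<forall>\<^sub>F s in at_right (0::real). s > 0"
    by (simp add: eventually_at_right_less)
  with e1 e2 e3 have "\<forall>\<^sub>F s in at_right 0. s > 0 \<and> sqrt (\<Lambda> * s) < r / 2 \<and> s / L + G * sqrt (\<Lambda> * s) < \<kappa>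
     \<and> 2 * sqrt (2 * (s / L + 2 * G * sqrt (\<Lambda> * s) + 2 * s)) / L + M * sqrt (\<Lambda> * s) < \<kappa>"
    by eventually_elim auto
  then obtain \<sigma> where \<sigma>: "\<sigma> > 0" "sqrt (\<Lambda> * \<sigma>) < r / 2" "\<sigma> / L + G * sqrt (\<Lambda> * \<sigma>) < \<kappa>"
     "2 * sqrt (2 * (\<sigma> / L + 2 * G * sqrt (\<Lambda> * \<sigma>) + 2 * \<sigma>)) / L + M * sqrt (\<Lambda> * \<sigma>) < \<kappa>"
    using eventually_happens'[OF trivial_limit_at_right_real] by blast
  show ?thesis
  proof (rule that[OF \<sigma>(1)])
    fix N :: nat and \<delta> h x
    assume D: "discrete_brake U g \<Omega> G M Um N \<delta> h C x" and d\<sigma>: "\<delta> \<le> \<sigma>"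
    interpret D: discrete_brake U g \<Omega> G M Um N \<delta> h C x by (rule D)
    note h = D.h_pos
    define n where "n = nat \<lceil>L / h\<rceil>"
    have Lh: "L / h > 0" using L h by simp
    have n0: "n > 0" using Lh by (simp add: n_def)
    have n1: "L / h \<le> real n" "real n \<le> L / h + 1" using Lh by (simp_all add: n_def)
    have hn: "L \<le> h * real n" "h * real n \<le> L + h"
      using n1 h by (simp_all add: field_simps)
    define l where "l = 4 * n"
    have hl: "h * l \<le> \<Lambda>" using hn D.h_le by (simp add: l_def \<Lambda>_def)
    have "real n \<le> real (l - 1)" using n0 unfolding l_def by (intro of_nat_mono) linarith
    then have "h * real n \<le> h * real (l - 1)" using h by (intro mult_left_mono) auto
    then have hl': "L \<le> h * real (l - 1)" using hn(1) by linarith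
    define f where "f k = h * (norm (D.vel k))\<^sup>2 + h * U (x k)" for k
    have f0: "f k \<ge> 0" for k
      unfolding f_def using h U_nonneg[OF D.x_closure] by simp
    have f_sum: "(\<Sum>k<N. f k) \<le> 2 * C"
      unfolding f_def sum.distrib using D.sum_vel D.sum_U by linarith
    have big: "(\<Sum>i<l. f (a + i)) > \<sigma>" if a: "a + l \<le> N" for a
    proof (rule ccontr)
      assume "\<not> ?thesis"
      then have small: "(\<Sum>i<l. h * (norm (D.vel (a + i)))\<^sup>2 + h * U (x (a + i))) \<le> \<sigma>"
        by (simp add: f_def)
      have l2: "2 \<le> l" using n0 by (simp add: l_def)
      note w = D.window[OF a l2 hl hl' L small]
      have "norm (g (x a)) \<le> 2 * sqrt (2 * (\<sigma> / L + 2 * G * sqrt (\<Lambda> * \<sigma>) + 2 * \<delta>)) / L + M * sqrt (\<Lambda> * \<sigma>)"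
        by (rule w(3))
      also have "\<dots> \<le> 2 * sqrt (2 * (\<sigma> / L + 2 * G * sqrt (\<Lambda> * \<sigma>) + 2 * \<sigma>)) / L + M * sqrt (\<Lambda> * \<sigma>)"
        using d\<sigma> L by (intro add_right_mono divide_right_mono mult_left_mono real_sqrt_le_mono) auto
      finally have "norm (g (x a)) \<le> \<kappa>" using \<sigma>(4) by linarith
      moreover have "U (x a) \<le> \<kappa>" using w(2) \<sigma>(3) by linarith
      ultimately obtain p where p: "p \<in> frontier \<Omega>" "g p = 0" "dist p (x a) < r / 2"
        using \<kappa>(2)[OF D.x_closure] by blast
      obtain e where e: "norm e = 1" "\<And>y s. \<lbrakk>y \<in> ball p r; \<bar>s\<bar> < r\<rbrakk>
          \<Longrightarrow> U (y + s *\<^sub>R e) + U (y - s *\<^sub>R e) - 2 * U y \<le> - \<mu> * s\<^sup>2"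
        using unstable[OF p(1,2)] by blast
      have "x (a + i) \<in> ball p r" if "i < 4 * n" for i
      proof -
        have "dist (x a) (x (a + i)) < r / 2"
          using w(1)[of i] \<sigma>(2) that by (simp add: l_def dist_norm norm_minus_commute)
        then show ?thesis
          using p(3) dist_triangle[of p "x (a + i)" "x a"] by simp
      qed
      then have "(h * n)\<^sup>2 * \<mu> \<le> 2"
        using D.no_long_stay[of a n r \<mu> e] a n0 r_pos mu_pos e unfolding l_def by blast
      moreover have "L\<^sup>2 * \<mu> \<le> (h * n)\<^sup>2 * \<mu>"
        using hn(1) L mu_pos by (intro mult_right_mono power_mono) auto
      ultimately show False using L2 by linarith
    qed
    \<comment> \<open>The disjoint full windows cost more than \<open>\<sigma>\<close> each out of a
      total of at most \<open>2 * C\<close>, which bounds their number; the remainder is shorter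
      than one window.\<close>
    define W where "W = N div l"
    have Wl: "W * l \<le> N" by (simp add: W_def)
    have "real W * \<sigma> = (\<Sum>j<W. \<sigma>)" by simp
    also have "\<dots> \<le> (\<Sum>j<W. \<Sum>k\<in>{j * l..<j * l + l}. f k)"
    proof (rule sum_mono)
      fix j assume "j \<in> {..<W}"
      then have "Suc j * l \<le> W * l" by (intro mult_right_mono) auto
      then have "j * l + l \<le> N" using Wl by simp
      from big[OF this] have "\<sigma> < (\<Sum>i<l. f (j * l + i))" .
      also have "\<dots> = (\<Sum>k\<in>{j * l..<j * l + l}. f k)"
        using sum.shift_bounds_nat_ivl[of f 0 "j * l" l] by (simp add: lessThan_atLeast0 add.commute)
      finally show "\<sigma> \<le> (\<Sum>k\<in>{j * l..<j * l + l}. f k)" by simp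
    qed
    also have "\<dots> = (\<Sum>k<W * l. f k)" by (rule sum.nat_group)
    also have "\<dots> \<le> (\<Sum>k<N. f k)" using Wl f0 by (intro sum_mono2) auto
    finally have W: "real W * \<sigma> \<le> 2 * C" using f_sum by linarith
    have "N < (W + 1) * l"
      using n0 unfolding W_def l_def by (simp add: dividend_less_div_times)
    then have "real N \<le> (real W + 1) * real l"
      by (metis less_imp_le of_nat_1 of_nat_add of_nat_le_iff of_nat_mult)
    then have "real N * h \<le> (real W + 1) * real l * h" using h by (intro mult_right_mono) auto
    also have "\<dots> = (real W + 1) * (h * l)" by simp
    also have "\<dots> \<le> (2 * C / \<sigma> + 1) * \<Lambda>"
    proof (rule mult_mono)
      show "real W + 1 \<le> 2 * C / \<sigma> + 1" using W \<sigma>(1) by (simp add: field_simps)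
      show "0 \<le> 2 * C / \<sigma> + 1" using D.C_nonneg \<sigma>(1) by simp
    qed (use hl h in auto)
    finally show "real N * h \<le> (2 * C / \<sigma> + 1) * \<Lambda>" .
  qed
qed

end

section \<open>Passage to the limit\<close>

text \<open>The expansions are available only from an earlier time to a later one. For
  \<open>t < s\<close> the expansion at \<open>t\<close> is turned into one at \<open>s\<close> by
  the Lipschitz bound on \<open>w\<close>.\<close>

lemma has_vector_derivative_quadratic:
  fixes z w :: "real \<Rightarrow> 'b::real_normed_vector"
  assumes z: "\<And>s t. \<lbrakk>a \<le> s; s \<le> t; t \<le> b\<rbrakk> \<Longrightarrow> norm (z t - z s - (t - s) *\<^sub>R w s) \<le> c * (t - s)\<^sup>2"
    and w: "\<And>s t. \<lbrakk>a \<le> s; s \<le> t; t \<le> b\<rbrakk> \<Longrightarrow> norm (w t - w s) \<le> c * (t - s)"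
    and s: "s \<in> {a..b}"
  shows "(z has_vector_derivative w s) (at s within {a..b})"
proof -
  have key: "norm (z t - z s - (t - s) *\<^sub>R w s) \<le> (2 * \<bar>c\<bar> * \<bar>t - s\<bar>) * \<bar>t - s\<bar>" if t: "t \<in> {a..b}" for t
  proof (cases "s \<le> t")
    case True
    have "norm (z t - z s - (t - s) *\<^sub>R w s) \<le> c * (t - s)\<^sup>2" using z True s t by simp
    also have "\<dots> \<le> 2 * \<bar>c\<bar> * (t - s)\<^sup>2" by (intro mult_right_mono) auto
    finally show ?thesis using True by (simp add: power2_eq_square mult.assoc)
  next
    case False
    have "z t - z s - (t - s) *\<^sub>R w s = - (z s - z t - (s - t) *\<^sub>R w t) + (s - t) *\<^sub>R (w s - w t)"
      by (simp add: algebra_simps)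
    also have "norm \<dots> \<le> norm (z s - z t - (s - t) *\<^sub>R w t) + norm ((s - t) *\<^sub>R (w s - w t))"
      by (rule order_trans[OF norm_triangle_ineq]) (simp only: norm_minus_cancel order_refl)
    also have "\<dots> \<le> c * (s - t)\<^sup>2 + (s - t) * (c * (s - t))"
      using z[of t s] w[of t s] s t False by (intro add_mono) (auto intro: mult_left_mono)
    also have "\<dots> = 2 * c * (s - t)\<^sup>2" by (simp add: power2_eq_square)
    also have "\<dots> \<le> 2 * \<bar>c\<bar> * (s - t)\<^sup>2" by (intro mult_right_mono) auto
    finally show ?thesis using False by (simp add: power2_eq_square mult.assoc)
  qed
  show ?thesis
    unfolding has_vector_derivative_def has_derivative_within_alt
  proof (intro conjI allI impI)
    show "bounded_linear (\<lambda>x. x *\<^sub>R w s)" by (rule bounded_linear_scaleR_left)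
    fix e :: real assume e: "e > 0"
    show "\<exists>d>0. \<forall>t\<in>{a..b}. norm (t - s) < d \<longrightarrow> norm (z t - z s - (t - s) *\<^sub>R w s) \<le> e * norm (t - s)"
    proof (intro exI[of _ "e / (2 * \<bar>c\<bar> + 1)"] conjI ballI impI)
      show "0 < e / (2 * \<bar>c\<bar> + 1)" using e by (simp add: add_nonneg_pos)
      fix t assume t: "t \<in> {a..b}" and d: "norm (t - s) < e / (2 * \<bar>c\<bar> + 1)"
      have "0 < 2 * \<bar>c\<bar> + 1" by linarith
      then have "(2 * \<bar>c\<bar> + 1) * \<bar>t - s\<bar> < e"
        using d by (simp add: pos_less_divide_eq mult.commute)
      then have "2 * \<bar>c\<bar> * \<bar>t - s\<bar> \<le> e"
        using abs_ge_zero[of "t - s"] unfolding distrib_right by argo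
      then have "(2 * \<bar>c\<bar> * \<bar>t - s\<bar>) * \<bar>t - s\<bar> \<le> e * \<bar>t - s\<bar>" by (intro mult_right_mono) auto
      then show "norm (z t - z s - (t - s) *\<^sub>R w s) \<le> e * norm (t - s)"
        using key[OF t] by simp
    qed
  qed
qed

section \<open>Errors of discrete recurrences\<close>

lemma recurrence_error:
  fixes z :: "nat \<Rightarrow> 'b::real_normed_vector"
  assumes "h \<ge> 0" "i \<le> j"
    and "\<And>k. \<lbrakk>i \<le> k; k < j\<rbrakk> \<Longrightarrow> z (Suc k) = z k + h *\<^sub>R w k"
    and "\<And>k. \<lbrakk>i \<le> k; k < j\<rbrakk> \<Longrightarrow> norm (w k - c) \<le> B"
  shows "norm (z j - z i - (h * real (j - i)) *\<^sub>R c) \<le> h * real (j - i) * B"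
  using assms(2-4)
proof (induction j rule: dec_induct)
  case base
  then show ?case by simp
next
  case (step n)
  have IH: "norm (z n - z i - (h * real (n - i)) *\<^sub>R c) \<le> h * real (n - i) * B"
    using step by auto
  have "z (Suc n) - z i - (h * real (Suc n - i)) *\<^sub>R c
      = (z n - z i - (h * real (n - i)) *\<^sub>R c) + h *\<^sub>R (w n - c)"
    using step.prems(1)[of n] step.hyps by (simp add: Suc_diff_le algebra_simps)
  also have "norm \<dots> \<le> norm (z n - z i - (h * real (n - i)) *\<^sub>R c) + norm (h *\<^sub>R (w n - c))"
    by (rule norm_triangle_ineq)
  also have "\<dots> \<le> h * real (n - i) * B + h * B"
    using IH step.prems(2)[of n] step.hyps assms(1) by (intro add_mono) (auto intro: mult_left_mono)
  also have "\<dots> = h * real (Suc n - i) * B"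
    using step.hyps by (simp add: Suc_diff_le algebra_simps)
  finally show ?case .
qed

text \<open>The form with a prescribed time \<open>\<tau>\<close>: rounding it to a multiple of
  \<open>h\<close> costs at most one step, which accounts for \<open>h * V\<close> and for
  \<open>\<tau> + h\<close> in place of \<open>\<tau>\<close>.\<close>

lemma recurrence_error':
  fixes z :: "nat \<Rightarrow> 'b::real_normed_vector"
  assumes h: "h \<ge> 0" and ij: "i \<le> j"
    and z: "\<And>k. \<lbrakk>i \<le> k; k < j\<rbrakk> \<Longrightarrow> z (Suc k) = z k + h *\<^sub>R w k"
    and w: "\<And>k. \<lbrakk>i \<le> k; k < j\<rbrakk> \<Longrightarrow> norm (w k - c) \<le> A * (h * real (j - i))"
    and A: "A \<ge> 0" and c: "norm c \<le> V" and \<tau>: "\<bar>h * real (j - i) - \<tau>\<bar> \<le> h" "\<tau> \<ge> 0"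
  shows "norm (z j - z i - \<tau> *\<^sub>R c) \<le> A * (\<tau> + h)\<^sup>2 + h * V"
proof -
  define \<tau>' where "\<tau>' = h * real (j - i)"
  have \<tau>': "0 \<le> \<tau>'" "\<tau>' \<le> \<tau> + h" "\<bar>\<tau>' - \<tau>\<bar> \<le> h" using \<tau> h by (auto simp: \<tau>'_def)
  have "z j - z i - \<tau> *\<^sub>R c = (z j - z i - \<tau>' *\<^sub>R c) + (\<tau>' - \<tau>) *\<^sub>R c"
    by (simp add: algebra_simps)
  also have "norm \<dots> \<le> norm (z j - z i - \<tau>' *\<^sub>R c) + norm ((\<tau>' - \<tau>) *\<^sub>R c)"
    by (rule norm_triangle_ineq)
  also have "\<dots> \<le> \<tau>' * (A * \<tau>') + h * V"
  proof (rule add_mono)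
    show "norm (z j - z i - \<tau>' *\<^sub>R c) \<le> \<tau>' * (A * \<tau>')"
      unfolding \<tau>'_def by (intro recurrence_error[where w = w] h ij z w)
    show "norm ((\<tau>' - \<tau>) *\<^sub>R c) \<le> h * V"
      unfolding norm_scaleR real_norm_def using \<tau>' c h by (intro mult_mono) auto
  qed
  also have "\<tau>' * (A * \<tau>') = A * \<tau>'\<^sup>2" by (simp add: power2_eq_square)
  also have "A * \<tau>'\<^sup>2 \<le> A * (\<tau> + h)\<^sup>2" using A \<tau>' by (intro mult_left_mono power_mono) auto
  finally show ?thesis by simp
qed

section \<open>Expansions of discrete curves, uniform in step and mean energy\<close>

context discrete_brake
begin

text \<open>The velocity is continued by one step so that the recurrence also holds at the last point.\<close>

definition P :: "nat \<Rightarrow> 'a" where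
  "P k = (if k < N then vel k else vel (N - 1) + h *\<^sub>R g (x N))"

text \<open>The root bounds the speed of genuine steps, and \<open>G\<close> pays for the extra step
  of \<open>P\<close>, as \<open>h\<close> is at most 1.\<close>

definition V :: real where "V = sqrt (2 * (Um + 2)) + G"

lemma N_pos: "0 < N" using K_pos .

lemma V_pos: "V > 0"
  unfolding V_def using G_pos Um_pos by (intro add_nonneg_pos) auto

lemma P_Suc: "k < N \<Longrightarrow> P (Suc k) = P k + h *\<^sub>R g (x (Suc k))"
proof -
  assume k: "k < N"
  show ?thesis
  proof (cases "Suc k < N")
    case True
    then show ?thesis using vel_Suc[of k] by (simp add: P_def)
  next
    case False
    then have "Suc k = N" "N - 1 = k" using k by auto
    then show ?thesis unfolding P_def using k by simp
  qed
qed

lemma x_P: "k < N \<Longrightarrow> x (Suc k) = x k + h *\<^sub>R P k"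
  by (simp add: P_def x_Suc)

lemma P_bound: "norm (P k) \<le> V"
proof (cases "k < N")
  case True
  then show ?thesis using speed_le[of k] G_pos by (simp add: P_def V_def)
next
  case False
  have "norm (vel (N - 1) + h *\<^sub>R g (x N)) \<le> norm (vel (N - 1)) + norm (h *\<^sub>R g (x N))"
    by (rule norm_triangle_ineq)
  also have "norm (h *\<^sub>R g (x N)) \<le> 1 * G"
    unfolding norm_scaleR real_norm_def using h_pos h_le g_bound[OF x_closure, of N] G_pos
    by (intro mult_mono) auto
  also have "norm (vel (N - 1)) \<le> sqrt (2 * (Um + 2))" using N_pos by (intro speed_le) simp
  finally show ?thesis using False by (simp add: P_def V_def)
qed

text \<open>The coefficients depend on the well only, not on \<open>N\<close>,
  \<open>\<delta>\<close> or \<open>h\<close>, and so survive in the limit.\<close>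

lemma expansion_x:
  assumes "i \<le> j" "j \<le> N" "\<bar>h * real (j - i) - \<tau>\<bar> \<le> h" "\<tau> \<ge> 0"
  shows "norm (x j - x i - \<tau> *\<^sub>R P i) \<le> G * (\<tau> + h)\<^sup>2 + h * V"
proof (rule recurrence_error'[where w = P])
  show "x (Suc k) = x k + h *\<^sub>R P k" if "i \<le> k" "k < j" for k
    using that assms by (intro x_P) simp
  show "norm (P k - P i) \<le> G * (h * real (j - i))" if k: "i \<le> k" "k < j" for k
  proof -
    have "norm (P k - P i - (h * real (k - i)) *\<^sub>R 0) \<le> h * real (k - i) * G"
    proof (rule recurrence_error[where w = "\<lambda>k. g (x (Suc k))"])
      show "P (Suc k') = P k' + h *\<^sub>R g (x (Suc k'))" if "i \<le> k'" "k' < k" for k'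
        using that k assms by (intro P_Suc) simp
      show "norm (g (x (Suc k')) - 0) \<le> G" for k' using g_bound[OF x_closure] by simp
    qed (use h_pos k in auto)
    also have "\<dots> \<le> h * real (j - i) * G"
      using k h_pos G_pos by (intro mult_right_mono mult_left_mono) auto
    finally show ?thesis by (simp add: mult.commute)
  qed
qed (use h_pos G_pos P_bound assms in auto)

lemma expansion_P:
  assumes "i \<le> j" "j \<le> N" "\<bar>h * real (j - i) - \<tau>\<bar> \<le> h" "\<tau> \<ge> 0"
  shows "norm (P j - P i - \<tau> *\<^sub>R g (x i)) \<le> (M * V) * (\<tau> + h)\<^sup>2 + h * G"
proof (rule recurrence_error'[where w = "\<lambda>k. g (x (Suc k))"])
  show "P (Suc k) = P k + h *\<^sub>R g (x (Suc k))" if "i \<le> k" "k < j" for k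
    using that assms by (intro P_Suc) simp
  show "norm (g (x (Suc k)) - g (x i)) \<le> M * V * (h * real (j - i))" if k: "i \<le> k" "k < j" for k
  proof -
    have "norm (x (Suc k) - x i - (h * real (Suc k - i)) *\<^sub>R 0) \<le> h * real (Suc k - i) * V"
    proof (rule recurrence_error[where w = P])
      show "x (Suc k') = x k' + h *\<^sub>R P k'" if "i \<le> k'" "k' < Suc k" for k'
        using that k assms by (intro x_P) simp
      show "norm (P k' - 0) \<le> V" for k' using P_bound by simp
    qed (use h_pos k in auto)
    also have "\<dots> \<le> h * real (j - i) * V"
      using k h_pos V_pos by (intro mult_right_mono mult_left_mono of_nat_mono) auto
    finally have "norm (x (Suc k) - x i) \<le> h * real (j - i) * V" by simp
    then have "M * norm (x (Suc k) - x i) \<le> M * (h * real (j - i) * V)"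
      using M_pos by (intro mult_left_mono) auto
    moreover have "norm (g (x (Suc k)) - g (x i)) \<le> M * norm (x (Suc k) - x i)"
      by (intro g_lip x_closure)
    ultimately show ?thesis by (simp add: mult_ac)
  qed
qed (use h_pos M_pos V_pos g_bound[OF x_closure] assms in auto)

text \<open>The step reached after the fraction \<open>\<theta>\<close> of the travel time. Clamping
  keeps it at most \<open>N\<close> for every real argument.\<close>

definition idx :: "real \<Rightarrow> nat" where
  "idx \<theta> = nat \<lfloor>max 0 (min 1 \<theta>) * N\<rfloor>"

lemma idx_le: "idx \<theta> \<le> N"
proof -
  have "max 0 (min 1 \<theta>) * real N \<le> 1 * real N" by (intro mult_right_mono) auto
  then have "\<lfloor>max 0 (min 1 \<theta>) * real N\<rfloor> \<le> int N" by (simp add: floor_le_iff)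
  then show ?thesis unfolding idx_def by linarith
qed

lemma idx_0: "idx 0 = 0" and idx_1: "idx 1 = N"
  by (simp_all add: idx_def)

lemma idx_less:
  assumes "\<theta> < 1" shows "idx \<theta> < N"
proof -
  have "max 0 (min 1 \<theta>) * real N < 1 * real N" using assms N_pos by (intro mult_strict_right_mono) auto
  then have "\<lfloor>max 0 (min 1 \<theta>) * real N\<rfloor> < int N" by (simp add: floor_less_iff)
  then show ?thesis unfolding idx_def using N_pos by linarith
qed

lemma energy_P:
  assumes "\<theta> < 1"
  shows "0 \<le> (norm (P (idx \<theta>)))\<^sup>2 / 2 - U (x (idx \<theta>))" "(norm (P (idx \<theta>)))\<^sup>2 / 2 - U (x (idx \<theta>)) \<le> 2 * \<delta>"
  using energy_bounds[OF idx_less[OF assms]] idx_less[OF assms] by (simp_all add: energy_def P_def)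

lemma idx_diff:
  assumes "0 \<le> s" "s \<le> t" "t \<le> 1"
  shows "idx s \<le> idx t" "\<bar>h * real (idx t - idx s) - (t - s) * (N * h)\<bar> \<le> h"
proof -
  have s: "max 0 (min 1 s) = s" and t: "max 0 (min 1 t) = t" using assms by auto
  have st: "s * N \<le> t * N" using assms by (intro mult_right_mono) auto
  show le: "idx s \<le> idx t"
    unfolding idx_def s t by (intro nat_mono floor_mono st)
  have "real (idx s) = of_int \<lfloor>s * N\<rfloor>" "real (idx t) = of_int \<lfloor>t * N\<rfloor>"
    unfolding idx_def s t using assms by simp_all
  then have "\<bar>real (idx t - idx s) - (t - s) * N\<bar> \<le> 1"
    unfolding of_nat_diff[OF le] left_diff_distrib by linarith
  then have "h * \<bar>real (idx t - idx s) - (t - s) * N\<bar> \<le> h * 1"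
    using h_pos by (intro mult_left_mono) auto
  also have "h * \<bar>real (idx t - idx s) - (t - s) * N\<bar> = \<bar>h * real (idx t - idx s) - (t - s) * (N * h)\<bar>"
  proof -
    have "h * real (idx t - idx s) - (t - s) * (N * h) = h * (real (idx t - idx s) - (t - s) * N)"
      by (simp add: algebra_simps)
    then show ?thesis using h_pos by (simp only: abs_mult abs_of_pos)
  qed
  finally show "\<bar>h * real (idx t - idx s) - (t - s) * (N * h)\<bar> \<le> h" by simp
qed

end

text \<open>With an uncountable index set a pointwise convergent subsequence need not exist.
  Tychonoff's theorem still gives a cluster point of the sequence of functions, hence convergence
  along a filter finer than \<open>sequentially\<close>, with no equicontinuity required.\<close>

lemma compact_pointwise_limit:
  fixes f :: "nat \<Rightarrow> 'i \<Rightarrow> 'b::topological_space"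
  assumes "compact K" "\<And>m i. f m i \<in> K"
  obtains F z where "F \<noteq> bot" "F \<le> sequentially" "\<And>i. z i \<in> K" "\<And>i. ((\<lambda>m. f m i) \<longlongrightarrow> z i) F"
proof -
  have "compact (PiE (UNIV :: 'i set) (\<lambda>_. K))"
    by (metis compactin_PiE euclidean_product_topology compactin_euclidean_iff assms(1))
  moreover have "\<forall>\<^sub>F x in filtermap f sequentially. x \<in> PiE UNIV (\<lambda>_. K)"
    using assms(2) by (simp add: eventually_filtermap PiE_iff)
  moreover have "filtermap f sequentially \<noteq> bot" by (simp add: filtermap_bot_iff)
  ultimately obtain z where z: "z \<in> PiE UNIV (\<lambda>_. K)" "inf (nhds z) (filtermap f sequentially) \<noteq> bot"
    unfolding compact_filter by blast
  \<comment> \<open>Generated by the preimages of the neighbourhoods of \<open>z\<close> together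
    with the tails of the sequence; it is proper because \<open>z\<close> is a cluster
    point.\<close>
  define F where "F = inf (filtercomap f (nhds z)) sequentially"
  have "F \<noteq> bot"
  proof
    assume "F = bot"
    then have "eventually (\<lambda>_. False) F" by simp
    then obtain A B where A: "eventually A (filtercomap f (nhds z))" and B: "eventually B sequentially"
      and AB: "\<And>m. A m \<Longrightarrow> B m \<Longrightarrow> False"
      unfolding F_def eventually_inf by blast
    obtain Q where Q: "eventually Q (nhds z)" "\<And>m. Q (f m) \<Longrightarrow> A m"
      using A unfolding eventually_filtercomap by blast
    have "eventually (\<lambda>y. \<not> Q y) (filtermap f sequentially)"
      unfolding eventually_filtermap using B by eventually_elim (use Q AB in blast)
    then have "eventually (\<lambda>_. False) (inf (nhds z) (filtermap f sequentially))"
      unfolding eventually_inf using Q(1) by blast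
    then show False using z(2) by (simp add: trivial_limit_def)
  qed
  moreover have "F \<le> sequentially" by (simp add: F_def)
  moreover have "z i \<in> K" for i using z(1) by auto
  moreover have "((\<lambda>m. f m i) \<longlongrightarrow> z i) F" for i
  proof -
    have "filterlim f (nhds z) F"
      unfolding F_def filterlim_iff_le_filtercomap by simp
    then show ?thesis
      by (rule continuous_on_tendsto_compose[OF continuous_on_product_coordinates[of i]]) auto
  qed
  ultimately show ?thesis by (rule that)
qed

context unstable_well
begin

text \<open>Time is rescaled to the unit interval because the travel times vary along the sequence.
  Their limit \<open>T\<close> reappears as a factor in the first-order system for position and
  velocity.\<close>

lemma limit_curve:
  obtains T v y where "T > 0" "v 0 = 0" "v 1 \<in> frontier \<Omega>" "\<And>s. v s \<in> closure \<Omega>"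
    "\<And>s. s \<in> {0..1} \<Longrightarrow> (v has_vector_derivative T *\<^sub>R y s) (at s within {0..1})"
    "\<And>s. s \<in> {0..1} \<Longrightarrow> (y has_vector_derivative T *\<^sub>R g (v s)) (at s within {0..1})"
    "\<And>s. s \<in> {0..1} \<Longrightarrow> (norm (y s))\<^sup>2 / 2 = U (v s)"
proof -
  obtain C where C: "\<And>\<epsilon>. \<epsilon> > 0 \<Longrightarrow> \<exists>N \<delta> h x. discrete_brake U g \<Omega> G M Um N \<delta> h C x \<and> h \<le> \<epsilon> \<and> \<delta> \<le> \<epsilon>"
    using ex_discrete_brake by blast
  obtain Tm \<eta> where \<eta>: "\<eta> > 0"
    and Tm: "\<And>N \<delta> h x. \<lbrakk>discrete_brake U g \<Omega> G M Um N \<delta> h C x; \<delta> \<le> \<eta>\<rbrakk> \<Longrightarrow> N * h \<le> Tm"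
    using time_bounded[of C] by metis
  \<comment> \<open>The cap \<open>\<eta>\<close> makes the uniform bound on travel times
    applicable; the other entry drives \<open>h\<close> and \<open>\<delta>\<close> to 0.\<close>
  define \<epsilon> where "\<epsilon> m = min \<eta> (1 / real (Suc m))" for m
  have \<epsilon>0: "\<epsilon> m > 0" for m using \<eta> by (simp add: \<epsilon>_def)
  have "\<forall>m. \<exists>N \<delta> h x. discrete_brake U g \<Omega> G M Um N \<delta> h C x \<and> h \<le> \<epsilon> m \<and> \<delta> \<le> \<epsilon> m"
    using C \<epsilon>0 by blast
  then obtain N \<delta> h x where D: "\<And>m. discrete_brake U g \<Omega> G M Um (N m) (\<delta> m) (h m) C (x m)"
    and h: "\<And>m. h m \<le> \<epsilon> m" and \<delta>: "\<And>m. \<delta> m \<le> \<epsilon> m"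
    unfolding choice_iff by blast
  define P where "P m = discrete_brake.P g (N m) (h m) (x m)" for m
  define idx where "idx m = discrete_brake.idx (N m)" for m
  define V where "V = sqrt (2 * (Um + 2)) + G"
  have V: "V = discrete_brake.V G Um" by (simp add: V_def discrete_brake.V_def[OF D[of 0]])
  have h0: "h m > 0" for m
    using D[of m] by (simp add: discrete_brake_def discrete_minimizer_def discrete_minimizer_axioms_def)
  have T_le: "N m * h m \<le> Tm" for m
    using Tm[OF D[of m]] \<delta>[of m] by (simp add: \<epsilon>_def)
  \<comment> \<open>Position, velocity and travel time are bundled, so that a single filter serves
    all three.\<close>
  define f where "f m s = (x m (idx m s), P m (idx m s), N m * h m)" for m s
  define K where "K = closure \<Omega> \<times> cball (0::'a) V \<times> {0..Tm}"
  have "compact K"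
    unfolding K_def by (intro compact_Times compact_closure_Omega compact_cball compact_Icc)
  moreover have "f m s \<in> K" for m s
    unfolding f_def K_def
    using discrete_minimizer.x_closure[OF discrete_brake.axioms(1)[OF D[of m]]]
      discrete_brake.P_bound[OF D[of m]] T_le[of m] h0[of m]
    by (simp add: P_def V)
  ultimately obtain F z where F: "F \<noteq> bot" "F \<le> sequentially" and z: "\<And>s. z s \<in> K"
    and lim: "\<And>s. ((\<lambda>m. f m s) \<longlongrightarrow> z s) F"
    using compact_pointwise_limit[of K f] by metis
  define v where "v s = fst (z s)" for s
  define y where "y s = fst (snd (z s))" for s
  \<comment> \<open>The third component does not depend on the parameter, so any value may replace
    0.\<close>
  define T where "T = snd (snd (z 0))"
  have xv: "((\<lambda>m. x m (idx m s)) \<longlongrightarrow> v s) F" for s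
    using tendsto_fst[OF lim[of s]] by (simp add: f_def v_def)
  have Py: "((\<lambda>m. P m (idx m s)) \<longlongrightarrow> y s) F" for s
    using tendsto_fst[OF tendsto_snd[OF lim[of s]]] by (simp add: f_def y_def)
  have NT: "((\<lambda>m. N m * h m) \<longlongrightarrow> T) F"
    using tendsto_snd[OF tendsto_snd[OF lim[of 0]]] by (simp add: f_def T_def)
  have v_cl: "v s \<in> closure \<Omega>" and y_V: "norm (y s) \<le> V" for s
    using z[of s] by (auto simp: K_def v_def y_def)
  have T0: "0 \<le> T" using z[of 0] by (auto simp: K_def T_def)
  have \<epsilon>lim: "(\<epsilon> \<longlongrightarrow> 0) F"
  proof (rule tendsto_mono[OF F(2)], rule tendsto_sandwich[where f = "\<lambda>_. 0" and h = "\<lambda>m. 1 / real (Suc m)"])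
    show "\<forall>\<^sub>F m in sequentially. 0 \<le> \<epsilon> m" by (intro always_eventually allI less_imp_le \<epsilon>0)
    show "\<forall>\<^sub>F m in sequentially. \<epsilon> m \<le> 1 / real (Suc m)" by (simp add: \<epsilon>_def)
    show "(\<lambda>m. 1 / real (Suc m)) \<longlonglongrightarrow> 0" by (rule LIMSEQ_inverse_real_of_nat[unfolded inverse_eq_divide])
  qed simp
  have hlim: "(h \<longlongrightarrow> 0) F"
    by (rule tendsto_sandwich[OF _ _ tendsto_const \<epsilon>lim]) (use h h0 in \<open>auto intro!: always_eventually less_imp_le\<close>)
  have \<delta>lim: "(\<delta> \<longlongrightarrow> 0) F"
  proof (rule tendsto_sandwich[OF _ _ tendsto_const \<epsilon>lim])
    have "\<delta> m > 0" for m
      using D[of m] by (simp add: discrete_brake_def discrete_minimizer_def discrete_minimizer_axioms_def)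
    then show "\<forall>\<^sub>F m in F. 0 \<le> \<delta> m" by (intro always_eventually allI less_imp_le)
  qed (use \<delta> in auto)
  have Ulim: "((\<lambda>m. U (x m (idx m s))) \<longlongrightarrow> U (v s)) F" for s
    by (rule continuous_on_tendsto_compose[OF continuous_on_U[of UNIV] xv]) auto
  have glim: "((\<lambda>m. g (x m (idx m s))) \<longlongrightarrow> g (v s)) F" for s
    by (rule continuous_on_tendsto_compose[OF continuous_on_g xv v_cl])
      (use discrete_minimizer.x_closure[OF discrete_brake.axioms(1)[OF D]] in simp)
  have exp_v: "norm (v t - v s - ((t - s) * T) *\<^sub>R y s) \<le> G * ((t - s) * T)\<^sup>2"
    if st: "0 \<le> s" "s \<le> t" "t \<le> 1" for s t
  proof -
    have "((\<lambda>m. norm (x m (idx m t) - x m (idx m s) - ((t - s) * (N m * h m)) *\<^sub>R P m (idx m s)))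
        \<longlongrightarrow> norm (v t - v s - ((t - s) * T) *\<^sub>R y s)) F"
      by (intro tendsto_intros xv Py NT)
    moreover have "((\<lambda>m. G * ((t - s) * (N m * h m) + h m)\<^sup>2 + h m * V) \<longlongrightarrow> G * ((t - s) * T + 0)\<^sup>2 + 0 * V) F"
      by (intro tendsto_intros NT hlim)
    moreover have "norm (x m (idx m t) - x m (idx m s) - ((t - s) * (N m * h m)) *\<^sub>R P m (idx m s))
        \<le> G * ((t - s) * (N m * h m) + h m)\<^sup>2 + h m * V" for m
      unfolding P_def idx_def V
      by (intro discrete_brake.expansion_x[OF D] discrete_brake.idx_diff[OF D] discrete_brake.idx_le[OF D] st)
        (use st h0[of m] in simp)
    ultimately show ?thesis
      using tendsto_le[OF F(1)] by (metis (no_types, lifting) add.right_neutral always_eventually mult_zero_left)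
  qed
  have exp_y: "norm (y t - y s - ((t - s) * T) *\<^sub>R g (v s)) \<le> M * V * ((t - s) * T)\<^sup>2"
    if st: "0 \<le> s" "s \<le> t" "t \<le> 1" for s t
  proof -
    have "((\<lambda>m. norm (P m (idx m t) - P m (idx m s) - ((t - s) * (N m * h m)) *\<^sub>R g (x m (idx m s))))
        \<longlongrightarrow> norm (y t - y s - ((t - s) * T) *\<^sub>R g (v s))) F"
      by (intro tendsto_intros glim Py NT)
    moreover have "((\<lambda>m. M * V * ((t - s) * (N m * h m) + h m)\<^sup>2 + h m * G) \<longlongrightarrow> M * V * ((t - s) * T + 0)\<^sup>2 + 0 * G) F"
      by (intro tendsto_intros NT hlim)
    moreover have "norm (P m (idx m t) - P m (idx m s) - ((t - s) * (N m * h m)) *\<^sub>R g (x m (idx m s)))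
        \<le> M * V * ((t - s) * (N m * h m) + h m)\<^sup>2 + h m * G" for m
      unfolding P_def idx_def V
      by (intro discrete_brake.expansion_P[OF D] discrete_brake.idx_diff[OF D] discrete_brake.idx_le[OF D] st)
        (use st h0[of m] in simp)
    ultimately show ?thesis
      using tendsto_le[OF F(1)] by (metis (no_types, lifting) add.right_neutral always_eventually mult_zero_left)
  qed
  have V0: "0 \<le> V" using discrete_brake.V_pos[OF D[of 0]] V by simp
  have sq: "((t - s) * T)\<^sup>2 \<le> T\<^sup>2 * (t - s)" if "0 \<le> s" "s \<le> t" "t \<le> 1" for s t :: real
  proof -
    have "(t - s) * (t - s) \<le> (t - s) * 1" using that by (intro mult_left_mono) auto
    then have "T\<^sup>2 * ((t - s) * (t - s)) \<le> T\<^sup>2 * (t - s)" by (intro mult_left_mono) auto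
    then show ?thesis by (simp add: power2_eq_square mult_ac)
  qed
  have lip_v: "norm (v t - v s) \<le> (G * T\<^sup>2 + T * V) * (t - s)" if st: "0 \<le> s" "s \<le> t" "t \<le> 1" for s t
  proof -
    have "norm (v t - v s) \<le> norm (v t - v s - ((t - s) * T) *\<^sub>R y s) + norm (((t - s) * T) *\<^sub>R y s)"
      by (metis diff_add_cancel norm_triangle_ineq)
    also have "\<dots> \<le> G * (T\<^sup>2 * (t - s)) + (t - s) * T * V"
    proof (rule add_mono)
      show "norm (v t - v s - ((t - s) * T) *\<^sub>R y s) \<le> G * (T\<^sup>2 * (t - s))"
        by (rule order_trans[OF exp_v[OF st] mult_left_mono[OF sq[OF st]]]) (use G_pos in simp)
      show "norm (((t - s) * T) *\<^sub>R y s) \<le> (t - s) * T * V"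
        using st T0 y_V[of s] by (simp add: mult_left_mono)
    qed
    finally show ?thesis by (simp add: algebra_simps)
  qed
  have lip_y: "norm (y t - y s) \<le> (M * V * T\<^sup>2 + T * G) * (t - s)" if st: "0 \<le> s" "s \<le> t" "t \<le> 1" for s t
  proof -
    have "norm (y t - y s) \<le> norm (y t - y s - ((t - s) * T) *\<^sub>R g (v s)) + norm (((t - s) * T) *\<^sub>R g (v s))"
      by (metis diff_add_cancel norm_triangle_ineq)
    also have "\<dots> \<le> M * V * (T\<^sup>2 * (t - s)) + (t - s) * T * G"
    proof (rule add_mono)
      show "norm (y t - y s - ((t - s) * T) *\<^sub>R g (v s)) \<le> M * V * (T\<^sup>2 * (t - s))"
        by (rule order_trans[OF exp_y[OF st] mult_left_mono[OF sq[OF st]]]) (use M_pos V0 in simp)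
      show "norm (((t - s) * T) *\<^sub>R g (v s)) \<le> (t - s) * T * G"
        using st T0 g_bound[OF v_cl[of s]] by (simp add: mult_left_mono)
    qed
    finally show ?thesis by (simp add: algebra_simps)
  qed
  have dv: "(v has_vector_derivative T *\<^sub>R y s) (at s within {0..1})" if s: "s \<in> {0..1}" for s
  proof (rule has_vector_derivative_quadratic[OF _ _ s])
    \<comment> \<open>One constant has to serve both the expansion and the Lipschitz bound; the sum
      of the two does.\<close>
    let ?c = "G * T\<^sup>2 + T * (M * V * T\<^sup>2 + T * G)"
    fix s t :: real assume st: "0 \<le> s" "s \<le> t" "t \<le> 1"
    have "G * ((t - s) * T)\<^sup>2 + 0 \<le> G * T\<^sup>2 * (t - s)\<^sup>2 + T * (M * V * T\<^sup>2 + T * G) * (t - s)\<^sup>2"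
      using T0 M_pos V0 G_pos by (intro add_mono) (simp_all add: power_mult_distrib)
    then show "norm (v t - v s - (t - s) *\<^sub>R (T *\<^sub>R y s)) \<le> ?c * (t - s)\<^sup>2"
      using exp_v[OF st] by (simp add: distrib_right)
    have "norm (T *\<^sub>R y t - T *\<^sub>R y s) = T * norm (y t - y s)"
      using T0 by (simp flip: scaleR_diff_right)
    also have "\<dots> \<le> T * ((M * V * T\<^sup>2 + T * G) * (t - s))" by (intro mult_left_mono lip_y st T0)
    also have "\<dots> + 0 \<le> T * ((M * V * T\<^sup>2 + T * G) * (t - s)) + G * T\<^sup>2 * (t - s)"
      using G_pos st by (intro add_left_mono) simp
    finally show "norm (T *\<^sub>R y t - T *\<^sub>R y s) \<le> ?c * (t - s)" by (simp add: algebra_simps)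
  qed
  have dy: "(y has_vector_derivative T *\<^sub>R g (v s)) (at s within {0..1})" if s: "s \<in> {0..1}" for s
  proof (rule has_vector_derivative_quadratic[OF _ _ s])
    let ?c = "M * V * T\<^sup>2 + T * (M * (G * T\<^sup>2 + T * V))"
    fix s t :: real assume st: "0 \<le> s" "s \<le> t" "t \<le> 1"
    have "M * V * ((t - s) * T)\<^sup>2 + 0 \<le> M * V * T\<^sup>2 * (t - s)\<^sup>2 + T * (M * (G * T\<^sup>2 + T * V)) * (t - s)\<^sup>2"
      using T0 M_pos V0 G_pos by (intro add_mono) (simp_all add: power_mult_distrib)
    then show "norm (y t - y s - (t - s) *\<^sub>R (T *\<^sub>R g (v s))) \<le> ?c * (t - s)\<^sup>2"
      using exp_y[OF st] by (simp add: distrib_right)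
    have "norm (T *\<^sub>R g (v t) - T *\<^sub>R g (v s)) = T * norm (g (v t) - g (v s))"
      using T0 by (simp flip: scaleR_diff_right)
    also have "\<dots> \<le> T * (M * norm (v t - v s))" by (intro mult_left_mono g_lip v_cl T0)
    also have "\<dots> \<le> T * (M * ((G * T\<^sup>2 + T * V) * (t - s)))"
      by (intro mult_left_mono lip_v st T0) (use M_pos in simp)
    also have "\<dots> + 0 \<le> T * (M * ((G * T\<^sup>2 + T * V) * (t - s))) + M * V * T\<^sup>2 * (t - s)"
      using M_pos V0 st by (intro add_left_mono) simp
    finally show "norm (T *\<^sub>R g (v t) - T *\<^sub>R g (v s)) \<le> ?c * (t - s)" by (simp add: algebra_simps)
  qed
  have e1: "(norm (y s))\<^sup>2 / 2 - U (v s) = 0" if s: "s \<in> {0..<1}" for s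
  proof -
    have L: "((\<lambda>m. (norm (P m (idx m s)))\<^sup>2 / 2 - U (x m (idx m s))) \<longlongrightarrow> (norm (y s))\<^sup>2 / 2 - U (v s)) F"
      by (intro tendsto_intros Py Ulim) simp
    have "((\<lambda>m. (norm (P m (idx m s)))\<^sup>2 / 2 - U (x m (idx m s))) \<longlongrightarrow> 0) F"
    proof (rule tendsto_sandwich[OF _ _ tendsto_const tendsto_mult_right_zero[OF \<delta>lim, of 2]])
      show "\<forall>\<^sub>F m in F. 0 \<le> (norm (P m (idx m s)))\<^sup>2 / 2 - U (x m (idx m s))"
        unfolding P_def idx_def by (intro always_eventually allI discrete_brake.energy_P[OF D]) (use s in simp)
      show "\<forall>\<^sub>F m in F. (norm (P m (idx m s)))\<^sup>2 / 2 - U (x m (idx m s)) \<le> 2 * \<delta> m"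
        unfolding P_def idx_def by (intro always_eventually allI discrete_brake.energy_P[OF D]) (use s in simp)
    qed
    from tendsto_unique[OF F(1) L this] show ?thesis .
  qed
  have cv: "continuous_on {0..1} v" by (rule continuous_on_vector_derivative) (rule dv)
  have cy: "continuous_on {0..1} y" by (rule continuous_on_vector_derivative) (rule dy)
  have cl: "closure {0..<1} = {0..1::real}" by (rule closure_atLeastLessThan) simp
  have e: "(norm (y s))\<^sup>2 / 2 - U (v s) = 0" if s: "s \<in> {0..1}" for s
  proof (rule continuous_constant_on_closure[where f = "\<lambda>s. (norm (y s))\<^sup>2 / 2 - U (v s)" and S = "{0..<1}"])
    show "continuous_on (closure {0..<1}) (\<lambda>s. (norm (y s))\<^sup>2 / 2 - U (v s))"
      unfolding cl by (intro continuous_intros cy continuous_on_compose2[OF continuous_on_U[of UNIV] cv]) auto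
    show "s \<in> closure {0..<1}" unfolding cl by (rule s)
  qed (rule e1)
  have v0: "v 0 = 0"
  proof -
    have "x m (idx m 0) = 0" for m
      unfolding idx_def discrete_brake.idx_0[OF D]
      using discrete_minimizer.adm[OF discrete_brake.axioms(1)[OF D]] by (simp add: admissible_def)
    then have "((\<lambda>_. 0) \<longlongrightarrow> v 0) F" using xv[of 0] by simp
    then show ?thesis using tendsto_unique[OF F(1) _ tendsto_const] by metis
  qed
  have v1: "v 1 \<in> frontier \<Omega>"
  proof (rule Lim_in_closed_set[OF frontier_closed _ F(1) xv])
    show "\<forall>\<^sub>F m in F. x m (idx m 1) \<in> frontier \<Omega>"
      unfolding idx_def discrete_brake.idx_1[OF D]
      using discrete_minimizer.adm[OF discrete_brake.axioms(1)[OF D]] by (simp add: admissible_def)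
  qed
  \<comment> \<open>Vanishing travel time would put the start \<open>0\<close> on the
    frontier.\<close>
  have "T \<noteq> 0"
  proof
    assume "T = 0"
    then have "v 1 = v 0" using exp_v[of 0 1] by simp
    then show False using v0 v1 zero_in frontier_notin by simp
  qed
  then have "T > 0" using T0 by simp
  from that[OF this v0 v1 v_cl dv dy] e show ?thesis by simp
qed

end

text \<open>The limit of curves in \<open>\<Omega>\<close> is only known to lie in the closure and
  may touch the frontier early, so it is cut at the first contact. There \<open>U\<close> vanishes,
  and zero energy makes the velocity vanish as well.\<close>

lemma (in unstable_well) brake_orbit:
  obtains T v y where "T > 0" "v 0 = 0" "v T \<in> frontier \<Omega>" "y T = 0" "\<And>t. t \<in> {0..<T} \<Longrightarrow> v t \<in> \<Omega>"
    "\<And>t. t \<in> {0..T} \<Longrightarrow> (v has_vector_derivative y t) (at t within {0..T})"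
    "\<And>t. t \<in> {0..T} \<Longrightarrow> (y has_vector_derivative g (v t)) (at t within {0..T})"
    "\<And>t. t \<in> {0..T} \<Longrightarrow> (norm (y t))\<^sup>2 / 2 = U (v t)"
proof -
  obtain T v y where T: "T > 0" and v0: "v 0 = 0" and v1: "v 1 \<in> frontier \<Omega>" and v_cl: "\<And>s. v s \<in> closure \<Omega>"
    and dv: "\<And>s. s \<in> {0..1} \<Longrightarrow> (v has_vector_derivative T *\<^sub>R y s) (at s within {0..1})"
    and dy: "\<And>s. s \<in> {0..1} \<Longrightarrow> (y has_vector_derivative T *\<^sub>R g (v s)) (at s within {0..1})"
    and e: "\<And>s. s \<in> {0..1} \<Longrightarrow> (norm (y s))\<^sup>2 / 2 = U (v s)"
    by (rule limit_curve) (rule that)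
  have cv: "continuous_on {0..1} v" by (rule continuous_on_vector_derivative) (rule dv)
  have "compact ({0..1} \<inter> v -` frontier \<Omega>)"
    unfolding compact_eq_bounded_closed
    by (intro conjI bounded_subset[OF bounded_closed_interval Int_lower1]
        continuous_closed_preimage[OF cv closed_atLeastAtMost frontier_closed])
  moreover have "1 \<in> {0..1} \<inter> v -` frontier \<Omega>" using v1 by simp
  ultimately obtain a where "a \<in> {0..1} \<inter> v -` frontier \<Omega>" "\<forall>s\<in>{0..1} \<inter> v -` frontier \<Omega>. a \<le> s"
    using compact_attains_inf by (metis empty_iff)
  then have a: "a \<in> {0..1}" "v a \<in> frontier \<Omega>"
    and least: "\<And>s. \<lbrakk>s \<in> {0..1}; v s \<in> frontier \<Omega>\<rbrakk> \<Longrightarrow> a \<le> s"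
    by simp_all
  have "a \<noteq> 0" using a(2) v0 zero_in frontier_notin by auto
  then have a0: "a > 0" using a(1) by simp
  define v2 where "v2 t = v (t / T)" for t
  define y2 where "y2 t = y (t / T)" for t
  have range: "t / T \<in> {0..1}" if "t \<in> {0..a * T}" for t
  proof -
    have "a * T \<le> 1 * T" using a(1) T by (intro mult_right_mono) auto
    then have "0 \<le> t" "t \<le> T" using that by auto
    then show ?thesis using T by simp
  qed
  have sub: "(\<lambda>t. t / T) ` {0..a * T} \<subseteq> {0..1}" using range by blast
  have chain: "((\<lambda>t. f (t / T)) has_vector_derivative d) (at t within {0..a * T})"
    if f: "(f has_vector_derivative T *\<^sub>R d) (at (t / T) within {0..1})" for f :: "real \<Rightarrow> 'a" and d t
  proof -
    have "((\<lambda>t. t / T) has_vector_derivative 1 / T) (at t within {0..a * T})"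
      unfolding has_real_derivative_iff_has_vector_derivative[symmetric] by (rule DERIV_cdivide[OF DERIV_ident])
    from vector_diff_chain_within[OF this has_vector_derivative_within_subset[OF f sub]]
    show ?thesis using T by (simp add: o_def)
  qed
  show ?thesis
  proof (rule that[of "a * T" v2 y2])
    show "a * T > 0" using a0 T by simp
    show "v2 0 = 0" by (simp add: v2_def v0)
    show vT: "v2 (a * T) \<in> frontier \<Omega>" using a(2) T by (simp add: v2_def)
    have "(norm (y a))\<^sup>2 / 2 = 0" unfolding e[OF a(1)] by (rule U_frontier[OF a(2)])
    then show "y2 (a * T) = 0" using T by (simp add: y2_def)
    show "v2 t \<in> \<Omega>" if t: "t \<in> {0..<a * T}" for t
    proof -
      have "t / T < a" using t T by (simp add: field_simps)
      moreover have "t / T \<in> {0..1}" using t by (intro range) simp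
      ultimately have "v (t / T) \<notin> frontier \<Omega>" using least[of "t / T"] by linarith
      then show ?thesis using closure_cases[OF v_cl] unfolding v2_def by blast
    qed
    fix t assume t: "t \<in> {0..a * T}"
    show "(v2 has_vector_derivative y2 t) (at t within {0..a * T})"
      unfolding v2_def y2_def by (rule chain[OF dv[OF range[OF t]]])
    show "(y2 has_vector_derivative g (v2 t)) (at t within {0..a * T})"
      unfolding v2_def y2_def by (rule chain[OF dy[OF range[OF t]]])
    show "(norm (y2 t))\<^sup>2 / 2 = U (v2 t)"
      unfolding v2_def y2_def by (rule e[OF range[OF t]])
  qed
qed

section \<open>Reflection and periodic extension\<close>

lemma has_vector_derivative_Un:
  assumes "(f has_vector_derivative d) (at t within S)" "(f has_vector_derivative d) (at t within S')"
  shows "(f has_vector_derivative d) (at t within S \<union> S')"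
  using assms unfolding has_vector_derivative_def has_derivative_within by (auto intro: Lim_Un)

text \<open>At a lattice point the derivatives from the two adjacent cells agree, both being the
  value of the one function \<open>w'\<close>; elsewhere the point is interior to its cell.\<close>

lemma has_vector_derivative_lattice:
  fixes w :: "real \<Rightarrow> 'b::real_normed_vector"
  assumes a: "a > 0"
    and w: "\<And>j t. t \<in> {of_int j * a..(of_int j + 1) * a}
      \<Longrightarrow> (w has_vector_derivative w' t) (at t within {of_int j * a..(of_int j + 1) * a})"
  shows "(w has_vector_derivative w' t) (at t)"
proof -
  define j where "j = \<lfloor>t / a\<rfloor>"
  have "of_int j \<le> t / a" "t / a < of_int j + 1" by (auto simp: j_def)
  then have j: "of_int j * a \<le> t" "t < (of_int j + 1) * a"
    using a by (simp_all add: pos_le_divide_eq pos_divide_less_eq)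
  show ?thesis
  proof (cases "of_int j * a = t")
    case False
    then have "t \<in> interior {of_int j * a..(of_int j + 1) * a}" using j by simp
    moreover have "(w has_vector_derivative w' t) (at t within {of_int j * a..(of_int j + 1) * a})"
      using j by (intro w) simp
    ultimately show ?thesis by (simp only: at_within_interior)
  next
    case True
    have t1: "t = (of_int (j - 1) + 1) * a" using True by simp
    have lt: "of_int (j - 1) * a < t" "t < (of_int j + 1) * a" using True a by (simp_all add: algebra_simps)
    have "(w has_vector_derivative w' t) (at t within
        {of_int (j - 1) * a..(of_int (j - 1) + 1) * a} \<union> {of_int j * a..(of_int j + 1) * a})"
    proof (intro has_vector_derivative_Un w)
      show "t \<in> {of_int (j - 1) * a..(of_int (j - 1) + 1) * a}"
        unfolding t1[symmetric] using lt(1) by simp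
      show "t \<in> {of_int j * a..(of_int j + 1) * a}" unfolding True using lt(2) by simp
    qed
    also have "{of_int (j - 1) * a..(of_int (j - 1) + 1) * a} \<union> {of_int j * a..(of_int j + 1) * a}
        = {of_int (j - 1) * a..(of_int j + 1) * a}"
      unfolding t1[symmetric] True using lt by (intro ivl_disj_un_two_touch) simp_all
    also have "at t within {of_int (j - 1) * a..(of_int j + 1) * a} = at t"
      using lt by (intro at_within_interior) simp
    finally show ?thesis .
  qed
qed

text \<open>The orbit is traversed back from its turning point and then continued as an odd function. On the
  quarter period \<open>[j T, (j + 1) T]\<close> the extension is \<open>\<plusminus> v\<close>, run forwards for even \<open>j\<close>
  and backwards for odd \<open>j\<close>, with signs \<open>+ + - -\<close>.\<close>

lemma periodic_extension:
  fixes v y :: "real \<Rightarrow> 'b::real_normed_vector"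
  assumes T: "T > 0" and v0: "v 0 = 0" and yT: "y T = 0"
    and dv: "\<And>t. t \<in> {0..T} \<Longrightarrow> (v has_vector_derivative y t) (at t within {0..T})"
    and dy: "\<And>t. t \<in> {0..T} \<Longrightarrow> (y has_vector_derivative g (v t)) (at t within {0..T})"
    and odd: "\<And>t. t \<in> {0..T} \<Longrightarrow> g (- v t) = - g (v t)"
  obtains w w' where
    "\<And>t. (w has_vector_derivative w' t) (at t)"
    "\<And>t. (w' has_vector_derivative g (w t)) (at t)"
    "\<And>t. w (t + 4 * T) = w t" "\<And>t. w (- t) = - w t"
    "\<And>t. t \<in> {0..T} \<Longrightarrow> w t = v t"
    "\<And>t. \<exists>s\<in>{0..T}. (w t = v s \<or> w t = - v s) \<and> norm (w' t) = norm (y s)"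
proof -
  \<comment> \<open>A triangle wave that folds the line onto \<open>{0..T}\<close>.\<close>
  define \<rho> where "\<rho> j t = (if even j then t - of_int j * T else (of_int j + 1) * T - t)" for j :: int and t
  define sg :: "int \<Rightarrow> real" where "sg j = (if even (j div 2) then 1 else - 1)" for j
  \<comment> \<open>On odd cells the orbit runs backwards, which reverses the sign of the
    velocity.\<close>
  define sg' :: "int \<Rightarrow> real" where "sg' j = (if even j then sg j else - sg j)" for j
  define J where "J j = {of_int j * T..(of_int j + 1) * T}" for j :: int
  define w where "w t = sg \<lfloor>t / T\<rfloor> *\<^sub>R v (\<rho> \<lfloor>t / T\<rfloor> t)" for t
  define w' where "w' t = sg' \<lfloor>t / T\<rfloor> *\<^sub>R y (\<rho> \<lfloor>t / T\<rfloor> t)" for t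
  have sg_even: "sg (j + 1) = sg j" if "even j" for j
    unfolding sg_def using that by (auto elim!: evenE)
  have sg_odd: "sg (j + 1) = - sg j" if "odd j" for j
    unfolding sg_def using that by (auto elim!: oddE)
  have sg_neg: "sg (- 1 - j) = - sg j" for j
  proof -
    have "(- 1 - j) div 2 = - 1 - j div 2" by presburger
    then show ?thesis unfolding sg_def by simp
  qed
  have sg4: "sg (j + 4) = sg j" for j
  proof -
    have "(j + 4) div 2 = j div 2 + 2" by presburger
    then show ?thesis unfolding sg_def by simp
  qed
  have sg1: "sg j = 1 \<or> sg j = - 1" for j by (simp add: sg_def)
  have \<rho>_range: "\<rho> j t \<in> {0..T}" if "t \<in> J j" for j t
    using that by (auto simp: \<rho>_def J_def algebra_simps)
  have fl: "\<lfloor>t / T\<rfloor> = j \<or> (\<lfloor>t / T\<rfloor> = j + 1 \<and> t = (of_int j + 1) * T)" if "t \<in> J j" for j t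
  proof (cases "t = (of_int j + 1) * T")
    case True
    then have "t / T = of_int (j + 1)" using T by simp
    then show ?thesis using True by (metis floor_of_int)
  next
    case False
    then have "of_int j * T \<le> t" "t < (of_int j + 1) * T" using that by (auto simp: J_def)
    then have "of_int j \<le> t / T" "t / T < of_int j + 1" using T by (simp_all add: pos_le_divide_eq pos_divide_less_eq)
    then have "\<lfloor>t / T\<rfloor> = j" by (rule floor_unique)
    then show ?thesis by simp
  qed
  have \<rho>_next: "\<rho> (j + 1) t = \<rho> j t" "even j \<Longrightarrow> \<rho> j t = T" "odd j \<Longrightarrow> \<rho> j t = 0"
    if "t = (of_int j + 1) * T" for j t
    unfolding that by (simp_all add: \<rho>_def algebra_simps)
  have w_J: "w t = sg j *\<^sub>R v (\<rho> j t)" if t: "t \<in> J j" for j t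
    using fl[OF t]
  proof
    assume "\<lfloor>t / T\<rfloor> = j + 1 \<and> t = (of_int j + 1) * T"
    then have f: "\<lfloor>t / T\<rfloor> = j + 1" and e: "t = (of_int j + 1) * T" by auto
    have "w t = sg (j + 1) *\<^sub>R v (\<rho> j t)" unfolding w_def f \<rho>_next(1)[OF e] ..
    \<comment> \<open>From an odd cell to the next the sign changes, but there the position is
      \<open>v 0 = 0\<close>.\<close>
    then show ?thesis
      using \<rho>_next(3)[OF e] by (cases "even j") (simp_all add: sg_even sg_odd v0)
  qed (simp add: w_def)
  have w'_J: "w' t = sg' j *\<^sub>R y (\<rho> j t)" if t: "t \<in> J j" for j t
    using fl[OF t]
  proof
    assume "\<lfloor>t / T\<rfloor> = j + 1 \<and> t = (of_int j + 1) * T"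
    then have f: "\<lfloor>t / T\<rfloor> = j + 1" and e: "t = (of_int j + 1) * T" by auto
    have "w' t = sg' (j + 1) *\<^sub>R y (\<rho> j t)" unfolding w'_def f \<rho>_next(1)[OF e] ..
    \<comment> \<open>From an even cell to the next the direction is reversed, but there the
      velocity is \<open>y T = 0\<close>.\<close>
    then show ?thesis
      using \<rho>_next(2)[OF e] by (cases "even j") (simp_all add: sg'_def sg_even sg_odd yT)
  qed (simp add: w'_def)
  have in_J: "t \<in> J \<lfloor>t / T\<rfloor>" for t
  proof -
    have "of_int \<lfloor>t / T\<rfloor> \<le> t / T" "t / T < of_int \<lfloor>t / T\<rfloor> + 1" by auto
    then have "of_int \<lfloor>t / T\<rfloor> * T \<le> t" "t < (of_int \<lfloor>t / T\<rfloor> + 1) * T"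
      using T by (simp_all only: pos_le_divide_eq pos_divide_less_eq)
    then show ?thesis by (simp add: J_def)
  qed
  have chain: "((\<lambda>t. f (\<rho> j t)) has_vector_derivative (if even j then d else - d)) (at t within J j)"
    if f: "(f has_vector_derivative d) (at (\<rho> j t) within {0..T})" for f :: "real \<Rightarrow> 'b" and d j t
  proof -
    have A: "(\<rho> j has_vector_derivative (if even j then 1 else - 1)) (at t within J j)"
      unfolding \<rho>_def has_real_derivative_iff_has_vector_derivative[symmetric]
      by (auto intro!: derivative_eq_intros)
    have S: "\<rho> j ` J j \<subseteq> {0..T}" using \<rho>_range by auto
    show ?thesis
      using vector_diff_chain_within[OF A has_vector_derivative_within_subset[OF f S]]
      by (cases "even j") (simp_all add: o_def)
  qed
  have g_w: "g (w t) = sg j *\<^sub>R g (v (\<rho> j t))" if "t \<in> J j" for j t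
    unfolding w_J[OF that] using sg1[of j] odd[OF \<rho>_range[OF that]] by auto
  have sg'1: "sg' j = 1 \<or> sg' j = - 1" for j using sg1 by (auto simp: sg'_def)
  show ?thesis
  proof (rule that)
    fix t
    show "(w has_vector_derivative w' t) (at t)"
    proof (rule has_vector_derivative_lattice[OF T], fold J_def)
      fix j t assume t: "t \<in> J j"
      have "((\<lambda>t. sg j *\<^sub>R v (\<rho> j t)) has_vector_derivative sg j *\<^sub>R (if even j then y (\<rho> j t) else - y (\<rho> j t)))
          (at t within J j)"
        by (rule bounded_linear.has_vector_derivative[OF bounded_linear_scaleR_right chain[OF dv[OF \<rho>_range[OF t]]]])
      then have "((\<lambda>t. sg j *\<^sub>R v (\<rho> j t)) has_vector_derivative w' t) (at t within J j)"
        unfolding w'_J[OF t] by (simp add: sg'_def split: if_splits)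
      then show "(w has_vector_derivative w' t) (at t within J j)"
        by (rule has_vector_derivative_transform[OF t, rotated]) (simp add: w_J)
    qed
    show "(w' has_vector_derivative g (w t)) (at t)"
    proof (rule has_vector_derivative_lattice[OF T], fold J_def)
      fix j t assume t: "t \<in> J j"
      have "((\<lambda>t. sg' j *\<^sub>R y (\<rho> j t)) has_vector_derivative
          sg' j *\<^sub>R (if even j then g (v (\<rho> j t)) else - g (v (\<rho> j t)))) (at t within J j)"
        by (rule bounded_linear.has_vector_derivative[OF bounded_linear_scaleR_right chain[OF dy[OF \<rho>_range[OF t]]]])
      then have "((\<lambda>t. sg' j *\<^sub>R y (\<rho> j t)) has_vector_derivative g (w t)) (at t within J j)"
        unfolding g_w[OF t] by (simp add: sg'_def split: if_splits)
      then show "(w' has_vector_derivative g (w t)) (at t within J j)"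
        by (rule has_vector_derivative_transform[OF t, rotated]) (simp add: w'_J)
    qed
    show "w (t + 4 * T) = w t"
    proof -
      have "(t + 4 * T) / T = t / T + of_int 4" using T by (simp add: add_divide_distrib)
      then have "\<lfloor>(t + 4 * T) / T\<rfloor> = \<lfloor>t / T\<rfloor> + 4" by (simp only: floor_add_int)
      moreover have "\<rho> (j + 4) (t + 4 * T) = \<rho> j t" for j by (simp add: \<rho>_def algebra_simps)
      ultimately show ?thesis by (simp add: w_def sg4)
    qed
    show "w (- t) = - w t"
    proof -
      let ?j = "\<lfloor>t / T\<rfloor>"
      \<comment> \<open>Reflection exchanges the cells \<open>j\<close> and \<open>- 1 - j\<close>,
        which have opposite parity, so the folded time is unchanged while the sign is
        reversed.\<close>
      have "- t \<in> J (- 1 - ?j)" using in_J[of t] by (simp add: J_def algebra_simps)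
      from w_J[OF this] have "w (- t) = - sg ?j *\<^sub>R v (\<rho> (- 1 - ?j) (- t))" by (simp add: sg_neg)
      also have "\<rho> (- 1 - ?j) (- t) = \<rho> ?j t" by (simp add: \<rho>_def algebra_simps)
      finally show ?thesis by (simp add: w_def)
    qed
    show "w t = v t" if "t \<in> {0..T}"
      using w_J[of t 0] that by (simp add: J_def sg_def \<rho>_def)
    show "\<exists>s\<in>{0..T}. (w t = v s \<or> w t = - v s) \<and> norm (w' t) = norm (y s)"
      using \<rho>_range[OF in_J[of t]] sg1[of "\<lfloor>t / T\<rfloor>"] sg'1[of "\<lfloor>t / T\<rfloor>"]
      by (intro bexI[of _ "\<rho> \<lfloor>t / T\<rfloor> t"]) (auto simp: w_def w'_def)
  qed
qed

section \<open>Functions of class \<open>C\<^sup>2\<close>\<close>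

lemma bounded_bilinear_matrix_vector_mult: "bounded_bilinear ((*v) :: real ^ 'n ^ 'm \<Rightarrow> real ^ 'n \<Rightarrow> real ^ 'm)"
  unfolding bilinear_conv_bounded_bilinear[symmetric] bilinear_def
  by (auto intro!: linearI simp: matrix_vector_mult_add_rdistrib matrix_vector_right_distrib
      matrix_vector_mult_scaleR scaleR_matrix_vector_assoc)

context
  fixes U :: "real ^ 'n \<Rightarrow> real"
  assumes C2: "class_C2 U"
begin

lemma U_has_derivative: "(U has_derivative (\<lambda>h. gradient U x \<bullet> h)) (at x)"
  using GDERIV_gradient[of U x] C2 unfolding class_C2_def gderiv_def by (simp add: inner_commute)

lemma gradient_has_derivative: "(gradient U has_derivative (\<lambda>h. hessian U x *v h)) (at x)"
  using C2 unfolding class_C2_def hessian_def by (simp flip: jacobian_works)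

lemma continuous_on_gradient: "continuous_on S (gradient U)"
  by (rule continuous_at_imp_continuous_on) (intro ballI has_derivative_continuous[OF gradient_has_derivative])

lemma continuous_on_hessian: "continuous_on S (hessian U)"
  by (rule continuous_on_subset[of UNIV]) (use C2 in \<open>simp_all add: class_C2_def\<close>)

lemma continuous_on_hessian_form: "continuous_on S (\<lambda>z. (hessian U z *v a) \<bullet> b)"
  by (intro continuous_intros continuous_on_hessian
      bounded_bilinear.continuous_on[OF bounded_bilinear_matrix_vector_mult])

section \<open>Derivatives along lines and symmetry of the Hessian\<close>

lemma line_derivative:
  "((\<lambda>t. U (x + t *\<^sub>R a)) has_real_derivative gradient U (x + t *\<^sub>R a) \<bullet> a) (at t)"
proof -
  have "((\<lambda>t. x + t *\<^sub>R a) has_derivative (\<lambda>h. h *\<^sub>R a)) (at t)"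
    by (auto intro!: derivative_eq_intros)
  from has_derivative_compose[OF this U_has_derivative]
  show ?thesis by (simp add: has_field_derivative_def mult_commute_abs)
qed

lemma line_gradient_derivative:
  "((\<lambda>t. gradient U (x + t *\<^sub>R a) \<bullet> b) has_real_derivative (hessian U (x + t *\<^sub>R a) *v a) \<bullet> b) (at t)"
proof -
  have "((\<lambda>t. x + t *\<^sub>R a) has_derivative (\<lambda>h. h *\<^sub>R a)) (at t)"
    by (auto intro!: derivative_eq_intros)
  from has_derivative_inner_left[OF has_derivative_compose[OF this gradient_has_derivative], of b]
  show ?thesis
    by (simp add: has_field_derivative_def mult_commute_abs matrix_vector_mult_scaleR)
qed

text \<open>The mean value theorem is used twice: along \<open>a\<close> for the increment of
  \<open>U\<close> in direction \<open>b\<close>, then along \<open>b\<close> for the resulting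
  increment of the gradient.\<close>

lemma mixed_difference:
  assumes "s > 0"
  obtains \<xi> where "norm (\<xi> - p) \<le> s * (norm a + norm b)"
    "U (p + s *\<^sub>R a + s *\<^sub>R b) - U (p + s *\<^sub>R a) - U (p + s *\<^sub>R b) + U p = s\<^sup>2 * ((hessian U \<xi> *v b) \<bullet> a)"
proof -
  have "((\<lambda>t. U ((p + s *\<^sub>R b) + t *\<^sub>R a) - U (p + t *\<^sub>R a)) has_real_derivative
      gradient U ((p + s *\<^sub>R b) + t *\<^sub>R a) \<bullet> a - gradient U (p + t *\<^sub>R a) \<bullet> a) (at t)" for t
    by (intro derivative_intros line_derivative)
  from MVT2[OF assms this] obtain t where t: "0 < t" "t < s"
    "(U (p + s *\<^sub>R b + s *\<^sub>R a) - U (p + s *\<^sub>R a)) - (U (p + s *\<^sub>R b + 0 *\<^sub>R a) - U (p + 0 *\<^sub>R a))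
      = (s - 0) * (gradient U (p + s *\<^sub>R b + t *\<^sub>R a) \<bullet> a - gradient U (p + t *\<^sub>R a) \<bullet> a)"
    by blast
  from MVT2[OF assms line_gradient_derivative[of "p + t *\<^sub>R a" b a]] obtain u where u: "0 < u" "u < s"
    "gradient U (p + t *\<^sub>R a + s *\<^sub>R b) \<bullet> a - gradient U (p + t *\<^sub>R a + 0 *\<^sub>R b) \<bullet> a
      = (s - 0) * ((hessian U (p + t *\<^sub>R a + u *\<^sub>R b) *v b) \<bullet> a)"
    by blast
  show ?thesis
  proof (rule that)
    have "norm (t *\<^sub>R a + u *\<^sub>R b) \<le> norm (t *\<^sub>R a) + norm (u *\<^sub>R b)" by (rule norm_triangle_ineq)
    also have "\<dots> \<le> s * norm a + s * norm b"
      using t u by (intro add_mono) (auto intro: mult_right_mono)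
    finally show "norm (p + t *\<^sub>R a + u *\<^sub>R b - p) \<le> s * (norm a + norm b)"
      by (simp add: distrib_left add.assoc)
    show "U (p + s *\<^sub>R a + s *\<^sub>R b) - U (p + s *\<^sub>R a) - U (p + s *\<^sub>R b) + U p
        = s\<^sup>2 * ((hessian U (p + t *\<^sub>R a + u *\<^sub>R b) *v b) \<bullet> a)"
      using t(3) u(3) by (simp add: add_ac power2_eq_square mult.assoc)
  qed
qed

text \<open>Schwarz's theorem: the mixed difference is symmetric in \<open>a\<close> and
  \<open>b\<close>, and divided by \<open>s\<^sup>2\<close> it approximates both Hessian forms by
  continuity.\<close>

lemma hessian_symmetric: "(hessian U p *v a) \<bullet> b = (hessian U p *v b) \<bullet> a"
proof (rule ccontr)
  let ?F = "\<lambda>z. (hessian U z *v b) \<bullet> a" and ?F' = "\<lambda>z. (hessian U z *v a) \<bullet> b"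
  assume "?F' p \<noteq> ?F p"
  define \<epsilon> where "\<epsilon> = \<bar>?F' p - ?F p\<bar> / 2"
  have \<epsilon>: "\<epsilon> > 0" using \<open>?F' p \<noteq> ?F p\<close> by (simp add: \<epsilon>_def)
  have "isCont ?F p" "isCont ?F' p"
    using continuous_on_hessian_form[of UNIV] by (simp_all add: continuous_on_eq_continuous_at)
  then obtain d d' where d: "d > 0" "\<And>z. norm (z - p) < d \<Longrightarrow> \<bar>?F z - ?F p\<bar> < \<epsilon>"
    and d': "d' > 0" "\<And>z. norm (z - p) < d' \<Longrightarrow> \<bar>?F' z - ?F' p\<bar> < \<epsilon>"
    using \<epsilon> unfolding continuous_at_eps_delta dist_norm real_norm_def by metis
  define s where "s = min d d' / (2 * (norm a + norm b + 1))"
  have s: "s > 0" using d d' by (simp add: s_def add_nonneg_pos)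
  have pos: "0 < 2 * (norm a + norm b + 1)" by (simp add: add_nonneg_pos)
  have "s * (2 * (norm a + norm b + 1)) = min d d'"
    using pos by (metis s_def less_irrefl nonzero_eq_divide_eq)
  moreover have "s * (norm a + norm b) \<le> s * (norm a + norm b + 1)"
    using s by (intro mult_left_mono) auto
  ultimately have sd: "s * (norm a + norm b) < d" "s * (norm a + norm b) < d'"
    using d(1) d'(1) min.cobounded1[of d d'] min.cobounded2[of d d'] by argo+
  obtain \<xi> where \<xi>: "norm (\<xi> - p) \<le> s * (norm a + norm b)"
    "U (p + s *\<^sub>R a + s *\<^sub>R b) - U (p + s *\<^sub>R a) - U (p + s *\<^sub>R b) + U p = s\<^sup>2 * ?F \<xi>"
    by (rule mixed_difference[OF s])
  obtain \<xi>' where \<xi>': "norm (\<xi>' - p) \<le> s * (norm b + norm a)"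
    "U (p + s *\<^sub>R b + s *\<^sub>R a) - U (p + s *\<^sub>R b) - U (p + s *\<^sub>R a) + U p = s\<^sup>2 * ?F' \<xi>'"
    by (rule mixed_difference[OF s])
  have comm: "p + s *\<^sub>R b + s *\<^sub>R a = p + s *\<^sub>R a + s *\<^sub>R b" by (simp add: add_ac)
  have "s\<^sup>2 * ?F \<xi> = s\<^sup>2 * ?F' \<xi>'"
    using \<xi>(2) \<xi>'(2) unfolding comm by linarith
  then have "?F \<xi> = ?F' \<xi>'" using s by simp
  moreover have "\<bar>?F \<xi> - ?F p\<bar> < \<epsilon>" using \<xi>(1) sd by (intro d(2)) linarith
  moreover have "\<bar>?F' \<xi>' - ?F' p\<bar> < \<epsilon>" using \<xi>'(1) sd by (intro d'(2)) (simp add: add.commute)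
  ultimately show False unfolding \<epsilon>_def by (simp add: abs_if split: if_splits)
qed

text \<open>By the mean value theorem for the gradient between \<open>- t\<close> and
  \<open>t\<close>, the function \<open>U (x + t *\<^sub>R e) + U (x - t *\<^sub>R e) + \<mu> *
  t\<^sup>2\<close> is nonincreasing for \<open>t \<ge> 0\<close>. The radius doubles because a
  point of the smaller ball is moved by up to \<open>r\<close>.\<close>

lemma second_difference:
  assumes e: "norm e = 1" and neg: "\<And>z. z \<in> ball p (2 * r) \<Longrightarrow> (hessian U z *v e) \<bullet> e \<le> - \<mu>"
    and x: "x \<in> ball p r" and s: "\<bar>s\<bar> < r"
  shows "U (x + s *\<^sub>R e) + U (x - s *\<^sub>R e) - 2 * U x \<le> - \<mu> * s\<^sup>2"
proof -
  have pos: "U (x + s *\<^sub>R e) + U (x - s *\<^sub>R e) - 2 * U x \<le> - \<mu> * s\<^sup>2" if s: "0 \<le> s" "s < r" for s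
  proof -
    define q where "q t = U (x + t *\<^sub>R e) + U (x + t *\<^sub>R (- e)) + \<mu> * t\<^sup>2" for t
    have "\<exists>d. (q has_real_derivative d) (at t) \<and> d \<le> 0" if t: "0 \<le> t" "t \<le> s" for t
    proof (intro exI conjI)
      show "(q has_real_derivative gradient U (x + t *\<^sub>R e) \<bullet> e + gradient U (x + t *\<^sub>R (- e)) \<bullet> (- e) + \<mu> * (2 * t)) (at t)"
        unfolding q_def
      proof (intro DERIV_add line_derivative)
        show "((\<lambda>t. \<mu> * t\<^sup>2) has_real_derivative \<mu> * (2 * t)) (at t)"
          by (auto intro!: derivative_eq_intros)
      qed
      show "gradient U (x + t *\<^sub>R e) \<bullet> e + gradient U (x + t *\<^sub>R (- e)) \<bullet> (- e) + \<mu> * (2 * t) \<le> 0"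
      proof (cases "t = 0")
        case False
        then have "- t < t" using t by simp
        from MVT2[OF this line_gradient_derivative[of x e e]] obtain u where u: "- t < u" "u < t"
          "gradient U (x + t *\<^sub>R e) \<bullet> e - gradient U (x + (- t) *\<^sub>R e) \<bullet> e = (t - - t) * ((hessian U (x + u *\<^sub>R e) *v e) \<bullet> e)"
          by blast
        have "dist p (x + u *\<^sub>R e) \<le> dist p x + dist x (x + u *\<^sub>R e)" by (rule dist_triangle)
        also have "dist x (x + u *\<^sub>R e) = \<bar>u\<bar>" using e by (simp add: dist_norm)
        finally have "x + u *\<^sub>R e \<in> ball p (2 * r)" using x u t s by simp
        from neg[OF this] have "(t - - t) * ((hessian U (x + u *\<^sub>R e) *v e) \<bullet> e) \<le> (t - - t) * - \<mu>"
          using t by (intro mult_left_mono) auto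
        then show ?thesis using u(3) by simp
      qed simp
    qed
    from DERIV_nonpos_imp_nonincreasing[OF s(1) this] have "q s \<le> q 0" by blast
    then show ?thesis by (simp add: q_def)
  qed
  show ?thesis
    using pos[of s] pos[of "- s"] s by (cases "0 \<le> s") (auto simp: add.commute)
qed

section \<open>Negative directions at hyperbolic critical points\<close>

lemma positive_definite_hessian:
  assumes nonneg: "\<And>e. 0 \<le> (hessian U p *v e) \<bullet> e" and inv: "invertible (hessian U p)" and e: "e \<noteq> 0"
  shows "0 < (hessian U p *v e) \<bullet> e"
proof (rule ccontr)
  let ?H = "hessian U p"
  let ?w = "?H *v e"
  assume "\<not> 0 < ?w \<bullet> e"
  then have e0: "?w \<bullet> e = 0" using nonneg[of e] by linarith
  define Q where "Q = (?H *v ?w) \<bullet> ?w"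
  \<comment> \<open>A null vector of a semidefinite symmetric form lies in the kernel: nonnegativity
    at \<open>e - t *\<^sub>R ?w\<close> bounds the norm of \<open>?w\<close> by a term that
    vanishes with \<open>t\<close>.\<close>
  have key: "2 * (?w \<bullet> ?w) \<le> t * Q" if t: "t > 0" for t
  proof -
    have "0 \<le> (?H *v (e - t *\<^sub>R ?w)) \<bullet> (e - t *\<^sub>R ?w)" by (rule nonneg)
    also have "\<dots> = ?w \<bullet> e - t * (?w \<bullet> ?w) - t * ((?H *v ?w) \<bullet> e) + t * (t * Q)"
      by (simp add: Q_def matrix_vector_mult_diff_distrib matrix_vector_mult_scaleR inner_diff_left
          inner_diff_right algebra_simps)
    also have "(?H *v ?w) \<bullet> e = ?w \<bullet> ?w" by (rule hessian_symmetric)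
    finally have "t * (2 * (?w \<bullet> ?w)) \<le> t * (t * Q)" using e0 by argo
    then show ?thesis using t by simp
  qed
  have "((\<lambda>t. t * Q) \<longlongrightarrow> 0 * Q) (at_right 0)" by (intro tendsto_intros)
  then have "2 * (?w \<bullet> ?w) \<le> 0 * Q"
  proof (rule tendsto_lowerbound)
    show "\<forall>\<^sub>F t in at_right 0. 2 * (?w \<bullet> ?w) \<le> t * Q"
      by (rule eventually_mono[OF eventually_at_right_less key])
  qed simp
  then have "?w \<bullet> ?w = 0" using inner_ge_zero[of ?w] by linarith
  then have "?w = 0" by simp
  then show False
    using inv e by (metis invertible_def matrix_left_invertible_ker)
qed

text \<open>By compactness of the unit sphere the form is at least
  \<open>c * (norm e)\<^sup>2\<close>, and near \<open>p\<close> the linearization error of the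
  gradient takes away at most half of this. Thus \<open>U\<close> increases along the rays from
  \<open>p\<close>.\<close>

lemma gradient_points_outward:
  assumes g0: "gradient U p = 0" and pos: "\<And>e. e \<noteq> 0 \<Longrightarrow> 0 < (hessian U p *v e) \<bullet> e"
  obtains d where "d > 0" "\<And>z. \<lbrakk>z \<noteq> p; dist z p < d\<rbrakk> \<Longrightarrow> 0 < gradient U z \<bullet> (z - p)"
proof -
  let ?H = "hessian U p"
  have ne: "sphere (0 :: real ^ 'n) 1 \<noteq> {}" by simp
  have "continuous_on (sphere 0 1) (\<lambda>e. (?H *v e) \<bullet> e)"
    by (intro continuous_intros linear_continuous_on matrix_vector_mul_bounded_linear)
  from continuous_attains_inf[OF compact_sphere ne this]
  obtain e0 where e0: "e0 \<in> sphere 0 1" "\<And>e. e \<in> sphere 0 1 \<Longrightarrow> (?H *v e0) \<bullet> e0 \<le> (?H *v e) \<bullet> e" by blast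
  define c where "c = (?H *v e0) \<bullet> e0"
  have "e0 \<noteq> 0" using e0(1) by auto
  then have c: "c > 0" unfolding c_def by (rule pos)
  have quad: "c * (norm e)\<^sup>2 \<le> (?H *v e) \<bullet> e" for e
  proof (cases "e = 0")
    case False
    then have "c \<le> (?H *v (e /\<^sub>R norm e)) \<bullet> (e /\<^sub>R norm e)" unfolding c_def by (intro e0(2)) simp
    also have "\<dots> = ((?H *v e) \<bullet> e) / (norm e)\<^sup>2"
      by (simp add: matrix_vector_mult_scaleR power2_eq_square divide_inverse mult_ac)
    finally show ?thesis using False by (simp add: pos_le_divide_eq)
  qed simp
  obtain d where d: "d > 0"
    "\<And>z. norm (z - p) < d \<Longrightarrow> norm (gradient U z - gradient U p - ?H *v (z - p)) \<le> c / 2 * norm (z - p)"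
    using gradient_has_derivative[of p] c unfolding has_derivative_at_alt by (metis half_gt_zero)
  show ?thesis
  proof (rule that[OF d(1)])
    fix z assume z: "z \<noteq> p" "dist z p < d"
    let ?r = "gradient U z - ?H *v (z - p)"
    have "\<bar>?r \<bullet> (z - p)\<bar> \<le> norm ?r * norm (z - p)" by (rule Cauchy_Schwarz_ineq2)
    also have "\<dots> \<le> c / 2 * norm (z - p) * norm (z - p)"
      using d(2)[of z] z(2) g0 by (intro mult_right_mono) (auto simp: dist_norm)
    finally have "\<bar>?r \<bullet> (z - p)\<bar> \<le> c / 2 * (norm (z - p))\<^sup>2" by (simp add: power2_eq_square)
    moreover have "c / 2 * (norm (z - p))\<^sup>2 > 0" using z c by simp
    moreover have "?r \<bullet> (z - p) = gradient U z \<bullet> (z - p) - (?H *v (z - p)) \<bullet> (z - p)"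
      by (rule inner_diff_left)
    ultimately show "0 < gradient U z \<bullet> (z - p)" using quad[of "z - p"] by linarith
  qed
qed

text \<open>If the Hessian were positive semidefinite, \<open>p\<close> would be an isolated zero of \<open>U\<close>.\<close>

lemma unstable_direction:
  assumes p: "p \<in> \<Gamma>" and con: "connected \<Gamma>" and ne: "\<Gamma> \<noteq> {p}" and zero: "\<And>z. z \<in> \<Gamma> \<Longrightarrow> U z = 0"
    and g0: "gradient U p = 0" and inv: "invertible (hessian U p)"
  obtains e where "norm e = 1" "(hessian U p *v e) \<bullet> e < 0"
proof -
  have "\<exists>e. (hessian U p *v e) \<bullet> e < 0"
  proof (rule ccontr)
    assume "\<not> ?thesis"
    then have nonneg: "0 \<le> (hessian U p *v e) \<bullet> e" for e by (simp add: not_less)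
    obtain d where d: "d > 0" "\<And>z. \<lbrakk>z \<noteq> p; dist z p < d\<rbrakk> \<Longrightarrow> 0 < gradient U z \<bullet> (z - p)"
      using gradient_points_outward[OF g0 positive_definite_hessian[OF nonneg inv]] by blast
    have "\<Gamma> \<noteq> {x}" for x using ne p by auto
    then have "p islimpt \<Gamma>" by (intro connected_imp_perfect con p)
    then obtain z where z: "z \<in> \<Gamma>" "z \<noteq> p" "dist z p < d"
      using d(1) unfolding islimpt_approachable by blast
    \<comment> \<open>\<open>U\<close> vanishes at both ends of the segment from \<open>p\<close> to
      \<open>z\<close>, so its radial derivative must vanish somewhere in between.\<close>
    from MVT2[OF zero_less_one line_derivative[of p "z - p"]] obtain t where t: "0 < t" "t < 1"
      "U (p + 1 *\<^sub>R (z - p)) - U (p + 0 *\<^sub>R (z - p)) = (1 - 0) * (gradient U (p + t *\<^sub>R (z - p)) \<bullet> (z - p))"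
      by blast
    let ?y = "p + t *\<^sub>R (z - p)"
    have "t * norm (z - p) \<le> 1 * norm (z - p)" using t by (intro mult_right_mono) auto
    then have "dist ?y p < d" using z(3) t by (simp add: dist_norm)
    moreover have "?y \<noteq> p" using z(2) t by simp
    ultimately have "0 < gradient U ?y \<bullet> (?y - p)" using d(2) by blast
    then have "0 < gradient U ?y \<bullet> (z - p)" using t by (simp add: zero_less_mult_iff)
    then show False using t(3) zero[OF z(1)] zero[OF p] by simp
  qed
  then obtain e where e: "(hessian U p *v e) \<bullet> e < 0" by blast
  then have "e \<noteq> 0" by auto
  show ?thesis
  proof (rule that[of "e /\<^sub>R norm e"])
    show "norm (e /\<^sub>R norm e) = 1" using \<open>e \<noteq> 0\<close> by simp
    have "(hessian U p *v (e /\<^sub>R norm e)) \<bullet> (e /\<^sub>R norm e) = ((hessian U p *v e) \<bullet> e) * (inverse (norm e) * inverse (norm e))"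
      by (simp add: matrix_vector_mult_scaleR mult_ac)
    also have "\<dots> < 0" using e \<open>e \<noteq> 0\<close> by (intro mult_neg_pos) auto
    finally show "(hessian U p *v (e /\<^sub>R norm e)) \<bullet> (e /\<^sub>R norm e) < 0" .
  qed
qed

lemma unstable_near:
  assumes "norm e = 1" "(hessian U p *v e) \<bullet> e < 0"
  obtains r \<mu> where "r > 0" "\<mu> > 0" "\<And>z. z \<in> ball p r \<Longrightarrow> (hessian U z *v e) \<bullet> e \<le> - \<mu>"
proof -
  define \<mu> where "\<mu> = - ((hessian U p *v e) \<bullet> e) / 2"
  have \<mu>: "\<mu> > 0" using assms by (simp add: \<mu>_def)
  have "isCont (\<lambda>z. (hessian U z *v e) \<bullet> e) p"
    using continuous_on_hessian_form[of UNIV] by (simp add: continuous_on_eq_continuous_at)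
  then obtain r where r: "r > 0" "\<And>z. dist z p < r \<Longrightarrow> \<bar>(hessian U z *v e) \<bullet> e - (hessian U p *v e) \<bullet> e\<bar> < \<mu>"
    using \<mu> unfolding continuous_at_eps_delta dist_real_def by metis
  show ?thesis
  proof (rule that[OF r(1) \<mu>])
    fix z assume "z \<in> ball p r"
    then have "dist z p < r" by (simp add: dist_commute)
    from r(2)[OF this] show "(hessian U z *v e) \<bullet> e \<le> - \<mu>" unfolding \<mu>_def by (simp add: abs_if split: if_splits)
  qed
qed

text \<open>Finiteness of the critical set enters here: it allows common constants to be taken as
  minima.\<close>

lemma uniformly_unstable:
  assumes "finite P"
    and "\<And>p. p \<in> P \<Longrightarrow> \<exists>e. norm e = 1 \<and> (hessian U p *v e) \<bullet> e < 0"
  obtains r \<mu> where "r > 0" "\<mu> > 0"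
    "\<And>p. p \<in> P \<Longrightarrow> \<exists>e. norm e = 1 \<and> (\<forall>z\<in>ball p r. (hessian U z *v e) \<bullet> e \<le> - \<mu>)"
proof -
  have "\<exists>r>0. \<exists>\<mu>>0. \<forall>p\<in>P. \<exists>e. norm e = 1 \<and> (\<forall>z\<in>ball p r. (hessian U z *v e) \<bullet> e \<le> - \<mu>)"
    using assms
  proof (induction P rule: finite_induct)
    case empty
    then show ?case by (auto intro: exI[of _ 1])
  next
    case (insert q P)
    have "\<exists>e. norm e = 1 \<and> (hessian U p *v e) \<bullet> e < 0" if "p \<in> P" for p
      using insert.prems[of p] that by simp
    from insert.IH[OF this] obtain r \<mu> where 1: "r > 0" "\<mu> > 0"
      "\<And>p. p \<in> P \<Longrightarrow> \<exists>e. norm e = 1 \<and> (\<forall>z\<in>ball p r. (hessian U z *v e) \<bullet> e \<le> - \<mu>)"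
      by blast
    obtain e where e: "norm e = 1" "(hessian U q *v e) \<bullet> e < 0" using insert.prems by blast
    obtain r' \<mu>' where 2: "r' > 0" "\<mu>' > 0" "\<And>z. z \<in> ball q r' \<Longrightarrow> (hessian U z *v e) \<bullet> e \<le> - \<mu>'"
      using unstable_near[OF e] by blast
    have "\<exists>e. norm e = 1 \<and> (\<forall>z\<in>ball p (min r r'). (hessian U z *v e) \<bullet> e \<le> - min \<mu> \<mu>')"
      if "p \<in> insert q P" for p
    proof (cases "p = q")
      case True
      have "(hessian U z *v e) \<bullet> e \<le> - min \<mu> \<mu>'" if "z \<in> ball p (min r r')" for z
        using 2(3)[of z] that True by simp
      then show ?thesis using e(1) by blast
    next
      case False
      then have "p \<in> P" using that by simp
      from 1(3)[OF this]
      obtain e' where e': "norm e' = 1" "\<And>z. z \<in> ball p r \<Longrightarrow> (hessian U z *v e') \<bullet> e' \<le> - \<mu>"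
        by blast
      have "(hessian U z *v e') \<bullet> e' \<le> - min \<mu> \<mu>'" if "z \<in> ball p (min r r')" for z
        using e'(2)[of z] that by simp
      then show ?thesis using e'(1) by blast
    qed
    moreover have "min r r' > 0" "min \<mu> \<mu>' > 0" using 1 2 by auto
    ultimately show ?case by blast
  qed
  then show ?thesis using that by blast
qed

text \<open>Segments between points of \<open>S\<close> may leave \<open>S\<close>, so all estimates
  are made on a ball containing it, which is convex and compact.\<close>

lemma local_bounds:
  assumes "bounded S"
  obtains G M Um where "G > 0" "M > 0" "Um > 0"
    "\<And>x. x \<in> S \<Longrightarrow> U x \<le> Um"
    "\<And>x. x \<in> S \<Longrightarrow> norm (gradient U x) \<le> G"
    "\<And>x y. \<lbrakk>x \<in> S; y \<in> S\<rbrakk> \<Longrightarrow> norm (gradient U y - gradient U x) \<le> M * norm (y - x)"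
    "\<And>x y. \<lbrakk>x \<in> S; y \<in> S\<rbrakk> \<Longrightarrow> \<bar>U y - U x\<bar> \<le> G * norm (y - x)"
    "\<And>x y. \<lbrakk>x \<in> S; y \<in> S\<rbrakk> \<Longrightarrow> \<bar>U y - U x - gradient U x \<bullet> (y - x)\<bar> \<le> M * (norm (y - x))\<^sup>2"
proof -
  obtain R where R: "S \<subseteq> cball 0 R" using bounded_subset_ballD[OF assms, of 0] ball_subset_cball by (meson order_trans)
  let ?B = "cball (0 :: real ^ 'n) R"
  have bd: "\<exists>b>0. \<forall>x\<in>?B. norm (f x) \<le> b" if "continuous_on ?B f" for f :: "real ^ 'n \<Rightarrow> 'b::real_normed_vector"
  proof -
    have "bounded (f ` ?B)" by (rule compact_imp_bounded[OF compact_continuous_image[OF that compact_cball]])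
    then obtain b where "b > 0" "\<forall>y\<in>f ` ?B. norm y \<le> b" unfolding bounded_pos by blast
    then show ?thesis by blast
  qed
  have "continuous_on ?B U"
    by (rule continuous_at_imp_continuous_on) (intro ballI has_derivative_continuous[OF U_has_derivative])
  from bd[OF this] obtain Um where Um: "Um > 0" "\<And>x. x \<in> ?B \<Longrightarrow> norm (U x) \<le> Um" by blast
  from bd[OF continuous_on_gradient] obtain G where G: "G > 0" "\<And>x. x \<in> ?B \<Longrightarrow> norm (gradient U x) \<le> G" by blast
  from bd[OF continuous_on_hessian] obtain b where b: "b > 0" "\<And>x. x \<in> ?B \<Longrightarrow> norm (hessian U x) \<le> b" by blast
  obtain k where k: "k > 0" "\<And>(A :: real ^ 'n ^ 'n) v. norm (A *v v) \<le> norm A * norm v * k"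
    using bounded_bilinear.pos_bounded[OF bounded_bilinear_matrix_vector_mult] by blast
  define M where "M = b * k"
  have M: "M > 0" using b k by (simp add: M_def)
  have HM: "norm (hessian U x *v v) \<le> M * norm v" if "x \<in> ?B" for x v
  proof -
    have "norm (hessian U x *v v) \<le> norm (hessian U x) * (norm v * k)" using k(2) by (simp add: mult.assoc)
    also have "\<dots> \<le> b * (norm v * k)" using b(2)[OF that] k(1) by (intro mult_right_mono) auto
    finally show ?thesis by (simp add: M_def mult_ac)
  qed
  have inner_le: "onorm (\<lambda>h. a \<bullet> h) \<le> norm a" for a :: "real ^ 'n"
    by (rule onorm_le) (simp add: Cauchy_Schwarz_ineq2)
  have g_lip: "norm (gradient U y - gradient U x) \<le> M * norm (y - x)" if "x \<in> ?B" "y \<in> ?B" for x y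
  proof (rule differentiable_bound[OF convex_cball _ _ that(2,1)])
    show "(gradient U has_derivative (\<lambda>h. hessian U z *v h)) (at z within ?B)" for z
      by (rule has_derivative_at_withinI[OF gradient_has_derivative])
    show "onorm (\<lambda>h. hessian U z *v h) \<le> M" if "z \<in> ?B" for z
      by (rule onorm_le) (rule HM[OF that])
  qed
  have U_lip: "\<bar>U y - U x\<bar> \<le> G * norm (y - x)" if "x \<in> ?B" "y \<in> ?B" for x y
    unfolding real_norm_def[symmetric]
  proof (rule differentiable_bound[OF convex_cball _ _ that(2,1)])
    show "(U has_derivative (\<lambda>h. gradient U z \<bullet> h)) (at z within ?B)" for z
      by (rule has_derivative_at_withinI[OF U_has_derivative])
    show "onorm (\<lambda>h. gradient U z \<bullet> h) \<le> G" if "z \<in> ?B" for z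
      by (rule order_trans[OF inner_le G(2)[OF that]])
  qed
  have taylor: "\<bar>U y - U x - gradient U x \<bullet> (y - x)\<bar> \<le> M * (norm (y - x))\<^sup>2" if xy: "x \<in> ?B" "y \<in> ?B" for x y
  proof -
    \<comment> \<open>Once the linear part at \<open>x\<close> is subtracted, the gradient along the
      segment is at most \<open>M * norm (y - x)\<close>.\<close>
    have "norm ((U y - gradient U x \<bullet> y) - (U x - gradient U x \<bullet> x)) \<le> (M * norm (y - x)) * norm (y - x)"
    proof (rule differentiable_bound[OF convex_closed_segment[of x y]])
      fix z assume z: "z \<in> closed_segment x y"
      show "((\<lambda>z. U z - gradient U x \<bullet> z) has_derivative (\<lambda>h. (gradient U z - gradient U x) \<bullet> h))
          (at z within closed_segment x y)"
        by (rule has_derivative_at_withinI)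
          (auto intro!: derivative_eq_intros U_has_derivative simp: inner_diff_left)
      have "z \<in> ?B" using z xy convex_cball[of 0 R] by (meson closed_segment_subset subsetD)
      then have "norm (gradient U z - gradient U x) \<le> M * norm (z - x)" using g_lip xy by blast
      also have "\<dots> \<le> M * norm (y - x)"
        using segment_bound1[OF z] M by (intro mult_left_mono) auto
      finally show "onorm (\<lambda>h. (gradient U z - gradient U x) \<bullet> h) \<le> M * norm (y - x)"
        by (rule order_trans[OF inner_le])
    qed auto
    then show ?thesis by (simp add: inner_diff_right power2_eq_square algebra_simps)
  qed
  show ?thesis
  proof (rule that[OF G(1) M Um(1)])
    show "U x \<le> Um" if "x \<in> S" for x using Um(2)[of x] R that by (auto simp: abs_le_iff)
    show "norm (gradient U x) \<le> G" if "x \<in> S" for x using G(2)[of x] R that by blast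
    fix x y assume "x \<in> S" "y \<in> S"
    then have xy: "x \<in> ?B" "y \<in> ?B" using R by auto
    show "norm (gradient U y - gradient U x) \<le> M * norm (y - x)" by (rule g_lip[OF xy])
    show "\<bar>U y - U x\<bar> \<le> G * norm (y - x)" by (rule U_lip[OF xy])
    show "\<bar>U y - U x - gradient U x \<bullet> (y - x)\<bar> \<le> M * (norm (y - x))\<^sup>2" by (rule taylor[OF xy])
  qed
qed

end

section \<open>The periodic orbit\<close>

text \<open>A frontier point with \<open>U x > 0\<close> could be added to the component without
  losing connectedness, against maximality.\<close>

lemma frontier_component_zero:
  fixes U :: "'a::real_normed_vector \<Rightarrow> real"
  assumes U: "continuous_on UNIV U" and \<Omega>: "\<Omega> \<in> components {x. U x > 0}" and x: "x \<in> frontier \<Omega>"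
  shows "U x = 0"
proof (rule antisym)
  have op: "open {x. U x > 0}" by (intro open_Collect_less continuous_on_const U)
  have "open \<Omega>" by (rule open_components[OF op \<Omega>])
  have xc: "x \<in> closure \<Omega>" using x by (simp add: frontier_def)
  have "\<Omega> \<subseteq> {x. 0 \<le> U x}" using in_components_subset[OF \<Omega>] by auto
  then have "closure \<Omega> \<subseteq> {x. 0 \<le> U x}"
    by (rule closure_minimal) (intro closed_Collect_le continuous_on_const U)
  then show "0 \<le> U x" using xc by auto
  show "U x \<le> 0"
  proof (rule ccontr)
    assume n: "\<not> U x \<le> 0"
    have "connected (insert x \<Omega>)"
      by (rule connected_intermediate_closure[OF in_components_connected[OF \<Omega>]])
        (use xc closure_subset in auto)
    moreover have "insert x \<Omega> \<subseteq> {x. U x > 0}" using in_components_subset[OF \<Omega>] n by auto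
    moreover have "\<Omega> \<inter> insert x \<Omega> \<noteq> {}" using in_components_nonempty[OF \<Omega>] by auto
    ultimately have "x \<in> \<Omega>" using components_maximal[OF \<Omega>] by blast
    then show False using x \<open>open \<Omega>\<close> by (simp add: frontier_def interior_open)
  qed
qed

text \<open>The mirror image is connected, lies in the positivity set and shares the point
  \<open>0\<close> with \<open>\<Omega>\<close>, so maximality applies.\<close>

lemma symmetric_component:
  fixes U :: "'a::real_normed_vector \<Rightarrow> real"
  assumes \<Omega>: "\<Omega> \<in> components {x. U x > 0}" and 0: "0 \<in> \<Omega>" and sym: "\<And>x. x \<in> \<Omega> \<Longrightarrow> U (- x) = U x"
    and x: "x \<in> \<Omega>"
  shows "- x \<in> \<Omega>"
proof -
  have "connected (uminus ` \<Omega>)"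
    by (rule connected_continuous_image[OF _ in_components_connected[OF \<Omega>]]) (intro continuous_intros)
  moreover have "uminus ` \<Omega> \<subseteq> {x. U x > 0}" using in_components_subset[OF \<Omega>] sym by auto
  moreover have "0 \<in> uminus ` \<Omega>" using 0 by force
  ultimately have "uminus ` \<Omega> \<subseteq> \<Omega>" using components_maximal[OF \<Omega>] 0 by blast
  then show ?thesis using x by blast
qed

text \<open>Evenness is known on \<open>\<Omega>\<close> only; continuity carries the identity to
  the closure, where the turning point of the orbit lies.\<close>

lemma gradient_odd:
  fixes U :: "real ^ 'n \<Rightarrow> real"
  assumes C2: "class_C2 U" and op: "open \<Omega>" and neg: "\<And>x. x \<in> \<Omega> \<Longrightarrow> - x \<in> \<Omega>"
    and sym: "\<And>x. x \<in> \<Omega> \<Longrightarrow> U (- x) = U x" and x: "x \<in> closure \<Omega>"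
  shows "gradient U (- x) = - gradient U x"
proof -
  have "gradient U (- x) + gradient U x = 0"
  proof (rule continuous_constant_on_closure[OF _ _ x])
    show "continuous_on (closure \<Omega>) (\<lambda>x. gradient U (- x) + gradient U x)"
      by (intro continuous_intros continuous_on_compose2[OF continuous_on_gradient[OF C2, of UNIV]]
          continuous_on_gradient[OF C2]) auto
    fix x assume x: "x \<in> \<Omega>"
    have "((\<lambda>x. U (- x)) has_derivative (\<lambda>h. gradient U (- x) \<bullet> (- h))) (at x)"
      by (rule has_derivative_compose[OF _ U_has_derivative[OF C2]]) (auto intro!: derivative_eq_intros)
    then have "(U has_derivative (\<lambda>h. gradient U (- x) \<bullet> (- h))) (at x)"
      by (rule has_derivative_transform_within_open[OF _ op x]) (rule sym)
    then have "(\<lambda>h. gradient U (- x) \<bullet> (- h)) = (\<lambda>h. gradient U x \<bullet> h)"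
      by (rule has_derivative_unique[OF _ U_has_derivative[OF C2]])
    then have "(gradient U (- x) + gradient U x) \<bullet> h = 0" for h
      by (simp add: fun_eq_iff inner_add_left) (metis add.right_inverse)
    then show "gradient U (- x) + gradient U x = 0" by (metis inner_eq_zero_iff)
  qed
  then show ?thesis by (simp add: eq_neg_iff_add_eq_0)
qed

theorem corollary1p6:
  fixes U :: "real ^ 'n \<Rightarrow> real"
    and \<Omega> :: "(real ^ 'n) set"
    and N :: nat
    and \<Gamma> :: "nat \<Rightarrow> (real ^ 'n) set"
  assumes "class_C2 U"
    and "\<Omega> \<in> components {x. U x > 0}"
    and "compact (frontier \<Omega>)"
    and "N \<ge> 1"
    and "bij_betw \<Gamma> {1..N} (components (frontier \<Omega>))"
    and "\<forall>i\<in>{1..N}. diameter (\<Gamma> i) > 0"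
    and "bounded \<Omega>"
    and "0 \<in> \<Omega>"
    and "\<forall>x\<in>\<Omega>. U (- x) = U x"
    and "finite {p \<in> frontier \<Omega>. critical_point U p}"
    and "\<forall>p\<in>{p \<in> frontier \<Omega>. critical_point U p}. hyperbolic_critical_point U p"
  shows "\<exists>\<Gamma>p \<in> \<Gamma> ` {1..N}. \<exists>Tp :: real. \<exists>v v' :: real \<Rightarrow> real ^ 'n.
           Tp > 0 \<and>
           (\<forall>t. v t \<in> closure \<Omega>) \<and>
           (\<forall>t. v (t + 4 * Tp) = v t) \<and>
           (\<forall>t. (v has_vector_derivative v' t) (at t) \<and>
                (v' has_vector_derivative gradient U (v t)) (at t) \<and>
                (1 / 2) * (norm (v' t))\<^sup>2 - U (v t) = 0 \<and>
                v (- t) = - v t) \<and>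
           v ` {0<..<Tp} \<subseteq> \<Omega> \<and>
           ((\<lambda>t. infdist (v t) \<Gamma>p) \<longlongrightarrow> 0) (at_left Tp)"
proof -
  note C2 = assms(1) and comp = assms(2)
  have cU: "continuous_on UNIV U"
    by (rule continuous_at_imp_continuous_on) (intro ballI has_derivative_continuous[OF U_has_derivative[OF C2]])
  have op: "open \<Omega>"
    by (rule open_components[OF _ comp]) (intro open_Collect_less continuous_on_const cU)
  have zero: "U x = 0" if "x \<in> frontier \<Omega>" for x
    by (rule frontier_component_zero[OF cU comp that])
  have sym: "U (- x) = U x" if "x \<in> \<Omega>" for x using assms(9) that by blast
  have neg: "- x \<in> \<Omega>" if "x \<in> \<Omega>" for x
    by (rule symmetric_component[OF comp assms(8) sym that])
  have odd: "gradient U (- x) = - gradient U x" if "x \<in> closure \<Omega>" for x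
    by (rule gradient_odd[OF C2 op neg sym that])
  have in_component: "\<exists>i\<in>{1..N}. x \<in> \<Gamma> i" if "x \<in> frontier \<Omega>" for x
  proof -
    have "x \<in> \<Union> (components (frontier \<Omega>))" using that by (simp only: Union_components)
    then show ?thesis using bij_betw_imp_surj_on[OF assms(5)] by blast
  qed
  have comp_i: "\<Gamma> i \<in> components (frontier \<Omega>)" if "i \<in> {1..N}" for i
    using bij_betwE[OF assms(5)] that by blast
  let ?P = "{p \<in> frontier \<Omega>. critical_point U p}"
  have "\<exists>e. norm e = 1 \<and> (hessian U p *v e) \<bullet> e < 0" if p: "p \<in> ?P" for p
  proof -
    obtain i where i: "i \<in> {1..N}" "p \<in> \<Gamma> i" using in_component p by blast
    have hyp: "gradient U p = 0" "invertible (hessian U p)"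
      using assms(11) p unfolding hyperbolic_critical_point_def critical_point_def by auto
    \<comment> \<open>A single point has diameter 0.\<close>
    have "\<Gamma> i \<noteq> {p}" using bspec[OF assms(6) i(1)] by (auto simp: diameter_singleton)
    moreover have "U z = 0" if "z \<in> \<Gamma> i" for z
      using zero in_components_subset[OF comp_i[OF i(1)]] that by blast
    ultimately obtain e where "norm e = 1" "(hessian U p *v e) \<bullet> e < 0"
      using unstable_direction[OF C2 i(2) in_components_connected[OF comp_i[OF i(1)]] _ _ hyp] by blast
    then show ?thesis by blast
  qed
  from uniformly_unstable[OF C2 assms(10) this] obtain r \<mu> where r: "r > 0" and \<mu>: "\<mu> > 0"
    and unst: "\<And>p. p \<in> ?P \<Longrightarrow> \<exists>e. norm e = 1 \<and> (\<forall>z\<in>ball p r. (hessian U z *v e) \<bullet> e \<le> - \<mu>)"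
    by blast
  have "bounded (closure \<Omega>)" by (rule bounded_closure[OF assms(7)])
  from local_bounds[OF C2 this] obtain G M Um where bounds: "G > 0" "M > 0" "Um > 0"
    "\<And>x. x \<in> closure \<Omega> \<Longrightarrow> U x \<le> Um"
    "\<And>x. x \<in> closure \<Omega> \<Longrightarrow> norm (gradient U x) \<le> G"
    "\<And>x y. \<lbrakk>x \<in> closure \<Omega>; y \<in> closure \<Omega>\<rbrakk> \<Longrightarrow> norm (gradient U y - gradient U x) \<le> M * norm (y - x)"
    "\<And>x y. \<lbrakk>x \<in> closure \<Omega>; y \<in> closure \<Omega>\<rbrakk> \<Longrightarrow> \<bar>U y - U x\<bar> \<le> G * norm (y - x)"
    "\<And>x y. \<lbrakk>x \<in> closure \<Omega>; y \<in> closure \<Omega>\<rbrakk> \<Longrightarrow> \<bar>U y - U x - gradient U x \<bullet> (y - x)\<bar> \<le> M * (norm (y - x))\<^sup>2"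
    by blast
  \<comment> \<open>Half the radius, since \<open>second_difference\<close> needs the Hessian bound
    on a ball twice as large.\<close>
  interpret unstable_well U "gradient U" \<Omega> G M Um "r / 2" \<mu>
  proof unfold_locales
    show "0 < U x" if "x \<in> \<Omega>" for x using in_components_subset[OF comp] that by auto
    show "r / 2 > 0" using r by simp
    fix p assume "p \<in> frontier \<Omega>" "gradient U p = 0"
    then obtain e where e: "norm e = 1" "\<And>z. z \<in> ball p r \<Longrightarrow> (hessian U z *v e) \<bullet> e \<le> - \<mu>"
      using unst[of p] unfolding critical_point_def by blast
    have "U (y + s *\<^sub>R e) + U (y - s *\<^sub>R e) - 2 * U y \<le> - \<mu> * s\<^sup>2"
      if "y \<in> ball p (r / 2)" "\<bar>s\<bar> < r / 2" for y s
      by (rule second_difference[OF C2 e(1) _ that]) (use e(2) in simp)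
    then show "\<exists>e. norm e = 1 \<and> (\<forall>y\<in>ball p (r / 2). \<forall>s. \<bar>s\<bar> < r / 2 \<longrightarrow>
        U (y + s *\<^sub>R e) + U (y - s *\<^sub>R e) - 2 * U y \<le> - \<mu> * s\<^sup>2)"
      using e(1) by blast
  qed (fact op assms(7) assms(8) U_has_derivative[OF C2] zero bounds \<mu>)+
  obtain T v y where T: "T > 0" and v0: "v 0 = 0" and vT: "v T \<in> frontier \<Omega>" and yT: "y T = 0"
    and v_in: "\<And>t. t \<in> {0..<T} \<Longrightarrow> v t \<in> \<Omega>"
    and dv: "\<And>t. t \<in> {0..T} \<Longrightarrow> (v has_vector_derivative y t) (at t within {0..T})"
    and dy: "\<And>t. t \<in> {0..T} \<Longrightarrow> (y has_vector_derivative gradient U (v t)) (at t within {0..T})"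
    and en: "\<And>t. t \<in> {0..T} \<Longrightarrow> (norm (y t))\<^sup>2 / 2 = U (v t)"
    by (rule brake_orbit) (rule that)
  have v_cl: "v t \<in> closure \<Omega>" if "t \<in> {0..T}" for t
    using v_in[of t] vT that Omega_in_closure frontier_in_closure by (cases "t = T") auto
  \<comment> \<open>The extension also runs through the mirror image of the orbit, frontier point
    included.\<close>
  have neg_cl: "- x \<in> closure \<Omega> \<and> U (- x) = U x" if x: "x \<in> closure \<Omega>" for x
  proof
    have "closed (uminus -` closure \<Omega>)" by (intro closed_vimage closed_closure continuous_intros)
    then have "closure \<Omega> \<subseteq> uminus -` closure \<Omega>"
      using neg Omega_in_closure by (intro closure_minimal) auto
    then show "- x \<in> closure \<Omega>" using x by blast
    have "U (- x) - U x = 0"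
      by (rule continuous_constant_on_closure[OF _ _ x])
        (auto intro!: continuous_intros continuous_on_compose2[OF cU] simp: sym)
    then show "U (- x) = U x" by simp
  qed
  have g_odd: "gradient U (- v t) = - gradient U (v t)" if "t \<in> {0..T}" for t
    by (rule odd[OF v_cl[OF that]])
  obtain w w' where w: "\<And>t. (w has_vector_derivative w' t) (at t)"
    "\<And>t. (w' has_vector_derivative gradient U (w t)) (at t)"
    "\<And>t. w (t + 4 * T) = w t" "\<And>t. w (- t) = - w t"
    "\<And>t. t \<in> {0..T} \<Longrightarrow> w t = v t"
    "\<And>t. \<exists>s\<in>{0..T}. (w t = v s \<or> w t = - v s) \<and> norm (w' t) = norm (y s)"
    by (rule periodic_extension[where v = v and y = y and g = "gradient U", OF T v0 yT])
      (rule dv dy g_odd that; assumption)+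
  have wt: "w t \<in> closure \<Omega>" "(1 / 2) * (norm (w' t))\<^sup>2 - U (w t) = 0" for t
  proof -
    obtain s where s: "s \<in> {0..T}" "w t = v s \<or> w t = - v s" "norm (w' t) = norm (y s)" using w(6) by blast
    show "w t \<in> closure \<Omega>" using s(2) v_cl[OF s(1)] neg_cl by metis
    have "U (w t) = U (v s)" using s(2) neg_cl[OF v_cl[OF s(1)]] by metis
    then show "(1 / 2) * (norm (w' t))\<^sup>2 - U (w t) = 0" using en[OF s(1)] s(3) by simp
  qed
  \<comment> \<open>The component sought is the one containing the turning point
    \<open>v T\<close>.\<close>
  obtain i where i: "i \<in> {1..N}" "v T \<in> \<Gamma> i" using in_component[OF vT] by blast
  have "isCont w T" by (rule has_vector_derivative_continuous[OF w(1)])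
  then have "(w \<longlongrightarrow> w T) (at_left T)" by (simp add: continuous_within filterlim_at_split)
  then have "((\<lambda>t. infdist (w t) (\<Gamma> i)) \<longlongrightarrow> infdist (w T) (\<Gamma> i)) (at_left T)"
    by (rule tendsto_infdist)
  moreover have "infdist (w T) (\<Gamma> i) = 0" using w(5)[of T] T i(2) by simp
  moreover have "w ` {0<..<T} \<subseteq> \<Omega>" using w(5) v_in by auto
  ultimately show ?thesis
    using i(1) T w wt by (intro bexI[of _ "\<Gamma> i"] exI[of _ T] exI[of _ w] exI[of _ w'] conjI allI imageI) auto
qed

end
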